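(* Consider the PBFT-light protocol run on top of the SMR synchronizer algorithm (both described in the context), with timeout durations capped as described there and with the optimization that in view $1$ processes do not exchange $\mathtt{NEW\_LEADER}$ messages. Assume that all correct processes start the protocol after $\mathsf{GST}$ with $\mathsf{dur\_recovery}>5\delta$ and $\mathsf{dur\_delivery}>4\delta$. Let $\mathcal V$ be defined by $$\mathcal V=\max\{v \mid (E_{\rm first}(v)\text{ is defined and } E_{\rm first}(v)<\mathsf{GST}+\rho)\ \text{or}\ v=0\}+1$$ if $A_{\rm first}(0)<\mathsf{GST}$, and $\mathcal V=1$ otherwise. Then $\mathcal V=1$ and $E_{\rm last}(1)\le T_{\rm last}(0)+\delta$. Furthermore, if a correct process broadcasts $x$ at time $t\ge\mathsf{GST}$ and $\mathsf{leader}(1)$ is correct, then all correct processes deliver $x$ by $\max\{t,\,T_{\rm last}(0)+\delta\}+4\delta$.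
   Context: Model. There are $n=3f+1$ processes $p_1,\dots,p_n$; at most $f$ are Byzantine, the others are correct. A quorum is a set of $2f+1$ processes. Links are authenticated; signatures are unforgeable ($\langle m\rangle_i$ is $m$ signed by $p_i$); $\mathsf{hash}$ is collision-resistant (treated as injective). Partial synchrony: each execution has $\mathsf{GST}$ and $\delta$, unknown to the protocol, such that messages sent between correct processes after $\mathsf{GST}$ are received within $\delta$; before $\mathsf{GST}$ messages can be arbitrarily delayed or lost. Local clocks may drift arbitrarily before $\mathsf{GST}$ and track real time thereafter. There is a known constant $\Delta$ with $\delta<\Delta$ in every execution. Local steps take no time; messages a process sends to itself are handled immediately. A handler with a precondition runs once its message(s) have been received and the precondition holds; received messages are kept until then. SMR synchronizer algorithm. Views are $1,2,\dots$; $0$ is the initial invalid view in which every process starts. The synchronizer issues $\mathtt{new\_view}(v)$ at a process (the process enters $v$); processes may call $\mathtt{advance}()$. $E_{\rm first}(v),E_{\rm last}(v)$ are the earliest and latest times a correct process enters $v$; $A_{\rm first}(v)$ is the earliest time a correct process calls $\mathtt{advance}$ while in $v$; $T_i(0)$ is the time at which correct $p_i$ either calls $\mathtt{advance}$ in view $0$ or enters a view $>0$ (assumed defined for all correct $p_i$), and $T_{\rm last}(0)$ is the latest such time. Variables: $\mathsf{max\_views}[1..n]$, $\mathsf{view}$, $\mathsf{view}^+$, initially $0$; boolean $\mathsf{advanced}$, initially false. - On $\mathtt{advance}()$: send $\mathtt{WISH}(\max(\mathsf{view}+1,\mathsf{view}^+))$ to all; $\mathsf{advanced}:=$ true. - Every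 $\rho$ time units of the local clock: if $\mathsf{advanced}$, send $\mathtt{WISH}(\max(\mathsf{view}+1,\mathsf{view}^+))$ to all; else if $\mathsf{view}^+>0$, send $\mathtt{WISH}(\mathsf{view}^+)$ to all. - On $\mathtt{WISH}(v)$ from $p_j$: $prev\_v:=\mathsf{view}$, $prev\_v^+:=\mathsf{view}^+$; $\mathsf{max\_views}[j]:=\max(\mathsf{max\_views}[j],v)$; set $\mathsf{view}$ (resp. $\mathsf{view}^+$) to the largest entry $v'$ of $\mathsf{max\_views}$ such that at least $2f+1$ (resp. $f+1$) entries are $\ge v'$; if $\mathsf{view}^+=\mathsf{view}$ and $\mathsf{view}>prev\_v$, trigger $\mathtt{new\_view}(\mathsf{view})$ and set $\mathsf{advanced}:=$ false; then if $\mathsf{view}^+>prev\_v^+$, send $\mathtt{WISH}(\mathsf{view}^+)$ to all. Values. There is a validity predicate $\mathsf{valid}$; all values broadcast by correct processes in an execution are valid and unique; $\mathtt{nop}$ is a special value that is never broadcast or delivered. PBFT-light at process $p_i$. $\mathsf{leader}(v)=p_{((v-1)\bmod n)+1}$. Variables: $\mathsf{curr\_view}=0$; $\mathsf{status}\in\{$initializing, normal, advanced$\}$; arrays indexed by positions $k\ge1$: $\mathsf{log},\mathsf{prep\_log},\mathsf{commit\_log},\mathsf{cert}$ (initially $\bot$), $\mathsf{prep\_view}$ (initially $0$), $\mathsf{phase}$ (initially start); $\mathsf{next}$; $\mathsf{last\_delivered}=0$; $\mathsf{init\_log\_length}$; durations $\mathsf{dur\_delivery}\le4\Delta$, $\mathsf{dur\_recovery}\le6\Delta$;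 timers $\mathsf{timer\_recovery}$ and $\mathsf{timer\_delivery}[x]$ for each $x$; constant $\tau>0$. (1) $\mathtt{start}()$ (called when the process starts the protocol): if $\mathsf{curr\_view}=0$, call $\mathtt{advance}()$. (2) When a timer expires: stop all timers; call $\mathtt{advance}()$; $\mathsf{status}:=$ advanced; increase $\mathsf{dur\_delivery}$ and $\mathsf{dur\_recovery}$ by $\tau$, but not above $4\Delta$ and $6\Delta$, respectively. (3) $\mathtt{broadcast}(x)$, $x$ valid: send $\langle\mathtt{BROADCAST}(x)\rangle_i$ to all, immediately and then every $\rho$ time units, until $x$ is delivered. (4) On $\mathtt{BROADCAST}(x)$, if $\mathsf{valid}(x)$, $\mathsf{status}=$ normal, $\mathsf{timer\_delivery}[x]$ is not active, and $\mathsf{commit\_log}[k]\ne x$ for all $k\le\mathsf{last\_delivered}$: start $\mathsf{timer\_delivery}[x]$ for duration $\mathsf{dur\_delivery}$; send $\langle\mathtt{FORWARD}(x)\rangle_i$ to $\mathsf{leader}(\mathsf{curr\_view})$. (5) On $\mathtt{FORWARD}(x)$, if $\mathsf{valid}(x)$, $\mathsf{status}=$ normal, $p_i=\mathsf{leader}(\mathsf{curr\_view})$, and $\mathsf{log}[k]\ne x$ for all $k$: send $\langle\mathtt{PREPREPARE}(\mathsf{curr\_view},\mathsf{next},x)\rangle_i$ to all; $\mathsf{next}:=\mathsf{next}+1$. (6) On $\langle\mathtt{PREPREPARE}(v,k,x)\rangle_j$, if $p_j=\mathsf{leader}(v)$, $\mathsf{curr\_view}=v$, $\mathsf{status}=$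 normal, $\mathsf{phase}[k]=$ start, $\mathsf{valid}(x)$, and $\mathsf{log}[k']\neq x$ for all $k'$: $\mathsf{log}[k]:=x$, $\mathsf{phase}[k]:=$ preprepared; send $\langle\mathtt{PREPARE}(v,k,\mathsf{hash}(x))\rangle_i$ to all. (7) On a set $C$ of $\langle\mathtt{PREPARE}(v,k,h)\rangle_j$ from all $p_j$ in a quorum, if $\mathsf{curr\_view}=v$, $\mathsf{phase}[k]=$ preprepared, $\mathsf{status}=$ normal, $\mathsf{hash}(\mathsf{log}[k])=h$: $\mathsf{prep\_log}[k]:=\mathsf{log}[k]$, $\mathsf{prep\_view}[k]:=v$, $\mathsf{cert}[k]:=C$, $\mathsf{phase}[k]:=$ prepared; send $\langle\mathtt{COMMIT}(v,k,h)\rangle_i$ to all. (8) On a set $C$ of $\langle\mathtt{COMMIT}(v,k,h)\rangle_j$ from all $p_j$ in a quorum, if $\mathsf{curr\_view}=v$, $\mathsf{phase}[k]=$ prepared, $\mathsf{status}=$ normal, $\mathsf{hash}(\mathsf{prep\_log}[k])=h$: $\mathsf{commit\_log}[k]:=\mathsf{log}[k]$, $\mathsf{phase}[k]:=$ committed; disseminate $\mathtt{DECISION}(\mathsf{commit\_log}[k],k,C)$ by reliable broadcast, whose latency under synchrony is at most $\delta+\rho$ (a process sends a valid $\mathtt{DECISION}$ message to all as soon as it has it, and resends it every $\rho$ time units). (9) When $\mathsf{commit\_log}[\mathsf{last\_delivered}+1]\ne\bot$: increment $\mathsf{last\_delivered}$; let $x=\mathsf{commit\_log}[\mathsf{last\_delivered}]$;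 if $x\neq\mathtt{nop}$, deliver $x$; stop $\mathsf{timer\_delivery}[x]$; if $\mathsf{last\_delivered}=\mathsf{init\_log\_length}$ and $\mathsf{status}=$ normal, stop $\mathsf{timer\_recovery}$. (10) On $\mathtt{DECISION}(x,k,C)$, if $\mathsf{commit\_log}[k]=\bot$ and for some $v$, $C$ is a set of $\langle\mathtt{COMMIT}(v,k,\mathsf{hash}(x))\rangle_j$ from all $p_j$ in a quorum: $\mathsf{commit\_log}[k]:=x$. (11) On $\mathtt{new\_view}(v)$: stop all timers; $\mathsf{curr\_view}:=v$; $\mathsf{status}:=$ initializing; send $\langle\mathtt{NEW\_LEADER}(v,\mathsf{prep\_view},\mathsf{prep\_log},\mathsf{cert})\rangle_i$ to $\mathsf{leader}(v)$; start $\mathsf{timer\_recovery}$ for duration $\mathsf{dur\_recovery}$. Optimization for $v=1$: no $\mathtt{NEW\_LEADER}$ message is sent; instead $\mathsf{leader}(1)$, upon entering view $1$, sets $\mathsf{next}:=1$ and immediately sends to all a $\mathtt{NEW\_STATE}$ message for view $1$ with the empty log, which processes accept without $\mathtt{NEW\_LEADER}$ messages. (12) On a set $M=\{\langle\mathtt{NEW\_LEADER}(v,pv_j,pl_j,c_j)\rangle_j\mid p_j\in Q\}$ for a quorum $Q$, if $p_i=\mathsf{leader}(v)$, $\mathsf{curr\_view}=v$, $\mathsf{status}=$ initializing and every message of $M$ is valid (for every $k$ with $pv_j[k]>0$: $pv_j[k]<v$ and $c_j[k]$ is a set of $\langle\mathtt{PREPARE}(pv_j[k],k,\mathsf{hash}(pl_j[k]))\rangle$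 messages signed by all members of a quorum): compute $log'$ as follows. For each $k$, if some $p_{j'}\in Q$ has $pv_{j'}[k]\ne0$ maximal among $pv_j[k]$, $p_j\in Q$, put $log'[k]:=pl_{j'}[k]$, else $log'[k]:=\bot$. Set $\mathsf{next}:=\max\{k\mid log'[k]\ne\bot\}+1$ ($1$ if the set is empty). For $k=1,\dots,\mathsf{next}-1$: if $log'[k]=\bot$, or there is $k'\ne k$ with $log'[k']=log'[k]$ and some $p_{j'}\in Q$ with $pv_{j'}[k']>pv_j[k]$ for all $p_j\in Q$, set $log'[k]:=\mathtt{nop}$. Send $\langle\mathtt{NEW\_STATE}(v,log',M)\rangle_i$ to all. (13) On $\langle\mathtt{NEW\_STATE}(v,log',M)\rangle_j$, if $\mathsf{status}=$ initializing, $\mathsf{curr\_view}=v$, $p_j=\mathsf{leader}(v)$, and (for $v>1$) $M$ consists of valid $\mathtt{NEW\_LEADER}$ messages for $v$ from a quorum and $log'$ is computed from $M$ as in (12): $\mathsf{log}:=log'$; for all $k$ with $\mathsf{log}[k]\ne\bot$ set $\mathsf{phase}[k]:=$ preprepared and send $\langle\mathtt{PREPARE}(v,k,\mathsf{hash}(\mathsf{log}[k]))\rangle_i$ to all, and for all other $k$ set $\mathsf{phase}[k]:=$ start; $\mathsf{status}:=$ normal; $\mathsf{init\_log\_length}:=\max\{k\mid\mathsf{log}[k]\ne\bot\}$ ($0$ if empty); if $\mathsf{init\_log\_length}\le\mathsf{last\_delivered}$, stop $\mathsf{timer\_recovery}$. *)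

theory Defs
  imports Complex_Main "HOL-Library.Multiset"
begin

type_synonym proc = nat
type_synonym view = nat
type_synonym pos = nat

subsection \<open>Parameters of the protocol\<close>

record ('x, 'h) protocol =
  max_faulty :: nat            \<comment> \<open>\<open>f\<close>; there are \<open>3 f + 1\<close> processes, numbered from 1\<close>
  period :: real               \<comment> \<open>\<open>\<rho>\<close>\<close>
  delay_bound :: real          \<comment> \<open>\<open>\<Delta>\<close>, the known upper bound on \<open>\<delta>\<close>\<close>
  dur_step :: real             \<comment> \<open>\<open>\<tau>\<close>\<close>
  valid :: "'x \<Rightarrow> bool"
  nop :: 'x
  hash :: "'x \<Rightarrow> 'h"

definition protocol_params :: "('x, 'h) protocol \<Rightarrow> bool" where
  "protocol_params P \<longleftrightarrow>
     period P > 0 \<and> delay_bound P > 0 \<and> dur_step P > 0 \<and> inj (hash P)"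

definition num_procs :: "('x, 'h) protocol \<Rightarrow> nat" where
  "num_procs P = 3 * max_faulty P + 1"

definition procs :: "('x, 'h) protocol \<Rightarrow> proc set" where
  "procs P = {1..num_procs P}"

definition leader :: "('x, 'h) protocol \<Rightarrow> view \<Rightarrow> proc" where
  "leader P v = (v - 1) mod num_procs P + 1"

definition quorum :: "('x, 'h) protocol \<Rightarrow> proc set \<Rightarrow> bool" where
  "quorum P Q \<longleftrightarrow> Q \<subseteq> procs P \<and> card Q = 2 * max_faulty P + 1"

subsection \<open>Messages\<close>

text \<open>A vote is the body of a PREPARE or COMMIT message. A pair of type
  \<open>proc \<times> 'h vote\<close> stands for such a message signed by the process: a PREPARE message
  inside the \<open>cert\<close> arrays, a COMMIT message inside a DECISION message. Likewise a pair of
  type \<open>proc \<times> ('x, 'h) report\<close> stands for a signed NEW\_LEADER message.\<close>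

datatype 'h vote = Vote view pos 'h

datatype ('x, 'h) report =
  Report (rep_view: view)
    (rep_prep_view: "pos \<Rightarrow> view")
    (rep_prep_log: "pos \<Rightarrow> 'x option")
    (rep_cert: "pos \<Rightarrow> (proc \<times> 'h vote) set option")

datatype ('x, 'h) content =
    BROADCAST 'x
  | FORWARD 'x
  | PREPREPARE view pos 'x
  | PREPARE "'h vote"
  | COMMIT "'h vote"
  | NEW_LEADER "('x, 'h) report"
  | NEW_STATE view "pos \<Rightarrow> 'x option" "(proc \<times> ('x, 'h) report) set"

datatype ('x, 'h) msg =
    WISH view
  | Signed proc "('x, 'h) content"
  | DECISION 'x pos "(proc \<times> 'h vote) set"

fun nested_in_report :: "('x, 'h) report \<Rightarrow> (proc \<times> ('x, 'h) content) set" where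
  "nested_in_report (Report v pv pl c) =
     {(j, PREPARE w) | j w. \<exists>k C. c k = Some C \<and> (j, w) \<in> C}"

fun nested_in_content :: "('x, 'h) content \<Rightarrow> (proc \<times> ('x, 'h) content) set" where
  "nested_in_content (NEW_LEADER r) = nested_in_report r"
| "nested_in_content (NEW_STATE v l M) =
     (\<Union>(j, r) \<in> M. insert (j, NEW_LEADER r) (nested_in_report r))"
| "nested_in_content _ = {}"

fun signed_parts :: "('x, 'h) msg \<Rightarrow> (proc \<times> ('x, 'h) content) set" where
  "signed_parts (WISH v) = {}"
| "signed_parts (Signed j m) = insert (j, m) (nested_in_content m)"
| "signed_parts (DECISION x k C) = {(j, COMMIT w) | j w. (j, w) \<in> C}"

definition votes :: "proc set \<Rightarrow> view \<Rightarrow> pos \<Rightarrow> 'h \<Rightarrow> (proc \<times> 'h vote) set" where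
  "votes Q v k h = (\<lambda>j. (j, Vote v k h)) ` Q"

definition quorum_votes ::
    "('x, 'h) protocol \<Rightarrow> view \<Rightarrow> pos \<Rightarrow> 'h \<Rightarrow> (proc \<times> 'h vote) set \<Rightarrow> bool" where
  "quorum_votes P v k h C \<longleftrightarrow> (\<exists>Q. quorum P Q \<and> C = votes Q v k h)"

definition valid_decision ::
    "('x, 'h) protocol \<Rightarrow> 'x \<Rightarrow> pos \<Rightarrow> (proc \<times> 'h vote) set \<Rightarrow> bool" where
  "valid_decision P x k C \<longleftrightarrow> k \<ge> 1 \<and> (\<exists>v. quorum_votes P v k (hash P x) C)"

subsection \<open>Local states\<close>

datatype status = Initializing | Normal | Advanced

datatype phase = Start_Phase | Preprepared | Prepared | Committed

datatype 'x event = Enters view | Advances view | Delivers 'x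

text \<open>Timers and retransmission times are readings of the local clock; \<^const>\<open>None\<close> means
  inactive. \<open>outbox\<close> and \<open>events\<close> hold what the last local step sent and signalled.
  The pair \<open>(j, m)\<close> in \<open>inbox\<close> is a message \<open>m\<close> received over the link from \<open>j\<close> and not yet
  consumed by a handler. \<open>view_plus\<close> is the variable written with a superscript plus.\<close>

record ('x, 'h) pstate =
  max_views :: "proc \<Rightarrow> view"
  sync_view :: view
  view_plus :: view
  advanced :: bool
  wish_time :: real
  started :: bool
  curr_view :: view
  status :: status
  cur_log :: "pos \<Rightarrow> 'x option"
  prep_log :: "pos \<Rightarrow> 'x option"
  commit_log :: "pos \<Rightarrow> 'x option"
  cert :: "pos \<Rightarrow> (proc \<times> 'h vote) set option"
  prep_view :: "pos \<Rightarrow> view"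
  phase :: "pos \<Rightarrow> phase"
  next_pos :: pos
  last_delivered :: pos
  init_log_length :: nat
  dur_delivery :: real
  dur_recovery :: real
  timer_recovery :: "real option"
  timer_delivery :: "'x \<Rightarrow> real option"
  rebroadcast_time :: "'x \<Rightarrow> real option"
  redecide_time :: "'x \<times> pos \<times> (proc \<times> 'h vote) set \<Rightarrow> real option"
  inbox :: "(proc \<times> ('x, 'h) msg) multiset"
  outbox :: "(proc \<times> ('x, 'h) msg) list"
  events :: "'x event list"

text \<open>The initial values of \<open>next_pos\<close> and \<open>init_log_length\<close> are irrelevant and left open, and
  so is that of \<open>status\<close>, except that a process in view 0 is not in normal operation.\<close>

definition init_pstate :: "('x, 'h) protocol \<Rightarrow> real \<Rightarrow> ('x, 'h) pstate \<Rightarrow> bool" where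
  "init_pstate P c s \<longleftrightarrow>
     max_views s = (\<lambda>_. 0) \<and> sync_view s = 0 \<and> view_plus s = 0 \<and> \<not> advanced s \<and>
     c \<le> wish_time s \<and> wish_time s \<le> c + period P \<and>
     \<not> started s \<and> curr_view s = 0 \<and> status s \<noteq> Normal \<and>
     cur_log s = (\<lambda>_. None) \<and> prep_log s = (\<lambda>_. None) \<and> commit_log s = (\<lambda>_. None) \<and>
     cert s = (\<lambda>_. None) \<and> prep_view s = (\<lambda>_. 0) \<and> phase s = (\<lambda>_. Start_Phase) \<and>
     last_delivered s = 0 \<and>
     dur_delivery s \<le> 4 * delay_bound P \<and> dur_recovery s \<le> 6 * delay_bound P \<and>
     timer_recovery s = None \<and> timer_delivery s = (\<lambda>_. None) \<and>
     rebroadcast_time s = (\<lambda>_. None) \<and> redecide_time s = (\<lambda>_. None) \<and>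
     inbox s = {#} \<and> outbox s = [] \<and> events s = []"

text \<open>Below, \<open>i\<close> is the process executing the code and \<open>c\<close> the current reading of its
  local clock.\<close>

definition send :: "proc \<Rightarrow> ('x, 'h) msg \<Rightarrow> ('x, 'h) pstate \<Rightarrow> ('x, 'h) pstate" where
  "send j m s = s\<lparr>outbox := outbox s @ [(j, m)]\<rparr>"

definition send_all ::
    "('x, 'h) protocol \<Rightarrow> ('x, 'h) msg \<Rightarrow> ('x, 'h) pstate \<Rightarrow> ('x, 'h) pstate" where
  "send_all P m s = s\<lparr>outbox := outbox s @ map (\<lambda>j. (j, m)) [1..<num_procs P + 1]\<rparr>"

definition signal :: "'x event \<Rightarrow> ('x, 'h) pstate \<Rightarrow> ('x, 'h) pstate" where
  "signal e s = s\<lparr>events := events s @ [e]\<rparr>"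

definition stop_timers :: "('x, 'h) pstate \<Rightarrow> ('x, 'h) pstate" where
  "stop_timers s = s\<lparr>timer_recovery := None, timer_delivery := (\<lambda>_. None)\<rparr>"

definition has_delivered :: "('x, 'h) pstate \<Rightarrow> 'x \<Rightarrow> bool" where
  "has_delivered s x \<longleftrightarrow> (\<exists>k \<in> {1..last_delivered s}. commit_log s k = Some x)"

subsection \<open>Synchronizer\<close>

definition wish_target :: "('x, 'h) pstate \<Rightarrow> view" where
  "wish_target s = max (sync_view s + 1) (view_plus s)"

definition do_advance ::
    "('x, 'h) protocol \<Rightarrow> ('x, 'h) pstate \<Rightarrow> ('x, 'h) pstate" where
  "do_advance P s =
     signal (Advances (curr_view s)) ((send_all P (WISH (wish_target s)) s)\<lparr>advanced := True\<rparr>)"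

definition do_wish_tick ::
    "('x, 'h) protocol \<Rightarrow> ('x, 'h) pstate \<Rightarrow> ('x, 'h) pstate" where
  "do_wish_tick P s =
     (let s' = s\<lparr>wish_time := wish_time s + period P\<rparr>
      in if advanced s then send_all P (WISH (wish_target s)) s'
         else if view_plus s > 0 then send_all P (WISH (view_plus s)) s'
         else s')"

definition supported_view ::
    "('x, 'h) protocol \<Rightarrow> nat \<Rightarrow> (proc \<Rightarrow> view) \<Rightarrow> view" where
  "supported_view P m mv =
     Max {v \<in> mv ` procs P. m \<le> card {j \<in> procs P. v \<le> mv j}}"

definition do_new_view ::
    "('x, 'h) protocol \<Rightarrow> proc \<Rightarrow> real \<Rightarrow> view \<Rightarrow> ('x, 'h) pstate \<Rightarrow> ('x, 'h) pstate" where
  "do_new_view P i c v s =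
     (let s1 = signal (Enters v)
                 ((stop_timers s)\<lparr>curr_view := v, status := Initializing\<rparr>);
          s2 = (if v = 1
                then (if i = leader P 1
                      then send_all P (Signed i (NEW_STATE 1 (\<lambda>_. None) {})) (s1\<lparr>next_pos := 1\<rparr>)
                      else s1)
                else send (leader P v)
                       (Signed i (NEW_LEADER
                          (Report v (prep_view s) (prep_log s) (cert s)))) s1)
      in s2\<lparr>timer_recovery := Some (c + dur_recovery s)\<rparr>)"

definition on_wish ::
    "('x, 'h) protocol \<Rightarrow> proc \<Rightarrow> real \<Rightarrow> proc \<Rightarrow> view \<Rightarrow> ('x, 'h) pstate \<Rightarrow> ('x, 'h) pstate" where
  "on_wish P i c j v s =
     (let mv = (max_views s)(j := max (max_views s j) v);
          w = supported_view P (2 * max_faulty P + 1) mv;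
          wp = supported_view P (max_faulty P + 1) mv;
          s1 = s\<lparr>max_views := mv, sync_view := w, view_plus := wp\<rparr>;
          s2 = (if wp = w \<and> w > sync_view s
                then (do_new_view P i c w s1)\<lparr>advanced := False\<rparr> else s1)
      in if wp > view_plus s then send_all P (WISH wp) s2 else s2)"

subsection \<open>Calls and clock-driven steps of the replication protocol\<close>

definition do_start :: "('x, 'h) protocol \<Rightarrow> ('x, 'h) pstate \<Rightarrow> ('x, 'h) pstate" where
  "do_start P s =
     (let s' = s\<lparr>started := True\<rparr> in if curr_view s = 0 then do_advance P s' else s')"

definition do_timeout :: "('x, 'h) protocol \<Rightarrow> ('x, 'h) pstate \<Rightarrow> ('x, 'h) pstate" where
  "do_timeout P s =
     (do_advance P (stop_timers s))
       \<lparr>status := Advanced,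
        dur_delivery := min (dur_delivery s + dur_step P) (4 * delay_bound P),
        dur_recovery := min (dur_recovery s + dur_step P) (6 * delay_bound P)\<rparr>"

definition do_broadcast ::
    "('x, 'h) protocol \<Rightarrow> proc \<Rightarrow> real \<Rightarrow> 'x \<Rightarrow> ('x, 'h) pstate \<Rightarrow> ('x, 'h) pstate" where
  "do_broadcast P i c x s =
     (send_all P (Signed i (BROADCAST x)) s)
       \<lparr>rebroadcast_time := (rebroadcast_time s)
          (x := if has_delivered s x then None else Some (c + period P))\<rparr>"

definition do_rebroadcast ::
    "('x, 'h) protocol \<Rightarrow> proc \<Rightarrow> 'x \<Rightarrow> ('x, 'h) pstate \<Rightarrow> ('x, 'h) pstate" where
  "do_rebroadcast P i x s =
     (send_all P (Signed i (BROADCAST x)) s)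
       \<lparr>rebroadcast_time := (rebroadcast_time s)
          (x := map_option (\<lambda>d. d + period P) (rebroadcast_time s x))\<rparr>"

text \<open>Reliable broadcast of DECISION messages: on obtaining one, a process sends it to
  everyone and schedules its retransmissions, unless it already had it.\<close>

definition rb_decision ::
    "('x, 'h) protocol \<Rightarrow> real \<Rightarrow> 'x \<Rightarrow> pos \<Rightarrow> (proc \<times> 'h vote) set \<Rightarrow>
     ('x, 'h) pstate \<Rightarrow> ('x, 'h) pstate" where
  "rb_decision P c x k C s =
     (if redecide_time s (x, k, C) = None
      then (send_all P (DECISION x k C) s)
             \<lparr>redecide_time := (redecide_time s)((x, k, C) := Some (c + period P))\<rparr>
      else s)"

definition do_redecide ::
    "('x, 'h) protocol \<Rightarrow> 'x \<Rightarrow> pos \<Rightarrow> (proc \<times> 'h vote) set \<Rightarrow>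
     ('x, 'h) pstate \<Rightarrow> ('x, 'h) pstate" where
  "do_redecide P x k C s =
     (send_all P (DECISION x k C) s)
       \<lparr>redecide_time := (redecide_time s)
          ((x, k, C) := map_option (\<lambda>d. d + period P) (redecide_time s (x, k, C)))\<rparr>"

subsection \<open>Computing the initial log of a view\<close>

definition top_pos :: "(pos \<Rightarrow> 'x option) \<Rightarrow> pos" where
  "top_pos l = (if \<forall>k. l k = None then 0 else Max {k. l k \<noteq> None})"

definition valid_report :: "('x, 'h) protocol \<Rightarrow> ('x, 'h) report \<Rightarrow> bool" where
  "valid_report P r \<longleftrightarrow>
     (\<forall>k \<ge> 1. rep_prep_view r k > 0 \<longrightarrow>
        rep_prep_view r k < rep_view r \<and>
        (\<exists>x C. rep_prep_log r k = Some x \<and> rep_cert r k = Some C \<and>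
               quorum_votes P (rep_prep_view r k) k (hash P x) C))"

definition valid_reports ::
    "('x, 'h) protocol \<Rightarrow> view \<Rightarrow> (proc \<times> ('x, 'h) report) set \<Rightarrow> bool" where
  "valid_reports P v M \<longleftrightarrow>
     quorum P (fst ` M) \<and> inj_on fst M \<and>
     (\<forall>(j, r) \<in> M. rep_view r = v \<and> valid_report P r)"

text \<open>The first pass is a relation, because several reports may attain the maximal view.\<close>

definition selected_log ::
    "(proc \<times> ('x, 'h) report) set \<Rightarrow> (pos \<Rightarrow> 'x option) \<Rightarrow> bool" where
  "selected_log M l \<longleftrightarrow>
     (\<forall>k. if k \<ge> 1 \<and> (\<exists>(j, r) \<in> M. rep_prep_view r k \<noteq> 0)
          then \<exists>(j', r') \<in> M. rep_prep_view r' k \<noteq> 0 \<and>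
                 (\<forall>(j, r) \<in> M. rep_prep_view r k \<le> rep_prep_view r' k) \<and>
                 l k = rep_prep_log r' k
          else l k = None)"

definition fill_pos ::
    "'x \<Rightarrow> (proc \<times> ('x, 'h) report) set \<Rightarrow> pos \<Rightarrow> (pos \<Rightarrow> 'x option) \<Rightarrow> (pos \<Rightarrow> 'x option)" where
  "fill_pos no M k l =
     (if l k = None \<or>
         (\<exists>k' \<ge> 1. k' \<noteq> k \<and> l k' = l k \<and>
            (\<exists>(j', r') \<in> M. \<forall>(j, r) \<in> M. rep_prep_view r k < rep_prep_view r' k'))
      then l(k := Some no) else l)"

text \<open>The second pass runs through the positions in increasing order, updating the log in place.\<close>

definition filled_log ::
    "'x \<Rightarrow> (proc \<times> ('x, 'h) report) set \<Rightarrow> (pos \<Rightarrow> 'x option) \<Rightarrow> (pos \<Rightarrow> 'x option)" where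
  "filled_log no M l = fold (fill_pos no M) [1..<top_pos l + 1] l"

subsection \<open>Message handlers\<close>

text \<open>Preconditions and effects of the handlers triggered by a single message. For
  \<^const>\<open>DECISION\<close>, \<^const>\<open>valid_decision\<close> alone enables the handler, because the relaying by
  reliable broadcast does not depend on the state of \<open>commit_log\<close>. PREPARE, COMMIT and NEW\_LEADER
  messages are handled in sets, see below. Since view 0 is not a proper view, no NEW\_STATE
  message is accepted for it.\<close>

fun msg_ready :: "('x, 'h) protocol \<Rightarrow> proc \<Rightarrow> ('x, 'h) pstate \<Rightarrow> ('x, 'h) msg \<Rightarrow> bool" where
  "msg_ready P i s (WISH v) = True"
| "msg_ready P i s (Signed j (BROADCAST x)) =
     (valid P x \<and> status s = Normal \<and> timer_delivery s x = None \<and> \<not> has_delivered s x)"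
| "msg_ready P i s (Signed j (FORWARD x)) =
     (valid P x \<and> status s = Normal \<and> i = leader P (curr_view s) \<and>
      (\<forall>k. cur_log s k \<noteq> Some x))"
| "msg_ready P i s (Signed j (PREPREPARE v k x)) =
     (k \<ge> 1 \<and> j = leader P v \<and> curr_view s = v \<and> status s = Normal \<and>
      phase s k = Start_Phase \<and> valid P x \<and> (\<forall>k'. cur_log s k' \<noteq> Some x))"
| "msg_ready P i s (Signed j (NEW_STATE v l M)) =
     (v \<ge> 1 \<and> status s = Initializing \<and> curr_view s = v \<and> j = leader P v \<and>
      (if v = 1 then l = (\<lambda>_. None)
       else valid_reports P v M \<and> (\<exists>l0. selected_log M l0 \<and> l = filled_log (nop P) M l0)))"
| "msg_ready P i s (Signed j _) = False"
| "msg_ready P i s (DECISION x k C) = valid_decision P x k C"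

fun msg_effect ::
    "('x, 'h) protocol \<Rightarrow> proc \<Rightarrow> real \<Rightarrow> proc \<Rightarrow> ('x, 'h) msg \<Rightarrow> ('x, 'h) pstate \<Rightarrow>
     ('x, 'h) pstate" where
  "msg_effect P i c src (WISH v) s = on_wish P i c src v s"
| "msg_effect P i c src (Signed j (BROADCAST x)) s =
     send (leader P (curr_view s)) (Signed i (FORWARD x))
       (s\<lparr>timer_delivery := (timer_delivery s)(x := Some (c + dur_delivery s))\<rparr>)"
| "msg_effect P i c src (Signed j (FORWARD x)) s =
     send_all P (Signed i (PREPREPARE (curr_view s) (next_pos s) x))
       (s\<lparr>next_pos := next_pos s + 1\<rparr>)"
| "msg_effect P i c src (Signed j (PREPREPARE v k x)) s =
     send_all P (Signed i (PREPARE (Vote v k (hash P x))))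
       (s\<lparr>cur_log := (cur_log s)(k := Some x), phase := (phase s)(k := Preprepared)\<rparr>)"
| "msg_effect P i c src (Signed j (NEW_STATE v l M)) s =
     fold (\<lambda>k. send_all P (Signed i (PREPARE (Vote v k (hash P (the (l k)))))))
       (sorted_list_of_set {k. l k \<noteq> None})
       (s\<lparr>cur_log := l,
          phase := (\<lambda>k. if l k \<noteq> None then Preprepared else Start_Phase),
          status := Normal,
          init_log_length := top_pos l,
          timer_recovery := (if top_pos l \<le> last_delivered s then None else timer_recovery s)\<rparr>)"
| "msg_effect P i c src (Signed j _) s = s"
| "msg_effect P i c src (DECISION x k C) s =
     (let s' = rb_decision P c x k C s
      in if commit_log s k = None
         then s'\<lparr>commit_log := (commit_log s)(k := Some x)\<rparr> else s')"

text \<open>A handler instance: \<open>On j m\<close> handles \<open>m\<close> received over the link from \<open>j\<close>; the next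
  three handle sets of messages; \<open>Deliver\<close> is triggered by the commit log alone.
  The log in \<open>On_New_Leaders\<close> is the outcome of the first pass over the reports.\<close>

datatype ('x, 'h) handler =
    On proc "('x, 'h) msg"
  | On_Prepares "proc set" view pos 'h
  | On_Commits "proc set" view pos 'h
  | On_New_Leaders view "(proc \<times> ('x, 'h) report) set" "pos \<Rightarrow> 'x option"
  | Deliver

definition received :: "('x, 'h) pstate \<Rightarrow> proc \<Rightarrow> ('x, 'h) content \<Rightarrow> bool" where
  "received s j m \<longleftrightarrow> (\<exists>src. (src, Signed j m) \<in># inbox s)"

fun ready :: "('x, 'h) protocol \<Rightarrow> proc \<Rightarrow> ('x, 'h) pstate \<Rightarrow> ('x, 'h) handler \<Rightarrow> bool" where
  "ready P i s (On j m) = ((j, m) \<in># inbox s \<and> msg_ready P i s m)"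
| "ready P i s (On_Prepares Q v k h) =
     (quorum P Q \<and> (\<forall>j \<in> Q. received s j (PREPARE (Vote v k h))) \<and>
      curr_view s = v \<and> phase s k = Preprepared \<and> status s = Normal \<and>
      (\<exists>x. cur_log s k = Some x \<and> hash P x = h))"
| "ready P i s (On_Commits Q v k h) =
     (quorum P Q \<and> (\<forall>j \<in> Q. received s j (COMMIT (Vote v k h))) \<and>
      curr_view s = v \<and> phase s k = Prepared \<and> status s = Normal \<and>
      (\<exists>x. prep_log s k = Some x \<and> hash P x = h))"
| "ready P i s (On_New_Leaders v M l) =
     (valid_reports P v M \<and> (\<forall>(j, r) \<in> M. received s j (NEW_LEADER r)) \<and>
      i = leader P v \<and> curr_view s = v \<and> status s = Initializing \<and> selected_log M l)"
| "ready P i s Deliver = (commit_log s (last_delivered s + 1) \<noteq> None)"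

fun effect ::
    "('x, 'h) protocol \<Rightarrow> proc \<Rightarrow> real \<Rightarrow> ('x, 'h) handler \<Rightarrow> ('x, 'h) pstate \<Rightarrow>
     ('x, 'h) pstate" where
  "effect P i c (On j m) s = msg_effect P i c j m (s\<lparr>inbox := inbox s - {#(j, m)#}\<rparr>)"
| "effect P i c (On_Prepares Q v k h) s =
     send_all P (Signed i (COMMIT (Vote v k h)))
       (s\<lparr>prep_log := (prep_log s)(k := cur_log s k),
          prep_view := (prep_view s)(k := v),
          cert := (cert s)(k := Some (votes Q v k h)),
          phase := (phase s)(k := Prepared)\<rparr>)"
| "effect P i c (On_Commits Q v k h) s =
     rb_decision P c (the (cur_log s k)) k (votes Q v k h)
       (s\<lparr>commit_log := (commit_log s)(k := cur_log s k), phase := (phase s)(k := Committed)\<rparr>)"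
| "effect P i c (On_New_Leaders v M l) s =
     send_all P (Signed i (NEW_STATE v (filled_log (nop P) M l) M))
       (s\<lparr>next_pos := top_pos l + 1\<rparr>)"
| "effect P i c Deliver s =
     (let k = last_delivered s + 1;
          x = the (commit_log s k);
          s1 = s\<lparr>last_delivered := k\<rparr>;
          s2 = (if x \<noteq> nop P
                then signal (Delivers x)
                       (s1\<lparr>rebroadcast_time := (rebroadcast_time s)(x := None)\<rparr>)
                else s1);
          s3 = s2\<lparr>timer_delivery := (timer_delivery s)(x := None)\<rparr>
      in if k = init_log_length s \<and> status s = Normal then s3\<lparr>timer_recovery := None\<rparr> else s3)"

definition quiescent :: "('x, 'h) protocol \<Rightarrow> proc \<Rightarrow> ('x, 'h) pstate \<Rightarrow> bool" where
  "quiescent P i s \<longleftrightarrow> (\<forall>H. \<not> ready P i s H)"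

text \<open>Messages of a process to itself are handled immediately: those sent in its last step come
  first, then any others, and only then messages of other processes. In particular, a leader
  handles its own PREPREPARE message before it can propose again.\<close>

definition urgent :: "('x, 'h) protocol \<Rightarrow> proc \<Rightarrow> ('x, 'h) pstate \<Rightarrow> ('x, 'h) handler set" where
  "urgent P i s =
     {On i m | m. ready P i s (On i m) \<and> (i, m) \<in> set (outbox s)}"

definition may_run :: "('x, 'h) protocol \<Rightarrow> proc \<Rightarrow> ('x, 'h) pstate \<Rightarrow> ('x, 'h) handler \<Rightarrow> bool" where
  "may_run P i s H \<longleftrightarrow>
     ready P i s H \<and>
     (H \<in> urgent P i s \<or>
      urgent P i s = {} \<and> ((\<exists>m. H = On i m) \<or> (\<forall>m. \<not> ready P i s (On i m))))"

subsection \<open>Inputs\<close>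

text \<open>Processes handle messages even before \<open>Start\<close>, so a process may enter a view before it
  starts the protocol; \<open>Start\<close> then has no further effect.\<close>

datatype ('x, 'h) input =
    Start
  | Broadcast 'x
  | Timeout
  | Wish_Tick
  | Rebroadcast 'x
  | Redecide 'x pos "(proc \<times> 'h vote) set"

fun input_ready ::
    "('x, 'h) protocol \<Rightarrow> real \<Rightarrow> ('x, 'h) pstate \<Rightarrow> ('x, 'h) input \<Rightarrow> bool" where
  "input_ready P c s Start = (\<not> started s)"
| "input_ready P c s (Broadcast x) = (valid P x \<and> x \<noteq> nop P)"
| "input_ready P c s Timeout =
     (\<exists>d \<le> c. timer_recovery s = Some d \<or> (\<exists>x. timer_delivery s x = Some d))"
| "input_ready P c s Wish_Tick = (wish_time s \<le> c)"
| "input_ready P c s (Rebroadcast x) = (\<exists>d \<le> c. rebroadcast_time s x = Some d)"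
| "input_ready P c s (Redecide x k C) = (\<exists>d \<le> c. redecide_time s (x, k, C) = Some d)"

fun input_effect ::
    "('x, 'h) protocol \<Rightarrow> proc \<Rightarrow> real \<Rightarrow> ('x, 'h) input \<Rightarrow> ('x, 'h) pstate \<Rightarrow>
     ('x, 'h) pstate" where
  "input_effect P i c Start s = do_start P s"
| "input_effect P i c (Broadcast x) s = do_broadcast P i c x s"
| "input_effect P i c Timeout s = do_timeout P s"
| "input_effect P i c Wish_Tick s = do_wish_tick P s"
| "input_effect P i c (Rebroadcast x) s = do_rebroadcast P i x s"
| "input_effect P i c (Redecide x k C) s = do_redecide P x k C s"

definition clock_deadlines :: "('x, 'h) pstate \<Rightarrow> real set" where
  "clock_deadlines s =
     {wish_time s} \<union> {d. timer_recovery s = Some d} \<union> {d. \<exists>x. timer_delivery s x = Some d} \<union>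
     {d. \<exists>x. rebroadcast_time s x = Some d} \<union> {d. \<exists>m. redecide_time s m = Some d}"

subsection \<open>Executions\<close>

record ('x, 'h) packet =
  sent_at :: real
  src :: proc
  dst :: proc
  payload :: "('x, 'h) msg"

text \<open>\<open>signed_by\<close> collects the signed messages that correct processes have sent so far.
  The components of \<open>local_state\<close> for Byzantine processes are meaningless.\<close>

record ('x, 'h) config =
  local_state :: "proc \<Rightarrow> ('x, 'h) pstate"
  net :: "('x, 'h) packet multiset"
  signed_by :: "(proc \<times> ('x, 'h) content) set"

datatype ('x, 'h) action =
    Pass
  | Handle proc "('x, 'h) handler"
  | Input proc "('x, 'h) input"
  | Receive "('x, 'h) packet"
  | Inject "('x, 'h) packet"

record ('x, 'h) run =
  correct :: "proc set"
  gst :: real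
  delta :: real
  clock :: "proc \<Rightarrow> real \<Rightarrow> real"
  conf :: "nat \<Rightarrow> ('x, 'h) config"
  now :: "nat \<Rightarrow> real"
  act :: "nat \<Rightarrow> ('x, 'h) action"

definition local_update ::
    "real \<Rightarrow> proc \<Rightarrow> (('x, 'h) pstate \<Rightarrow> ('x, 'h) pstate) \<Rightarrow>
     ('x, 'h) config \<Rightarrow> ('x, 'h) config" where
  "local_update t i F g =
     (let s = F ((local_state g i)\<lparr>outbox := [], events := []\<rparr>);
          own = filter (\<lambda>(j, m). j = i) (outbox s);
          other = filter (\<lambda>(j, m). j \<noteq> i) (outbox s)
      in g\<lparr>local_state := (local_state g)(i := s\<lparr>inbox := inbox s + mset own\<rparr>),
           net := net g +
             mset (map (\<lambda>(j, m). \<lparr>sent_at = t, src = i, dst = j, payload = m\<rparr>) other),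
           signed_by := signed_by g \<union> {(i, m) | m. \<exists>j. (j, Signed i m) \<in> set (outbox s)}\<rparr>)"

definition receive :: "('x, 'h) packet \<Rightarrow> ('x, 'h) config \<Rightarrow> ('x, 'h) config" where
  "receive q g =
     (let s = local_state g (dst q)
      in g\<lparr>local_state := (local_state g)
             (dst q := s\<lparr>inbox := inbox s + {#(src q, payload q)#}\<rparr>),
           net := net g - {#q#}\<rparr>)"

text \<open>Enabled handlers are urgent: time does not pass, and a process does nothing else, while
  they are pending. Time does not pass beyond the deadlines of the clock-driven steps of correct
  processes, nor beyond the delivery deadline of a message sent at or after GST between correct
  processes. A message with no deadline may stay in \<open>net\<close> forever, i.e.\ be lost.
  Byzantine processes send any message all of whose parts signed by correct processes have
  been sent by those before.\<close>

fun step ::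
    "('x, 'h) protocol \<Rightarrow> ('x, 'h) run \<Rightarrow> real \<Rightarrow> ('x, 'h) config \<Rightarrow> ('x, 'h) action \<Rightarrow>
     real \<Rightarrow> ('x, 'h) config \<Rightarrow> bool" where
  "step P E t g Pass t' g' =
     (t \<le> t' \<and> g' = g \<and>
      (\<forall>i \<in> correct E. quiescent P i (local_state g i) \<and>
         (\<forall>d \<in> clock_deadlines (local_state g i). clock E i t' \<le> d)) \<and>
      (\<forall>q \<in># net g. src q \<in> correct E \<and> dst q \<in> correct E \<and> gst E \<le> sent_at q \<longrightarrow>
         t' \<le> sent_at q + delta E))"
| "step P E t g (Handle i H) t' g' =
     (t' = t \<and> i \<in> correct E \<and> may_run P i (local_state g i) H \<and>
      g' = local_update t i (effect P i (clock E i t) H) g)"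
| "step P E t g (Input i u) t' g' =
     (t' = t \<and> i \<in> correct E \<and> quiescent P i (local_state g i) \<and>
      input_ready P (clock E i t) (local_state g i) u \<and>
      g' = local_update t i (input_effect P i (clock E i t) u) g)"
| "step P E t g (Receive q) t' g' =
     (t' = t \<and> q \<in># net g \<and> dst q \<in> correct E \<and>
      quiescent P (dst q) (local_state g (dst q)) \<and> g' = receive q g)"
| "step P E t g (Inject q) t' g' =
     (t' = t \<and> sent_at q = t \<and> src q \<in> procs P - correct E \<and> dst q \<in> correct E \<and>
      (\<forall>(j, m) \<in> signed_parts (payload q). j \<in> correct E \<longrightarrow> (j, m) \<in> signed_by g) \<and>
      g' = g\<lparr>net := net g + {#q#}\<rparr>)"

definition execution :: "('x, 'h) protocol \<Rightarrow> ('x, 'h) run \<Rightarrow> bool" where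
  "execution P E \<longleftrightarrow>
     correct E \<subseteq> procs P \<and> card (procs P - correct E) \<le> max_faulty P \<and>
     0 < delta E \<and> delta E < delay_bound P \<and>
     (\<forall>i \<in> correct E. mono (clock E i) \<and> continuous_on UNIV (clock E i) \<and>
        (\<forall>t t'. gst E \<le> t \<and> t \<le> t' \<longrightarrow> clock E i t' - clock E i t = t' - t)) \<and>
     (\<forall>i \<in> correct E. init_pstate P (clock E i (now E 0)) (local_state (conf E 0) i)) \<and>
     net (conf E 0) = {#} \<and> signed_by (conf E 0) = {} \<and>
     (\<forall>m. step P E (now E m) (conf E m) (act E m) (now E (Suc m)) (conf E (Suc m))) \<and>
     (\<forall>T. \<exists>m. T < now E m) \<and>
     (\<forall>m m' i i' x. act E m = Input i (Broadcast x) \<and> act E m' = Input i' (Broadcast x) \<longrightarrow>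
        m = m')"

subsection \<open>Derived notions\<close>

definition occurs :: "('x, 'h) run \<Rightarrow> nat \<Rightarrow> proc \<Rightarrow> 'x event \<Rightarrow> bool" where
  "occurs E m i e \<longleftrightarrow>
     ((\<exists>H. act E m = Handle i H) \<or> (\<exists>u. act E m = Input i u)) \<and>
     e \<in> set (events (local_state (conf E (Suc m)) i))"

definition enter_times :: "('x, 'h) run \<Rightarrow> view \<Rightarrow> real set" where
  "enter_times E v = {now E m | m i. i \<in> correct E \<and> occurs E m i (Enters v)}"

definition advance_times :: "('x, 'h) run \<Rightarrow> view \<Rightarrow> real set" where
  "advance_times E v = {now E m | m i. i \<in> correct E \<and> occurs E m i (Advances v)}"

text \<open>Each of the following is meaningful only if the underlying set of times is non-empty,
  i.e.\ if the corresponding quantity is defined.\<close>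

definition E_first :: "('x, 'h) run \<Rightarrow> view \<Rightarrow> real" where
  "E_first E v = Inf (enter_times E v)"

definition E_last :: "('x, 'h) run \<Rightarrow> view \<Rightarrow> real" where
  "E_last E v = Sup (enter_times E v)"

definition A_first :: "('x, 'h) run \<Rightarrow> view \<Rightarrow> real" where
  "A_first E v = Inf (advance_times E v)"

definition leave_zero_times :: "('x, 'h) run \<Rightarrow> proc \<Rightarrow> real set" where
  "leave_zero_times E i =
     {now E m | m. occurs E m i (Advances 0) \<or> (\<exists>v > 0. occurs E m i (Enters v))}"

definition T_zero :: "('x, 'h) run \<Rightarrow> proc \<Rightarrow> real" where
  "T_zero E i = Inf (leave_zero_times E i)"

definition T_last_zero :: "('x, 'h) run \<Rightarrow> real" where
  "T_last_zero E = Max (T_zero E ` correct E)"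

definition stable_view :: "('x, 'h) protocol \<Rightarrow> ('x, 'h) run \<Rightarrow> view" where
  "stable_view P E =
     (if advance_times E 0 \<noteq> {} \<and> A_first E 0 < gst E
      then Max {v. (enter_times E v \<noteq> {} \<and> E_first E v < gst E + period P) \<or> v = 0} + 1
      else 1)"

definition delivers_by :: "('x, 'h) run \<Rightarrow> proc \<Rightarrow> 'x \<Rightarrow> real \<Rightarrow> bool" where
  "delivers_by E i x t \<longleftrightarrow> (\<exists>m. occurs E m i (Delivers x) \<and> now E m \<le> t)"

definition starts_after_gst :: "('x, 'h) run \<Rightarrow> proc \<Rightarrow> bool" where
  "starts_after_gst E i \<longleftrightarrow>
     (\<exists>m. act E m = Input i Start) \<and> (\<forall>m. act E m = Input i Start \<longrightarrow> gst E \<le> now E m)"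

end

theory Submission
  imports Defs
begin

text \<open>Before the first timeout of a correct process, no correct process wishes for a view above 1,
  so a correct process that finds view 1 supported also enters it. Once one correct process has
  entered view 1, its \<open>f + 1\<close> correct supporters make everyone wish within \<open>\<delta>\<close> and enter within
  \<open>2 \<delta>\<close>, whereas timers run for more than \<open>4 \<delta>\<close>; so everyone is in view 1 before any timeout.

  If the leader of view 1 is correct, no correct process ever times out. A process that starts a
  delivery timer at time \<open>s\<close> has its FORWARD handled by \<open>s + \<delta>\<close>, and by \<open>s + 2 \<delta>\<close> everyone is in
  normal operation and has the proposal, so that all prepare by \<open>s + 3 \<delta>\<close> and commit by \<open>s + 4 \<delta>\<close>.
  A broadcast also takes only four message delays, because it reaches the leader directly and the
  leader forwards it to itself at once. Agreement needs no quorum intersection here: everything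
  logged or committed is a proposal that the leader signed in view 1.\<close>

text \<open>The argument is circular at first sight: timers are stopped in time only if everyone
  stays in view 1, and views stay at 1 only while no timer fires. Invariants are therefore stated
  for step indices \<open>m\<close> with \<open>no_timeout m\<close>. Under a correct leader the
  circle is closed by induction on \<open>m\<close>: the facts about the steps below
  \<open>m\<close> show that step \<open>m\<close> is not a timeout. Under a Byzantine leader
  timeouts may happen, and the facts are used only up to the first one.

  Real-time bounds are read off at the last configuration of an instant. Time passes only when every
  correct process is quiescent and no deadline is exceeded, so at that point each message due has
  been received and no enabled handler is left. "Happens within a delay" thus becomes "otherwise
  some handler would still be ready". Deadlines may be met with equality; since timers run strictly
  longer than the bounds, the last configuration at a bound still precedes the timeout.

  Byzantine wishes for high views are harmless, because every supported view is also supported by a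
  correct process.\<close>

lemma finite_procs [simp]: "finite (procs P)"
  by (simp add: procs_def)

lemma card_procs [simp]: "card (procs P) = 3 * max_faulty P + 1"
  by (simp add: procs_def num_procs_def)

lemma leader_in_procs [simp]: "leader P v \<in> procs P"
  by (simp add: leader_def procs_def num_procs_def Suc_le_eq)

lemma set_upt_procs [simp]: "{1..<num_procs P + 1} = procs P" "{Suc 0..<Suc (num_procs P)} = procs P"
  by (auto simp: procs_def)

section \<open>Views supported by a given number of processes\<close>

context
  fixes P :: "('x, 'h) protocol" and r :: nat and mv :: "proc \<Rightarrow> view"
  assumes r: "r \<le> 3 * max_faulty P + 1"
begin

text \<open>\<open>Max\<close> is informative only on a nonempty set. The least entry is reached by
  all \<open>3 f + 1\<close> processes, so it always qualifies.\<close>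

lemma supported_view_witness:
  "{v \<in> mv ` procs P. r \<le> card {j \<in> procs P. v \<le> mv j}} \<noteq> {}"
proof -
  have ne: "procs P \<noteq> {}" using leader_in_procs by blast
  define u where "u = Min (mv ` procs P)"
  have "u \<in> mv ` procs P" unfolding u_def using ne by (intro Min_in) auto
  moreover have "{j \<in> procs P. u \<le> mv j} = procs P" by (auto simp: u_def)
  ultimately have "u \<in> {v \<in> mv ` procs P. r \<le> card {j \<in> procs P. v \<le> mv j}}"
    using r by simp
  then show ?thesis by blast
qed

lemma supported_view_support: "r \<le> card {j \<in> procs P. supported_view P r mv \<le> mv j}"
  using Max_in[of "{v \<in> mv ` procs P. r \<le> card {j \<in> procs P. v \<le> mv j}}"]
    supported_view_witness
  unfolding supported_view_def by auto

text \<open>\<open>supported_view\<close> ranges over entries of \<open>mv\<close>, and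
  \<open>v\<close> need not be one. The least entry among the supporters of \<open>v\<close> is an
  entry, keeps all these supporters and is at least \<open>v\<close>; \<open>r > 0\<close>
  guarantees that there is a supporter.\<close>

lemma supported_view_greatest:
  assumes "r > 0" and "r \<le> card {j \<in> procs P. v \<le> mv j}"
  shows "v \<le> supported_view P r mv"
proof -
  let ?S = "{j \<in> procs P. v \<le> mv j}"
  have ne: "?S \<noteq> {}" using assms by force
  define u where "u = Min (mv ` ?S)"
  have u: "u \<in> mv ` ?S" unfolding u_def using ne by (intro Min_in) auto
  have "?S \<subseteq> {j \<in> procs P. u \<le> mv j}" by (auto simp: u_def)
  then have "card ?S \<le> card {j \<in> procs P. u \<le> mv j}" by (intro card_mono) auto
  then have "u \<in> {v \<in> mv ` procs P. r \<le> card {j \<in> procs P. v \<le> mv j}}"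
    using u assms by auto
  then have "u \<le> supported_view P r mv"
    unfolding supported_view_def by (intro Max_ge) auto
  moreover have "v \<le> u" using u by auto
  ultimately show ?thesis by simp
qed

end

lemma supported_view_mono:
  assumes "r \<le> 3 * max_faulty P + 1"
  assumes "r > 0" and "\<And>j. mv j \<le> mv' j"
  shows "supported_view P r mv \<le> supported_view P r mv'"
proof -
  have "card {j \<in> procs P. supported_view P r mv \<le> mv j}
      \<le> card {j \<in> procs P. supported_view P r mv \<le> mv' j}"
    using assms(3) by (intro card_mono) (auto intro: order_trans)
  then show ?thesis
    using supported_view_support[OF assms(1), of mv]
      supported_view_greatest[OF assms(1,2), of _ mv'] by simp
qed

lemma supported_view_zero:
  "r \<le> 3 * max_faulty P + 1 \<Longrightarrow> supported_view P r (\<lambda>_. 0) = 0"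
proof -
  assume "r \<le> 3 * max_faulty P + 1"
  then have "Max {v \<in> (\<lambda>_. 0) ` procs P. r \<le> card {j \<in> procs P. v \<le> (0::nat)}} \<in> {0}"
    using Max_in[OF _ supported_view_witness[of r P "\<lambda>_. 0"]] by auto
  then show ?thesis by (simp add: supported_view_def)
qed

lemma supported_view_antimono:
  assumes "0 < r" "r \<le> r'" "r' \<le> 3 * max_faulty P + 1"
  shows "supported_view P r' mv \<le> supported_view P r mv"
  using assms supported_view_support[of r' P mv] by (intro supported_view_greatest) auto

section \<open>Effects of single handlers and inputs on the local state\<close>

lemma on_wish_fields [simp]:
  "max_views (on_wish P i c j v s) = (max_views s)(j := max (max_views s j) v)"
  "started (on_wish P i c j v s) = started s"
  "cur_log (on_wish P i c j v s) = cur_log s"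
  "prep_log (on_wish P i c j v s) = prep_log s"
  "commit_log (on_wish P i c j v s) = commit_log s"
  "phase (on_wish P i c j v s) = phase s"
  "last_delivered (on_wish P i c j v s) = last_delivered s"
  "dur_delivery (on_wish P i c j v s) = dur_delivery s"
  "dur_recovery (on_wish P i c j v s) = dur_recovery s"
  "redecide_time (on_wish P i c j v s) = redecide_time s"
  "inbox (on_wish P i c j v s) = inbox s"
  by (simp_all add: on_wish_def Let_def do_new_view_def signal_def stop_timers_def send_all_def
      send_def)

lemma on_wish_fields2:
  fixes s :: "('x, 'h) pstate" and P :: "('x, 'h) protocol" and i j :: proc and v :: view
  defines "w \<equiv> supported_view P (2 * max_faulty P + 1) ((max_views s)(j := max (max_views s j) v))"
    and "wp \<equiv> supported_view P (max_faulty P + 1) ((max_views s)(j := max (max_views s j) v))"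
  defines "ent \<equiv> wp = w \<and> w > sync_view s"
  shows
  "sync_view (on_wish P i c j v s) = w"
  "view_plus (on_wish P i c j v s) = wp"
  "advanced (on_wish P i c j v s) \<longleftrightarrow> \<not> ent \<and> advanced s"
  "curr_view (on_wish P i c j v s) = (if ent then w else curr_view s)"
  "status (on_wish P i c j v s) = (if ent then Initializing else status s)"
  "next_pos (on_wish P i c j v s) = (if ent \<and> w = 1 \<and> i = leader P 1 then 1 else next_pos s)"
  "timer_recovery (on_wish P i c j v s) =
    (if ent then Some (c + dur_recovery s) else timer_recovery s)"
  "timer_delivery (on_wish P i c j v s) = (if ent then (\<lambda>_. None) else timer_delivery s)"
  "events (on_wish P i c j v s) = (if ent then events s @ [Enters w] else events s)"
  "outbox (on_wish P i c j v s) = outbox s @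
    (if ent then if w = 1
       then if i = leader P 1
         then map (\<lambda>j. (j, Signed i (NEW_STATE 1 (\<lambda>_. None) {}))) [1..<num_procs P + 1] else []
       else [(leader P w, Signed i (NEW_LEADER (Report w (prep_view s) (prep_log s) (cert s))))]
     else []) @
    (if wp > view_plus s then map (\<lambda>j. (j, WISH wp)) [1..<num_procs P + 1] else [])"
  unfolding on_wish_def Let_def do_new_view_def signal_def stop_timers_def send_all_def
      send_def w_def[symmetric] wp_def[symmetric] ent_def by (simp_all del: upt_Suc)

lemma fold_send_all:
  "fold (\<lambda>k. send_all P (g k)) ks s =
     s\<lparr>outbox := outbox s @ concat (map (\<lambda>k. map (\<lambda>j. (j, g k)) [1..<num_procs P + 1]) ks)\<rparr>"
  by (induction ks arbitrary: s) (simp_all add: send_all_def del: upt_Suc)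

lemmas primitive_defs = send_def send_all_def signal_def stop_timers_def do_advance_def
  do_wish_tick_def do_start_def do_timeout_def do_broadcast_def do_rebroadcast_def
  rb_decision_def do_redecide_def Let_def

text \<open>The preparation that \<open>local_update\<close> makes before each step, so that
  afterwards \<open>outbox\<close> and \<open>events\<close> hold what this step alone
  produced.\<close>

definition clear :: "('x, 'h) pstate \<Rightarrow> ('x, 'h) pstate" where
  "clear s = s\<lparr>outbox := [], events := []\<rparr>"

lemma clear_fields [simp]:
  "max_views (clear s) = max_views s" "sync_view (clear s) = sync_view s"
  "view_plus (clear s) = view_plus s" "advanced (clear s) = advanced s"
  "wish_time (clear s) = wish_time s" "started (clear s) = started s"
  "curr_view (clear s) = curr_view s" "status (clear s) = status s"
  "cur_log (clear s) = cur_log s" "prep_log (clear s) = prep_log s"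
  "commit_log (clear s) = commit_log s" "cert (clear s) = cert s"
  "prep_view (clear s) = prep_view s" "phase (clear s) = phase s"
  "next_pos (clear s) = next_pos s" "last_delivered (clear s) = last_delivered s"
  "init_log_length (clear s) = init_log_length s" "dur_delivery (clear s) = dur_delivery s"
  "dur_recovery (clear s) = dur_recovery s" "timer_recovery (clear s) = timer_recovery s"
  "timer_delivery (clear s) = timer_delivery s" "rebroadcast_time (clear s) = rebroadcast_time s"
  "redecide_time (clear s) = redecide_time s" "inbox (clear s) = inbox s"
  "outbox (clear s) = []" "events (clear s) = []"
  by (simp_all add: clear_def)

lemma has_delivered_clear [simp]: "has_delivered (clear s) x = has_delivered s x"
  by (simp add: has_delivered_def)

lemma new_state_effect:
  "msg_effect P i c j' (Signed j (NEW_STATE v l M)) ((clear s)\<lparr>inbox := B\<rparr>) =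
     (clear s)\<lparr>inbox := B,
        cur_log := l, phase := (\<lambda>k. if l k \<noteq> None then Preprepared else Start_Phase),
        status := Normal, init_log_length := top_pos l,
        timer_recovery := (if top_pos l \<le> last_delivered s then None else timer_recovery s),
        outbox := concat (map (\<lambda>k. map (\<lambda>j. (j, Signed i (PREPARE (Vote v k (hash P (the (l k)))))))
          [1..<num_procs P + 1]) (sorted_list_of_set {k. l k \<noteq> None}))\<rparr>"
  by (simp add: fold_send_all del: upt_Suc)

lemma decision_effect:
  "msg_effect P i c j (DECISION x k C) ((clear s)\<lparr>inbox := B\<rparr>) = (clear s)\<lparr>inbox := B,
        commit_log := (if commit_log s k = None then (commit_log s)(k := Some x) else commit_log s),
        redecide_time := (if redecide_time s (x, k, C) = None
          then (redecide_time s)((x, k, C) := Some (c + period P)) else redecide_time s),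
        outbox := (if redecide_time s (x, k, C) = None
          then map (\<lambda>j. (j, DECISION x k C)) [1..<num_procs P + 1] else [])\<rparr>"
  by (rule pstate.equality) (simp_all add: primitive_defs del: upt_Suc)

lemma deliver_effect:
  assumes "commit_log s (last_delivered s + 1) = Some x"
  shows "effect P i c Deliver (clear s) = (clear s)\<lparr>last_delivered := last_delivered s + 1,
        events := (if x \<noteq> nop P then [Delivers x] else []),
        rebroadcast_time := (if x \<noteq> nop P then (rebroadcast_time s)(x := None)
          else rebroadcast_time s),
        timer_delivery := (timer_delivery s)(x := None),
        timer_recovery := (if last_delivered s + 1 = init_log_length s \<and> status s = Normal
          then None else timer_recovery s)\<rparr>"
  unfolding effect.simps Let_def clear_fields assms option.sel
  by (rule pstate.equality) (simp_all add: signal_def)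

text \<open>The share of a \<open>Handle\<close> or \<open>Input\<close> step that concerns the
  acting process only. The result still has its whole \<open>outbox\<close>; the split into messages
  to itself and packets for the network comes later.\<close>

inductive local_move ::
    "('x, 'h) protocol \<Rightarrow> proc \<Rightarrow> real \<Rightarrow> ('x, 'h) pstate \<Rightarrow> ('x, 'h) action \<Rightarrow>
     ('x, 'h) pstate \<Rightarrow> bool"
  for P i c s where
  handle: "may_run P i s H \<Longrightarrow> local_move P i c s (Handle i H) (effect P i c H (clear s))"
| input: "quiescent P i s \<Longrightarrow> input_ready P c s u \<Longrightarrow>
    local_move P i c s (Input i u) (input_effect P i c u (clear s))"

text \<open>One case for each handler and each input, sixteen in all, so that an invariant of local
  steps becomes a check of guards and new field values.\<close>

lemma local_move_cases [consumes 1, case_names wish bcast forward preprepare new_state decision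
    prepares commits new_leaders deliver start broadcast timeout tick rebroadcast redecide]:
  assumes "local_move P i c s a r"
  obtains
    (wish) j v where "a = Handle i (On j (WISH v))" "(j, WISH v) \<in># inbox s"
      "r = on_wish P i c j v ((clear s)\<lparr>inbox := inbox s - {#(j, WISH v)#}\<rparr>)"
  | (bcast) j' j x where "a = Handle i (On j' (Signed j (BROADCAST x)))"
      "(j', Signed j (BROADCAST x)) \<in># inbox s"
      "valid P x" "status s = Normal" "timer_delivery s x = None" "\<not> has_delivered s x"
      "r = (clear s)\<lparr>inbox := inbox s - {#(j', Signed j (BROADCAST x))#},
        timer_delivery := (timer_delivery s)(x := Some (c + dur_delivery s)),
        outbox := [(leader P (curr_view s), Signed i (FORWARD x))]\<rparr>"
  | (forward) j' j x where "a = Handle i (On j' (Signed j (FORWARD x)))"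
      "(j', Signed j (FORWARD x)) \<in># inbox s"
      "valid P x" "status s = Normal" "i = leader P (curr_view s)" "\<forall>k. cur_log s k \<noteq> Some x"
      "r = (clear s)\<lparr>inbox := inbox s - {#(j', Signed j (FORWARD x))#},
        next_pos := next_pos s + 1,
        outbox := map (\<lambda>j. (j, Signed i (PREPREPARE (curr_view s) (next_pos s) x)))
          [1..<num_procs P + 1]\<rparr>"
  | (preprepare) j' j v k x where "a = Handle i (On j' (Signed j (PREPREPARE v k x)))"
      "(j', Signed j (PREPREPARE v k x)) \<in># inbox s"
      "k \<ge> 1" "j = leader P v" "curr_view s = v" "status s = Normal" "phase s k = Start_Phase"
      "valid P x" "\<forall>k. cur_log s k \<noteq> Some x"
      "r = (clear s)\<lparr>inbox := inbox s - {#(j', Signed j (PREPREPARE v k x))#},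
        cur_log := (cur_log s)(k := Some x), phase := (phase s)(k := Preprepared),
        outbox := map (\<lambda>j. (j, Signed i (PREPARE (Vote v k (hash P x))))) [1..<num_procs P + 1]\<rparr>"
  | (new_state) j' j v l M where "a = Handle i (On j' (Signed j (NEW_STATE v l M)))"
      "(j', Signed j (NEW_STATE v l M)) \<in># inbox s"
      "v \<ge> 1" "status s = Initializing" "curr_view s = v" "j = leader P v"
      "v = 1 \<Longrightarrow> l = (\<lambda>_. None)"
      "r = (clear s)\<lparr>inbox := inbox s - {#(j', Signed j (NEW_STATE v l M))#},
        cur_log := l, phase := (\<lambda>k. if l k \<noteq> None then Preprepared else Start_Phase),
        status := Normal, init_log_length := top_pos l,
        timer_recovery := (if top_pos l \<le> last_delivered s then None else timer_recovery s),
        outbox := concat (map (\<lambda>k. map (\<lambda>j. (j, Signed i (PREPARE (Vote v k (hash P (the (l k)))))))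
          [1..<num_procs P + 1]) (sorted_list_of_set {k. l k \<noteq> None}))\<rparr>"
  | (decision) j' x k C where "a = Handle i (On j' (DECISION x k C))"
      "(j', DECISION x k C) \<in># inbox s" "valid_decision P x k C"
      "r = (clear s)\<lparr>inbox := inbox s - {#(j', DECISION x k C)#},
        commit_log := (if commit_log s k = None then (commit_log s)(k := Some x) else commit_log s),
        redecide_time := (if redecide_time s (x, k, C) = None
          then (redecide_time s)((x, k, C) := Some (c + period P)) else redecide_time s),
        outbox := (if redecide_time s (x, k, C) = None
          then map (\<lambda>j. (j, DECISION x k C)) [1..<num_procs P + 1] else [])\<rparr>"
  | (prepares) Q v k h x where "a = Handle i (On_Prepares Q v k h)" "quorum P Q"
      "\<forall>j \<in> Q. received s j (PREPARE (Vote v k h))"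
      "curr_view s = v" "phase s k = Preprepared" "status s = Normal"
      "cur_log s k = Some x" "hash P x = h"
      "r = (clear s)\<lparr>prep_log := (prep_log s)(k := cur_log s k),
          prep_view := (prep_view s)(k := v),
          cert := (cert s)(k := Some (votes Q v k h)),
          phase := (phase s)(k := Prepared),
          outbox := map (\<lambda>j. (j, Signed i (COMMIT (Vote v k h)))) [1..<num_procs P + 1]\<rparr>"
  | (commits) Q v k h x where "a = Handle i (On_Commits Q v k h)" "quorum P Q"
      "\<forall>j \<in> Q. received s j (COMMIT (Vote v k h))"
      "curr_view s = v" "phase s k = Prepared" "status s = Normal"
      "prep_log s k = Some x" "hash P x = h"
      "r = rb_decision P c (the (cur_log s k)) k (votes Q v k h)
       ((clear s)\<lparr>commit_log := (commit_log s)(k := cur_log s k),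
         phase := (phase s)(k := Committed)\<rparr>)"
  | (new_leaders) v M l where "a = Handle i (On_New_Leaders v M l)" "valid_reports P v M"
      "\<forall>(j, r) \<in> M. received s j (NEW_LEADER r)"
      "i = leader P v" "curr_view s = v" "status s = Initializing" "selected_log M l"
      "r = (clear s)\<lparr>next_pos := top_pos l + 1,
        outbox := map (\<lambda>j. (j, Signed i (NEW_STATE v (filled_log (nop P) M l) M)))
          [1..<num_procs P + 1]\<rparr>"
  | (deliver) x where "a = Handle i Deliver" "commit_log s (last_delivered s + 1) = Some x"
      "r = (clear s)\<lparr>last_delivered := last_delivered s + 1,
        events := (if x \<noteq> nop P then [Delivers x] else []),
        rebroadcast_time := (if x \<noteq> nop P then (rebroadcast_time s)(x := None)
          else rebroadcast_time s),
        timer_delivery := (timer_delivery s)(x := None),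
        timer_recovery := (if last_delivered s + 1 = init_log_length s \<and> status s = Normal
          then None else timer_recovery s)\<rparr>"
  | (start) "a = Input i Start" "\<not> started s" "r = do_start P (clear s)"
  | (broadcast) x where "a = Input i (Broadcast x)" "valid P x" "x \<noteq> nop P"
      "r = (clear s)\<lparr>
        outbox := map (\<lambda>j. (j, Signed i (BROADCAST x))) [1..<num_procs P + 1],
        rebroadcast_time := (rebroadcast_time s)(x := if has_delivered s x then None
          else Some (c + period P))\<rparr>"
  | (timeout) d where "a = Input i Timeout" "d \<le> c"
      "timer_recovery s = Some d \<or> (\<exists>x. timer_delivery s x = Some d)"
      "r = do_timeout P (clear s)"
  | (tick) "a = Input i Wish_Tick" "r = do_wish_tick P (clear s)"
  | (rebroadcast) x where "a = Input i (Rebroadcast x)"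
      "r = (clear s)\<lparr>
        outbox := map (\<lambda>j. (j, Signed i (BROADCAST x))) [1..<num_procs P + 1],
        rebroadcast_time := (rebroadcast_time s)
          (x := map_option (\<lambda>d. d + period P) (rebroadcast_time s x))\<rparr>"
  | (redecide) x k C where "a = Input i (Redecide x k C)" "redecide_time s (x, k, C) \<noteq> None"
      "r = (clear s)\<lparr>
        outbox := map (\<lambda>j. (j, DECISION x k C)) [1..<num_procs P + 1],
        redecide_time := (redecide_time s)
          ((x, k, C) := map_option (\<lambda>d. d + period P) (redecide_time s (x, k, C)))\<rparr>"
  using assms
proof cases
  case (handle H)
  then have rdy: "ready P i s H" by (simp add: may_run_def)
  show thesis
  proof (cases H)
    case (On j' m)
    show thesis
    proof (cases m)
      case (WISH v)
      then show thesis using handle rdy On wish by simp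
    next
      case (Signed j ct)
      show thesis
      proof (cases ct)
        case BROADCAST
        then show thesis using handle rdy On Signed by (intro bcast) (simp_all add: primitive_defs)
      next
        case FORWARD
        then show thesis using handle rdy On Signed
          by (intro forward) (simp_all add: primitive_defs del: upt_Suc)
      next
        case (PREPREPARE v k x)
        then have g: "(j', Signed j (PREPREPARE v k x)) \<in># inbox s"
          "k \<ge> 1" "j = leader P v" "curr_view s = v" "status s = Normal" "phase s k = Start_Phase"
          "valid P x" "\<forall>k. cur_log s k \<noteq> Some x"
          using rdy unfolding On Signed PREPREPARE ready.simps msg_ready.simps by blast+
        show thesis by (rule preprepare[OF _ g])
          (use handle On Signed PREPREPARE in \<open>simp_all add: primitive_defs del: upt_Suc\<close>)
      next
        case (NEW_STATE v l M)
        then have g: "(j', Signed j (NEW_STATE v l M)) \<in># inbox s"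
          "v \<ge> 1" "status s = Initializing" "curr_view s = v" "j = leader P v"
          and l: "v = 1 \<longrightarrow> l = (\<lambda>_. None)"
          using rdy unfolding On Signed NEW_STATE ready.simps msg_ready.simps
          by (blast, blast, blast, blast, blast, auto)
        show thesis
          by (rule new_state[OF _ g l[rule_format]])
            (simp_all only: handle On Signed NEW_STATE effect.simps new_state_effect clear_fields)
      qed (use handle rdy On Signed in simp_all)
    next
      case (DECISION x k C)
      show thesis
        by (rule decision[of j' x k C])
          (use handle rdy On DECISION in
            \<open>simp_all only: effect.simps decision_effect clear_fields ready.simps msg_ready.simps\<close>)
    qed
  next
    case (On_Prepares Q v k h)
    then obtain x where x: "cur_log s k = Some x" "hash P x = h" using rdy by auto
    show thesis
      by (rule prepares[of Q v k h x])
        (use handle rdy On_Prepares x in \<open>simp_all add: primitive_defs clear_def del: upt_Suc\<close>)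
  next
    case (On_Commits Q v k h)
    then obtain x where x: "prep_log s k = Some x" "hash P x = h" using rdy by auto
    show thesis
      by (rule commits[of Q v k h x]) (use handle rdy On_Commits x in simp_all)
  next
    case (On_New_Leaders v M l)
    show thesis
      by (rule new_leaders[of v M l])
        (use handle rdy On_New_Leaders in \<open>simp_all add: primitive_defs clear_def del: upt_Suc\<close>)
  next
    case Deliver
    then obtain x where x: "commit_log s (last_delivered s + 1) = Some x" using rdy by auto
    show thesis
      by (rule deliver[OF _ x])
        (simp_all only: handle Deliver deliver_effect[OF x])
  qed
next
  case (input u)
  show thesis
  proof (cases u)
    case Start then show thesis using input start by simp
  next
    case Broadcast then show thesis using input
      by (intro broadcast) (simp_all add: primitive_defs del: upt_Suc cong: if_cong)
  next
    case Timeout then show thesis using input timeout by auto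
  next
    case Wish_Tick then show thesis using input tick by simp
  next
    case Rebroadcast then show thesis using input
      by (intro rebroadcast) (simp_all add: primitive_defs del: upt_Suc)
  next
    case Redecide
    then have "redecide_time s (x1, x2, x3) \<noteq> None" if "u = Redecide x1 x2 x3" for x1 x2 x3
      using input that by auto
    then show thesis using input Redecide
      by (intro redecide) (simp_all add: primitive_defs del: upt_Suc)
  qed
qed

lemma in_remove: "q \<in># M \<Longrightarrow> q \<noteq> q' \<Longrightarrow> q \<in># M - {#q'#}"
  by (simp add: in_diff_count)

text \<open>Only a single-message handler consumes anything, and only its own message. The handlers
  for sets leave the votes in the inbox.\<close>

lemma inbox_after_move:
  assumes "local_move P i c s a r"
  shows "inbox r \<subseteq># inbox s"
    and "(j, m) \<in># inbox s \<Longrightarrow> (j, m) \<in># inbox r \<or> a = Handle i (On j m)"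
proof -
  show "inbox r \<subseteq># inbox s"
    using assms by (cases rule: local_move_cases) (auto simp: primitive_defs)
  assume m: "(j, m) \<in># inbox s"
  have rm: "(j, m) \<in># inbox s - {#y#} \<or> y = (j, m)" for y
    using m by (metis in_remove)
  show "(j, m) \<in># inbox r \<or> a = Handle i (On j m)"
    using assms m
    by (cases rule: local_move_cases) (use rm in \<open>auto simp: primitive_defs\<close>)
qed

definition own :: "proc \<Rightarrow> ('x, 'h) pstate \<Rightarrow> (proc \<times> ('x, 'h) msg) multiset" where
  "own i r = mset (filter (\<lambda>(j, m). j = i) (outbox r))"

lemma in_own [simp]: "y \<in># own i r \<longleftrightarrow> y \<in> set (outbox r) \<and> fst y = i"
  by (auto simp: own_def)

section \<open>Steps of a run, globally and as seen by one process\<close>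

locale pbft_run =
  fixes P :: "('x, 'h) protocol" and E :: "('x, 'h) run"
  assumes params: "protocol_params P"
    and exec: "execution P E"
    and starts: "\<forall>i \<in> correct E. starts_after_gst E i"
    and recovery: "\<forall>i \<in> correct E. dur_recovery (local_state (conf E 0) i) > 5 * delta E"
    and delivery: "\<forall>i \<in> correct E. dur_delivery (local_state (conf E 0) i) > 4 * delta E"
begin

abbreviation C where "C \<equiv> correct E"
abbreviation st where "st m i \<equiv> local_state (conf E m) i"
abbreviation clk where "clk m i \<equiv> clock E i (now E m)"
abbreviation move where "move m i r \<equiv> local_move P i (clk m i) (st m i) (act E m) r"
abbreviation d where "d \<equiv> delta E"

definition emit where
  "emit m i r = mset (map (\<lambda>(j, c). \<lparr>sent_at = now E m, src = i, dst = j, payload = c\<rparr>)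
     (filter (\<lambda>(j, c). j \<noteq> i) (outbox r)))"

lemma in_emit:
  "q \<in># emit m i r \<Longrightarrow>
    src q = i \<and> (dst q, payload q) \<in> set (outbox r) \<and> sent_at q = now E m"
  by (auto simp: emit_def)

lemma step: "step P E (now E m) (conf E m) (act E m) (now E (Suc m)) (conf E (Suc m))"
  using exec by (simp add: execution_def)

lemma C_procs: "i \<in> C \<Longrightarrow> i \<in> procs P"
  using exec by (auto simp: execution_def)

lemma finite_C: "finite C"
  using C_procs by (meson finite_procs finite_subset subsetI)

lemma card_faulty: "card (procs P - C) \<le> max_faulty P"
  using exec by (simp add: execution_def)

lemma d_pos: "0 < d"
  using exec by (simp add: execution_def)

text \<open>\<open>Handle\<close> and \<open>Input\<close> merge into \<open>local\<close>: for the
  network and for the signatures they do not differ.\<close>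

lemma step_cases [case_names pass local receive inject]:
  obtains
    (pass) "act E m = Pass" "now E m \<le> now E (Suc m)" "conf E (Suc m) = conf E m"
      "\<And>i. i \<in> C \<Longrightarrow> quiescent P i (st m i)"
      "\<And>q. q \<in># net (conf E m) \<Longrightarrow> src q \<in> C \<Longrightarrow> dst q \<in> C \<Longrightarrow> gst E \<le> sent_at q \<Longrightarrow>
         now E (Suc m) \<le> sent_at q + d"
  | (local) i r where "i \<in> C" "now E (Suc m) = now E m" "move m i r"
      "local_state (conf E (Suc m)) =
        (local_state (conf E m))(i := r\<lparr>inbox := inbox r + own i r\<rparr>)"
      "net (conf E (Suc m)) = net (conf E m) + emit m i r"
      "signed_by (conf E (Suc m)) =
        signed_by (conf E m) \<union> {(i, c) | c. \<exists>j. (j, Signed i c) \<in> set (outbox r)}"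
  | (receive) q where "act E m = Receive q" "now E (Suc m) = now E m" "q \<in># net (conf E m)"
      "dst q \<in> C" "quiescent P (dst q) (st m (dst q))"
      "local_state (conf E (Suc m)) = (local_state (conf E m))
        (dst q := (st m (dst q))\<lparr>inbox := inbox (st m (dst q)) + {#(src q, payload q)#}\<rparr>)"
      "net (conf E (Suc m)) = net (conf E m) - {#q#}"
      "signed_by (conf E (Suc m)) = signed_by (conf E m)"
  | (inject) q where "act E m = Inject q" "now E (Suc m) = now E m"
      "src q \<in> procs P - C" "dst q \<in> C" "sent_at q = now E m"
      "\<forall>(j, c) \<in> signed_parts (payload q). j \<in> C \<longrightarrow> (j, c) \<in> signed_by (conf E m)"
      "local_state (conf E (Suc m)) = local_state (conf E m)"
      "net (conf E (Suc m)) = net (conf E m) + {#q#}"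
      "signed_by (conf E (Suc m)) = signed_by (conf E m)"
proof (cases "act E m")
  case Pass
  then show thesis using step[of m] by (intro pass) auto
next
  case (Handle i H)
  let ?r = "effect P i (clk m i) H (clear (st m i))"
  have "move m i ?r"
    using step[of m] Handle by (auto intro: local_move.intros)
  then show thesis using step[of m] Handle
    by (intro local[of i ?r])
      (simp_all add: local_update_def Let_def clear_def own_def emit_def)
next
  case (Input i u)
  let ?r = "input_effect P i (clk m i) u (clear (st m i))"
  have "move m i ?r"
    using step[of m] Input by (auto intro: local_move.intros)
  then show thesis using step[of m] Input
    by (intro local[of i ?r])
      (simp_all add: local_update_def Let_def clear_def own_def emit_def)
next
  case (Receive q)
  then show thesis using step[of m]
    by (intro receive) (simp_all add: receive_def Let_def)
next
  case (Inject q)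
  then show thesis using step[of m] by (intro inject) auto
qed

lemma now_Suc: "now E m \<le> now E (Suc m)"
  by (cases m rule: step_cases) auto

lemma now_mono: "m \<le> m' \<Longrightarrow> now E m \<le> now E m'"
  using now_Suc by (rule lift_Suc_mono_le)

lemma now_less: "now E m < now E m' \<Longrightarrow> m < m'"
  using now_mono by (meson not_le)

lemma signed_by_mono: "m \<le> m' \<Longrightarrow> signed_by (conf E m) \<subseteq> signed_by (conf E m')"
proof (rule lift_Suc_mono_le[of "\<lambda>m. signed_by (conf E m)"])
  show "signed_by (conf E m) \<subseteq> signed_by (conf E (Suc m))" for m
    by (cases m rule: step_cases) auto
qed

text \<open>The same step from the viewpoint of process \<open>i\<close>. Steps of other processes
  leave it idle, so an invariant of local states, apart from its inbox, has a single case with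
  content.\<close>

lemma state_cases [consumes 1, case_names idle move receive]:
  assumes "i \<in> C"
  obtains
    (idle) "st (Suc m) i = st m i" "\<And>r. \<not> move m i r"
  | (move) r where "move m i r" "now E (Suc m) = now E m"
      "st (Suc m) i = r\<lparr>inbox := inbox r + own i r\<rparr>"
  | (receive) q where "act E m = Receive q" "dst q = i" "q \<in># net (conf E m)"
      "st (Suc m) i = (st m i)\<lparr>inbox := inbox (st m i) + {#(src q, payload q)#}\<rparr>"
      "\<And>r. \<not> move m i r" "quiescent P i (st m i)"
proof (cases m rule: step_cases)
  case pass
  then show thesis by (intro idle) (auto elim: local_move.cases)
next
  case (local i' r)
  then have "\<not> move m j r'" if "j \<noteq> i'" for j r'
    using that by (auto elim!: local_move.cases)
  then show thesis using local by (cases "i = i'") (auto intro: idle move)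
next
  case (receive q)
  then have no: "\<not> move m j r'" for j r' by (auto elim!: local_move.cases)
  show thesis
  proof (cases "dst q = i")
    case True then show thesis using receive no by (intro that(3)[of q]) auto
  next
    case False then show thesis using receive no by (intro idle) auto
  qed
next
  case (inject q)
  then show thesis by (intro idle) (auto elim: local_move.cases)
qed

lemma move_unique: "move m i r \<Longrightarrow> move m j r' \<Longrightarrow> i = j"
  by (auto elim!: local_move.cases)

text \<open>Events are emptied when a local step begins, so those found in the state after it were
  signalled by that very step.\<close>

lemma occurs_iff:
  assumes "i \<in> C"
  shows "occurs E m i e \<longleftrightarrow> (\<exists>r. move m i r \<and> e \<in> set (events r))"
proof
  assume o: "occurs E m i e"
  show "\<exists>r. move m i r \<and> e \<in> set (events r)"
    using assms
  proof (cases rule: state_cases[where m = m])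
    case idle
    have "\<exists>r. move m i r"
      using o step[of m] by (auto simp: occurs_def) (blast intro: local_move.intros)+
    then show ?thesis using idle by blast
  next
    case (move r)
    then show ?thesis using o by (auto simp: occurs_def)
  next
    case (receive q)
    then show ?thesis using o by (auto simp: occurs_def)
  qed
next
  assume "\<exists>r. move m i r \<and> e \<in> set (events r)"
  then obtain r where r: "move m i r" "e \<in> set (events r)" by blast
  obtain r' where r': "move m i r'" "st (Suc m) i = r'\<lparr>inbox := inbox r' + own i r'\<rparr>"
    using assms r(1) by (cases rule: state_cases[where m = m]) blast+
  have "r' = r" using r(1) r'(1) by (auto elim!: local_move.cases)
  then have "e \<in> set (events (st (Suc m) i))" using r r' by simp
  moreover have "(\<exists>H. act E m = Handle i H) \<or> (\<exists>u. act E m = Input i u)"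
    using r(1) by (auto elim!: local_move.cases)
  ultimately show "occurs E m i e" by (simp add: occurs_def)
qed

lemma move_now:
  assumes "i \<in> C" "move m i r"
  shows "now E (Suc m) = now E m" and "st (Suc m) i = r\<lparr>inbox := inbox r + own i r\<rparr>"
    and "net (conf E (Suc m)) = net (conf E m) + emit m i r"
    and "signed_by (conf E (Suc m)) =
        signed_by (conf E m) \<union> {(i, c) | c. \<exists>j. (j, Signed i c) \<in> set (outbox r)}"
proof -
  have *: "now E (Suc m) = now E m \<and> st (Suc m) i = r\<lparr>inbox := inbox r + own i r\<rparr> \<and>
    net (conf E (Suc m)) = net (conf E m) + emit m i r \<and> signed_by (conf E (Suc m)) =
        signed_by (conf E m) \<union> {(i, c) | c. \<exists>j. (j, Signed i c) \<in> set (outbox r)}"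
  proof (cases m rule: step_cases)
    case (local i' r')
    have "i' = i" using local(3) assms(2) move_unique by blast
    moreover from this have "r' = r" using local(3) assms(2) by (auto elim!: local_move.cases)
    ultimately show ?thesis using local by simp
  qed (use assms in \<open>auto elim!: local_move.cases\<close>)
  then show "now E (Suc m) = now E m" "st (Suc m) i = r\<lparr>inbox := inbox r + own i r\<rparr>"
    "net (conf E (Suc m)) = net (conf E m) + emit m i r"
    "signed_by (conf E (Suc m)) =
        signed_by (conf E m) \<union> {(i, c) | c. \<exists>j. (j, Signed i c) \<in> set (outbox r)}"
    by auto
qed

section \<open>Messages in transit and the last configuration of an instant\<close>

definition in_flight :: "nat \<Rightarrow> proc \<Rightarrow> proc \<Rightarrow> ('x, 'h) msg \<Rightarrow> bool" where
  "in_flight m i j c \<longleftrightarrow>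
     (\<exists>q \<in># net (conf E m). src q = i \<and> dst q = j \<and> payload q = c) \<or> (i, c) \<in># inbox (st m j)"

text \<open>\<open>in_flight\<close> serves safety, where every message that may still be handled
  counts, whenever it was sent. \<open>timely\<close> serves progress: between correct processes, a
  packet sent from GST on is bound by the deadline in \<open>Pass\<close>, and a message in the
  inbox has already arrived.\<close>

definition timely :: "nat \<Rightarrow> proc \<Rightarrow> proc \<Rightarrow> ('x, 'h) msg \<Rightarrow> bool" where
  "timely m i j c \<longleftrightarrow>
     (\<exists>q \<in># net (conf E m). src q = i \<and> dst q = j \<and> payload q = c \<and> gst E \<le> sent_at q) \<or>
     (i, c) \<in># inbox (st m j)"

lemma in_flight_0 [simp]: "j \<in> C \<Longrightarrow> \<not> in_flight 0 i j c"
  using exec by (auto simp: in_flight_def execution_def init_pstate_def)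

text \<open>\<open>Inject\<close> requires a Byzantine source, so a message from a correct process
  can only stem from one of its own moves.\<close>

lemma in_flight_origin:
  assumes "i \<in> C" "j \<in> C" "in_flight (Suc m) i j c"
  shows "in_flight m i j c \<or> (\<exists>r. move m i r \<and> (j, c) \<in> set (outbox r))"
proof (cases m rule: step_cases)
  case pass
  then show ?thesis using assms by (simp add: in_flight_def)
next
  case (local k r)
  note sub = inbox_after_move(1)[OF local(3)]
  consider q where "q \<in># net (conf E (Suc m))" "src q = i" "dst q = j" "payload q = c"
    | "(i, c) \<in># inbox (st (Suc m) j)"
    using assms(3) by (auto simp: in_flight_def)
  then show ?thesis
  proof cases
    case 1
    then show ?thesis using local in_emit[of q m k r] by (auto simp: in_flight_def)
  next
    case 2
    then show ?thesis using local sub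
      by (cases "j = k") (auto simp: in_flight_def dest: mset_subset_eqD)
  qed
next
  case (receive q)
  then show ?thesis using assms(3)
    by (auto simp: in_flight_def split: if_splits dest: in_diffD)
next
  case (inject q)
  then show ?thesis using assms by (auto simp: in_flight_def)
qed

lemma timely_new:
  assumes "i \<in> C" "move m i r" "(j, c) \<in> set (outbox r)" "gst E \<le> now E m"
  shows "timely (Suc m) i j c"
proof (cases "j = i")
  case True
  then show ?thesis using move_now(2)[OF assms(1,2)] assms(3) by (simp add: timely_def)
next
  case False
  let ?q = "\<lparr>sent_at = now E m, src = i, dst = j, payload = c\<rparr>"
  have "?q \<in># emit m i r" using assms(3) False by (force simp: emit_def)
  then show ?thesis unfolding timely_def move_now(3)[OF assms(1,2)] using assms(4)
    by (intro disjI1 bexI[of _ ?q]) auto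
qed

lemma inbox_step:
  assumes "j \<in> C" "(i, c) \<in># inbox (st m j)" "act E m \<noteq> Handle j (On i c)"
  shows "(i, c) \<in># inbox (st (Suc m) j)"
  using assms(1)
proof (cases rule: state_cases[where m = m])
  case (move r)
  then show ?thesis using inbox_after_move(2)[OF move(1) assms(2)] assms(3) by auto
qed (use assms in auto)

lemma timely_step:
  assumes "j \<in> C" "timely m i j c"
  shows "timely (Suc m) i j c \<or> act E m = Handle j (On i c)"
proof (cases "(i, c) \<in># inbox (st m j)")
  case True
  then show ?thesis using inbox_step[OF assms(1)] by (auto simp: timely_def)
next
  case False
  then obtain q where q: "q \<in># net (conf E m)" "src q = i" "dst q = j" "payload q = c"
    "gst E \<le> sent_at q" using assms(2) by (auto simp: timely_def)
  show ?thesis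
  proof (cases m rule: step_cases)
    case (receive q')
    then show ?thesis
    proof (cases "q = q'")
      case True then show ?thesis using receive q by (auto simp: timely_def)
    next
      case False
      then have "q \<in># net (conf E (Suc m))" using receive q by (simp add: in_remove)
      then show ?thesis using q by (auto simp: timely_def)
    qed
  qed (use q in \<open>auto simp: timely_def\<close>)
qed

lemma sent_at_le_now: "q \<in># net (conf E m) \<Longrightarrow> sent_at q \<le> now E m"
proof (induction m)
  case 0
  then show ?case using exec by (auto simp: execution_def)
next
  case (Suc m)
  show ?case
  proof (cases m rule: step_cases)
    case pass
    then show ?thesis using Suc by force
  next
    case (local i r)
    then show ?thesis using Suc by (auto simp: emit_def)
  next
    case (receive q)
    then show ?thesis using Suc by (auto dest: in_diffD)
  next
    case (inject q)
    then show ?thesis using Suc by auto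
  qed
qed

text \<open>The index of the last configuration at time \<open>T\<close>: all handlers have run, and everything due by
  \<open>T\<close> has arrived.\<close>

definition at_end :: "real \<Rightarrow> nat \<Rightarrow> bool" where
  "at_end T m \<longleftrightarrow> now E m \<le> T \<and> T < now E (Suc m)"

text \<open>Time is unbounded, so there is a first index past \<open>T\<close>. It lies above
  \<open>m0\<close>, hence has a predecessor, which is the index sought.\<close>

lemma at_end_exists:
  assumes "now E m0 \<le> T"
  obtains m where "at_end T m" "m0 \<le> m"
proof -
  obtain k where k: "T < now E k" using exec unfolding execution_def by blast
  define l where "l = (LEAST k. T < now E k)"
  have l: "T < now E l" unfolding l_def using k by (rule LeastI)
  have "m0 < l" using l assms by (intro now_less) simp
  then obtain m where m: "l = Suc m" by (cases l) auto
  have "\<not> T < now E m" using not_less_Least[of m "\<lambda>k. T < now E k"] m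
    unfolding l_def by simp
  then show thesis using that[of m] l m \<open>m0 < l\<close> by (auto simp: at_end_def)
qed

lemma at_end_after: "at_end T m \<Longrightarrow> now E m' \<le> T \<Longrightarrow> m' \<le> m"
  using now_less[of m' "Suc m"] by (auto simp: at_end_def)

lemma at_end_before: "at_end T m \<Longrightarrow> T < now E m' \<Longrightarrow> m < m'"
  using now_less[of m m'] by (auto simp: at_end_def)

text \<open>Time can grow only in a \<open>Pass\<close> step. Its guard yields quiescence here and
  the respected delivery deadlines in the next lemma.\<close>

lemma at_end_quiescent:
  assumes "at_end T m" "i \<in> C"
  shows "quiescent P i (st m i)"
  using assms by (cases m rule: step_cases) (auto simp: at_end_def)

lemma at_end_arrived:
  assumes "at_end T m" "q \<in># net (conf E m)" "src q \<in> C" "dst q \<in> C" "gst E \<le> sent_at q"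
  shows "T < sent_at q + d"
  using assms by (cases m rule: step_cases) (fastforce simp: at_end_def)+

text \<open>\<open>R\<close> stands for the effect of handling the message: handling establishes it,
  and it persists. At the end of \<open>T\<close> the message has had this effect or lies in the
  inbox, and whoever applies the lemma then exploits quiescence. For votes, which are never
  consumed, \<open>R\<close> is simply \<open>False\<close>.\<close>

lemma arrives:
  assumes "i \<in> C" "j \<in> C" and sent: "timely m i j c \<or> R m"
    and T: "now E m + d \<le> T" "at_end T m'"
    and stable: "\<And>l. m \<le> l \<Longrightarrow> l < m' \<Longrightarrow> R l \<Longrightarrow> R (Suc l)"
    and handled: "\<And>l. m \<le> l \<Longrightarrow> l < m' \<Longrightarrow> act E l = Handle j (On i c) \<Longrightarrow> R (Suc l)"
  shows "(i, c) \<in># inbox (st m' j) \<or> R m'"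
proof -
  have mm': "m \<le> m'" using at_end_after[OF T(2), of m] T(1) d_pos by simp
  let ?G = "\<lambda>l. (i, c) \<in># inbox (st l j) \<or> R l"
  \<comment> \<open>The bound on \<open>sent_at\<close> is relative to the fixed index
    \<open>m\<close>, so a packet still in the network at \<open>m'\<close> would have missed a
    deadline of at most \<open>now E m + d\<close>.\<close>
  let ?N = "\<lambda>l q. q \<in># net (conf E l) \<and> src q = i \<and> dst q = j \<and> payload q = c \<and>
    gst E \<le> sent_at q \<and> sent_at q \<le> now E m"
  have "?G l \<or> (\<exists>q. ?N l q)" if "m \<le> l" "l \<le> m'" for l
    using that
  proof (induction l rule: dec_induct)
    case base
    then show ?case using sent sent_at_le_now[of _ m] by (auto simp: timely_def)
  next
    case (step l)
    then consider "R l" | "(i, c) \<in># inbox (st l j)" | q where "?N l q" by auto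
    then show ?case
    proof cases
      case 1
      then show ?thesis using stable step by auto
    next
      case 2
      then show ?thesis using inbox_step[OF assms(2) 2] handled step by fastforce
    next
      case 3
      show ?thesis
      proof (cases l rule: step_cases)
        case (receive q')
        show ?thesis
        proof (cases "q = q'")
          case True then show ?thesis using receive 3 by auto
        next
          case False
          then have "?N (Suc l) q" using receive 3 by (auto intro: in_remove)
          then show ?thesis by blast
        qed
      next
        case pass
        then have "?N (Suc l) q" using 3 by auto
        then show ?thesis by blast
      next
        case local
        then have "?N (Suc l) q" using 3 by auto
        then show ?thesis by blast
      next
        case inject
        then have "?N (Suc l) q" using 3 by auto
        then show ?thesis by blast
      qed
    qed
  qed
  from this[OF mm'] show ?thesis
    using at_end_arrived[OF T(2)] assms(1,2) T(1) by fastforce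
qed

end

text \<open>Exactly the condition under which \<open>do_wish_tick\<close> sends a wish.\<close>

definition wished :: "('x, 'h) pstate \<Rightarrow> bool" where
  "wished s \<longleftrightarrow> advanced s \<or> view_plus s > 0"

lemma wished_simps [simp]:
  "wished (s\<lparr>inbox := B\<rparr>) = wished s"
  by (simp add: wished_def)

lemmas move_simps = primitive_defs on_wish_fields2 wish_target_def

section \<open>The synchronizer variables and view 0\<close>

context pbft_run
begin

lemma correct_supporter:
  assumes "max_faulty P + 1 \<le> card {j \<in> procs P. R j}"
  obtains j where "j \<in> C" "R j"
proof -
  have "\<not> {j \<in> procs P. R j} \<subseteq> procs P - C"
    using assms card_faulty card_mono[of "procs P - C" "{j \<in> procs P. R j}"] by auto
  then show thesis using that by auto
qed

lemma correct_majority: "2 * max_faulty P + 1 \<le> card C"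
proof -
  have "card (procs P - C) = card (procs P) - card C"
    using C_procs by (intro card_Diff_subset finite_C) auto
  then show ?thesis using card_faulty by simp
qed

text \<open>Only \<open>on_wish\<close> changes \<open>max_views\<close>, \<open>sync_view\<close>
  or \<open>view_plus\<close>, and it recomputes the last two from the first. Their monotonicity
  thus reduces to that of \<open>max_views\<close>.\<close>

lemma supported_views:
  assumes "i \<in> C"
  shows "sync_view (st m i) = supported_view P (2 * max_faulty P + 1) (max_views (st m i)) \<and>
    view_plus (st m i) = supported_view P (max_faulty P + 1) (max_views (st m i))"
proof (induction m)
  case 0
  then show ?case using exec assms
    by (simp add: execution_def init_pstate_def supported_view_zero)
next
  case (Suc m)
  show ?case
    using assms
  proof (cases rule: state_cases[where m = m])
    case (move r)
    from move(1) Suc show ?thesis unfolding move(3)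
      by (cases rule: local_move_cases) (simp_all add: move_simps fun_upd_def del: upt_Suc)
  qed (use Suc in simp_all)
qed

lemma sync_view_le_view_plus: "i \<in> C \<Longrightarrow> sync_view (st m i) \<le> view_plus (st m i)"
  by (simp add: supported_views supported_view_antimono)

lemma max_views_Suc:
  assumes "i \<in> C"
  shows "max_views (st m i) j \<le> max_views (st (Suc m) i) j"
  using assms
proof (cases rule: state_cases[where m = m])
  case (move r)
  from move(1) show ?thesis unfolding move(3)
    by (cases rule: local_move_cases) (simp_all add: move_simps del: upt_Suc)
qed simp_all

lemma max_views_mono: "i \<in> C \<Longrightarrow> m \<le> m' \<Longrightarrow> max_views (st m i) j \<le> max_views (st m' i) j"
  by (rule lift_Suc_mono_le[of "\<lambda>m. max_views (st m i) j"]) (rule max_views_Suc)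

lemma sync_view_mono:
  assumes "i \<in> C" "m \<le> m'"
  shows "sync_view (st m i) \<le> sync_view (st m' i)"
  using assms by (simp add: supported_views supported_view_mono max_views_mono)

lemma enters_sync_view:
  assumes "i \<in> C" "occurs E m i (Enters v)"
  shows "sync_view (st m i) < v" "sync_view (st (Suc m) i) = v"
proof -
  obtain r where r: "move m i r" "Enters v \<in> set (events r)"
    using assms by (auto simp: occurs_iff)
  from r have "sync_view (st m i) < v \<and> sync_view r = v"
    by (cases rule: local_move_cases) (auto simp: move_simps simp del: upt_Suc split: if_splits)
  then show "sync_view (st m i) < v" "sync_view (st (Suc m) i) = v"
    using move_now(2)[OF assms(1) r(1)] by auto
qed

text \<open>Entering \<open>v\<close> lifts \<open>sync_view\<close> from below \<open>v\<close> to
  \<open>v\<close>, and \<open>sync_view\<close> never falls.\<close>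

lemma enters_unique:
  assumes "i \<in> C" "occurs E m i (Enters v)" "occurs E m' i (Enters v)"
  shows "m = m'"
proof (rule ccontr)
  assume "m \<noteq> m'"
  then consider "Suc m \<le> m'" | "Suc m' \<le> m" by linarith
  then show False
    using enters_sync_view[OF assms(1,2)] enters_sync_view[OF assms(1,3)]
      sync_view_mono[OF assms(1)] by cases (metis not_le)+
qed

text \<open>Recovery timers start on entering a view, and delivery timers only in normal status,
  which the guard \<open>v >= 1\<close> of NEW_STATE keeps out of view 0. An entered view exceeds an
  earlier \<open>sync_view\<close>, so a process never returns to 0.\<close>

lemma view_zero_idle:
  assumes "i \<in> C" "curr_view (st m i) = 0"
  shows "timer_recovery (st m i) = None" "timer_delivery (st m i) x = None"
    "status (st m i) \<noteq> Normal"
proof -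
  have "curr_view (st m i) = 0 \<longrightarrow> timer_recovery (st m i) = None \<and>
    (\<forall>x. timer_delivery (st m i) x = None) \<and> status (st m i) \<noteq> Normal"
  proof (induction m)
    case 0
    then show ?case using exec assms(1) by (simp add: execution_def init_pstate_def)
  next
    case (Suc m)
    show ?case
      using assms(1)
    proof (cases rule: state_cases[where m = m])
      case (move r)
      from move(1) Suc show ?thesis unfolding move(3)
        by (cases rule: local_move_cases)
          (auto simp: move_simps simp del: upt_Suc split: if_splits)
    qed (use Suc in simp_all)
  qed
  then show "timer_recovery (st m i) = None" "timer_delivery (st m i) x = None"
    "status (st m i) \<noteq> Normal" using assms(2) by auto
qed

lemma advances_zero:
  assumes "i \<in> C" "occurs E m i (Advances 0)"
  shows "act E m = Input i Start" "advanced (st (Suc m) i)"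
proof -
  obtain r where r: "move m i r" "Advances 0 \<in> set (events r)"
    using assms by (auto simp: occurs_iff)
  from r have "act E m = Input i Start \<and> advanced r"
    by (cases rule: local_move_cases)
      (use view_zero_idle[OF assms(1)] in \<open>auto simp: move_simps simp del: upt_Suc split: if_splits\<close>)
  then show "act E m = Input i Start" "advanced (st (Suc m) i)"
    using move_now(2)[OF assms(1) r(1)] by auto
qed

lemma start_after_gst: "i \<in> C \<Longrightarrow> act E m = Input i Start \<Longrightarrow> gst E \<le> now E m"
  using starts by (auto simp: starts_after_gst_def)

text \<open>A timeout needs a running timer and there is none in view 0, so an advance in view 0
  comes from \<open>Start\<close>, hence not before GST. This selects the second branch of
  \<open>stable_view\<close>.\<close>

lemma stable_view_eq_1: "stable_view P E = 1"
proof -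
  have "gst E \<le> t" if "t \<in> advance_times E 0" for t
    using that advances_zero(1) start_after_gst by (fastforce simp: advance_times_def)
  then have "advance_times E 0 \<noteq> {} \<longrightarrow> gst E \<le> A_first E 0"
    unfolding A_first_def by (intro impI cInf_greatest) auto
  then have "\<not> (advance_times E 0 \<noteq> {} \<and> A_first E 0 < gst E)" by linarith
  then show ?thesis unfolding stable_view_def by (simp only: if_False)
qed

subsection \<open>Before the first timeout\<close>

text \<open>The bound is strict: step \<open>m\<close> itself may be the first timeout, and the
  state in which it occurs is still covered.\<close>

definition no_timeout :: "nat \<Rightarrow> bool" where
  "no_timeout m \<longleftrightarrow> (\<forall>l<m. \<forall>i \<in> C. act E l \<noteq> Input i Timeout)"

lemma no_timeout_le: "no_timeout m \<Longrightarrow> m' \<le> m \<Longrightarrow> no_timeout m'"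
  by (simp add: no_timeout_def)

lemma no_timeout_act: "no_timeout m \<Longrightarrow> l < m \<Longrightarrow> i \<in> C \<Longrightarrow> act E l \<noteq> Input i Timeout"
  by (simp add: no_timeout_def)

text \<open>Nothing is claimed about the \<open>max_views\<close> entries of Byzantine senders. For
  correct ones, the \<open>in_flight\<close> clause controls what can still be recorded, and the
  last clause says that a wish is already recorded or sure to arrive. The latter needs the GST
  clause, since wishes sent before GST might be lost.\<close>

definition early :: "nat \<Rightarrow> bool" where
  "early m \<longleftrightarrow> (\<forall>i \<in> C.
     curr_view (st m i) = sync_view (st m i) \<and>
     (advanced (st m i) \<longrightarrow> sync_view (st m i) = 0) \<and>
     (curr_view (st m i) > 0 \<longrightarrow> status (st m i) \<noteq> Advanced) \<and>
     dur_delivery (st m i) = dur_delivery (st 0 i) \<and>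
     dur_recovery (st m i) = dur_recovery (st 0 i) \<and>
     (wished (st m i) \<longrightarrow> gst E \<le> now E m) \<and>
     (\<forall>j \<in> C. max_views (st m i) j \<le> 1 \<and>
        (max_views (st m i) j = 1 \<longrightarrow> wished (st m j)) \<and>
        (\<forall>v. in_flight m j i (WISH v) \<longrightarrow> v = 1 \<and> wished (st m j)) \<and>
        (wished (st m i) \<longrightarrow> max_views (st m j) i \<ge> 1 \<or> timely m i j (WISH 1))))"

text \<open>Entries of Byzantine processes are unbounded, but \<open>view_plus\<close> is reached by
  \<open>f + 1\<close> entries, one of which belongs to a correct process.\<close>

lemma early_view_plus:
  assumes "early m" "i \<in> C"
  shows "view_plus (st m i) \<le> 1" "sync_view (st m i) \<le> 1"
proof -
  have "max_faulty P + 1 \<le> card {j \<in> procs P. view_plus (st m i) \<le> max_views (st m i) j}"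
    using supported_view_support[of "max_faulty P + 1" P "max_views (st m i)"]
    by (simp add: supported_views[OF assms(2)])
  then obtain j where "j \<in> C" "view_plus (st m i) \<le> max_views (st m i) j"
    by (rule correct_supporter)
  then show "view_plus (st m i) \<le> 1" using assms by (fastforce simp: early_def)
  then show "sync_view (st m i) \<le> 1" using sync_view_le_view_plus[OF assms(2), of m] by simp
qed

lemma early_move:
  assumes m: "early m" and i: "i \<in> C" and mv: "move m i r" and nt: "act E m \<noteq> Input i Timeout"
  shows "curr_view r = sync_view r \<and>
     (advanced r \<longrightarrow> sync_view r = 0) \<and>
     (curr_view r > 0 \<longrightarrow> status r \<noteq> Advanced) \<and>
     dur_delivery r = dur_delivery (st m i) \<and>
     dur_recovery r = dur_recovery (st m i) \<and>
     (wished (st m i) \<longrightarrow> wished r) \<and>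
     (wished r \<longrightarrow> gst E \<le> now E m) \<and>
     (\<forall>j v. (j, WISH v) \<in> set (outbox r) \<longrightarrow> v = 1 \<and> wished r) \<and>
     (wished r \<and> \<not> wished (st m i) \<longrightarrow> (\<forall>j \<in> procs P. (j, WISH 1) \<in> set (outbox r))) \<and>
     (\<forall>j \<in> C. max_views r j \<le> 1 \<and>
       (max_views r j = 1 \<longrightarrow> max_views (st m i) j = 1 \<or> in_flight m j i (WISH 1)))"
    (is "?thesis r")
proof -
  let ?s = "st m i"
  have s: "curr_view ?s = sync_view ?s" "advanced ?s \<Longrightarrow> sync_view ?s = 0"
    "curr_view ?s > 0 \<Longrightarrow> status ?s \<noteq> Advanced"
    "wished ?s \<Longrightarrow> gst E \<le> now E m" and mv1: "\<And>j. j \<in> C \<Longrightarrow> max_views ?s j \<le> 1"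
    using m i by (auto simp: early_def)
  have vp: "view_plus ?s \<le> 1" "sync_view ?s \<le> 1" "sync_view ?s \<le> view_plus ?s"
    using early_view_plus[OF m i] sync_view_le_view_plus[OF i] by auto
  show ?thesis
    using mv
  proof (cases rule: local_move_cases)
    case (wish j v)
    define mv' where "mv' = (max_views ?s)(j := max (max_views ?s j) v)"
    have fl: "in_flight m j i (WISH v)" using wish by (simp add: in_flight_def)
    have mv'1: "mv' j' \<le> 1" "mv' j' = 1 \<Longrightarrow> max_views ?s j' = 1 \<or> in_flight m j' i (WISH 1)"
      if "j' \<in> C" for j'
      using that mv1[OF that] fl m i by (auto simp: mv'_def early_def max_def split: if_splits)
    define w where "w = supported_view P (2 * max_faulty P + 1) mv'"
    define wp where "wp = supported_view P (max_faulty P + 1) mv'"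
    have "max_faulty P + 1 \<le> card {j \<in> procs P. wp \<le> mv' j}"
      unfolding wp_def by (rule supported_view_support) simp
    then obtain j' where j': "j' \<in> C" "wp \<le> mv' j'" by (rule correct_supporter)
    have wp1: "wp \<le> 1" using j' mv'1(1) by force
    have wwp: "w \<le> wp" unfolding w_def wp_def by (intro supported_view_antimono) auto
    have le: "max_views ?s k \<le> mv' k" for k by (simp add: mv'_def)
    have wmono: "sync_view ?s \<le> w" "view_plus ?s \<le> wp"
      unfolding w_def wp_def using supported_views[OF i, of m] le
      by (auto intro: supported_view_mono)
    \<comment> \<open>A positive \<open>view_plus\<close> rests on the wish of some correct process.
      That process had wished before this step, so GST has passed.\<close>
    have g: "gst E \<le> now E m" if "wp > 0"
    proof -
      have "mv' j' = 1" using that j' mv'1(1)[OF j'(1)] by simp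
      from mv'1(2)[OF j'(1) this] have "wished (st m j')" using m i j'(1) by (auto simp: early_def)
      then show ?thesis using m j'(1) by (auto simp: early_def)
    qed
    have fields: "sync_view r = w" "view_plus r = wp" "max_views r = mv'"
      "advanced r \<longleftrightarrow> \<not> (wp = w \<and> w > sync_view ?s) \<and> advanced ?s"
      "curr_view r = (if wp = w \<and> w > sync_view ?s then w else curr_view ?s)"
      "status r = (if wp = w \<and> w > sync_view ?s then Initializing else status ?s)"
      "dur_delivery r = dur_delivery ?s" "dur_recovery r = dur_recovery ?s"
      "\<And>j v. (j, WISH v) \<in> set (outbox r) \<longleftrightarrow> wp > view_plus ?s \<and> v = wp \<and> j \<in> procs P"
      unfolding wish w_def wp_def mv'_def
      by (auto simp: on_wish_fields2 procs_def simp del: upt_Suc)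
    \<comment> \<open>Because \<open>w <= wp <= 1\<close>, an increase of \<open>w\<close> forces
      both to be 1. The side condition that the two views agree therefore never delays an
      entry.\<close>
    have a1: "wp = w \<and> w > sync_view ?s \<longleftrightarrow> w \<noteq> sync_view ?s"
      using wp1 wwp wmono vp by linarith
    show ?thesis
      unfolding wished_def fields a1 using s g mv'1 wp1 wwp wmono vp
      by (auto simp: wished_def)
  qed (use s vp mv1 nt start_after_gst[OF i] i in \<open>auto simp: move_simps wished_def procs_def
      max_def simp del: upt_Suc split: if_splits\<close>)
qed

lemma early_wished_Suc:
  assumes "early m" "i \<in> C" "act E m \<noteq> Input i Timeout" "wished (st m i)"
  shows "wished (st (Suc m) i)"
  using assms(2)
proof (cases rule: state_cases[where m = m])
  case (move r)
  then show ?thesis using early_move[OF assms(1,2) move(1) assms(3)] assms(4) by simp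
qed (use assms in simp_all)

lemma early_Suc:
  assumes m: "early m" and nt: "\<And>i. i \<in> C \<Longrightarrow> act E m \<noteq> Input i Timeout"
  shows "early (Suc m)"
  unfolding early_def
proof (intro ballI conjI)
  fix i assume i: "i \<in> C"
  note em = early_move[OF m i _ nt[OF i]]
  have s: "curr_view (st m i) = sync_view (st m i)" "advanced (st m i) \<longrightarrow> sync_view (st m i) = 0"
    "curr_view (st m i) > 0 \<longrightarrow> status (st m i) \<noteq> Advanced"
    "dur_delivery (st m i) = dur_delivery (st 0 i)" "dur_recovery (st m i) = dur_recovery (st 0 i)"
    "wished (st m i) \<longrightarrow> gst E \<le> now E m"
    using m i by (auto simp: early_def)
  let ?t = "st (Suc m) i"
  have "curr_view ?t = sync_view ?t \<and> (advanced ?t \<longrightarrow> sync_view ?t = 0) \<and>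
    (curr_view ?t > 0 \<longrightarrow> status ?t \<noteq> Advanced) \<and> dur_delivery ?t = dur_delivery (st 0 i) \<and>
    dur_recovery ?t = dur_recovery (st 0 i) \<and> (wished ?t \<longrightarrow> gst E \<le> now E (Suc m))"
    using i
  proof (cases rule: state_cases[where m = m])
    case (move r)
    then show ?thesis using em[OF move(1)] s by simp
  qed (use s now_Suc[of m] in auto)
  then show "curr_view ?t = sync_view ?t" "(advanced ?t \<longrightarrow> sync_view ?t = 0)"
    "(curr_view ?t > 0 \<longrightarrow> status ?t \<noteq> Advanced)" "dur_delivery ?t = dur_delivery (st 0 i)"
    "dur_recovery ?t = dur_recovery (st 0 i)" "(wished ?t \<longrightarrow> gst E \<le> now E (Suc m))"
    by auto
  fix j assume j: "j \<in> C"
  have sj: "max_views (st m i) j \<le> 1" "max_views (st m i) j = 1 \<longrightarrow> wished (st m j)"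
    "\<forall>v. in_flight m j i (WISH v) \<longrightarrow> v = 1 \<and> wished (st m j)"
    "wished (st m i) \<longrightarrow> max_views (st m j) i \<ge> 1 \<or> timely m i j (WISH 1)"
    using m i j by (auto simp: early_def)
  note wj = early_wished_Suc[OF m j nt[OF j]]
  have "max_views ?t j \<le> 1 \<and> (max_views ?t j = 1 \<longrightarrow> wished (st (Suc m) j))"
    using i
  proof (cases rule: state_cases[where m = m])
    case (move r)
    then show ?thesis using em[OF move(1)] sj wj j by auto
  qed (use sj wj in auto)
  then show "max_views ?t j \<le> 1" "max_views ?t j = 1 \<longrightarrow> wished (st (Suc m) j)" by auto
  show "\<forall>v. in_flight (Suc m) j i (WISH v) \<longrightarrow> v = 1 \<and> wished (st (Suc m) j)"
  proof (intro allI impI)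
    fix v assume "in_flight (Suc m) j i (WISH v)"
    from in_flight_origin[OF j i this] show "v = 1 \<and> wished (st (Suc m) j)"
    proof (elim disjE exE conjE)
      fix r assume r: "move m j r" "(i, WISH v) \<in> set (outbox r)"
      then show ?thesis using early_move[OF m j r(1) nt[OF j]] move_now(2)[OF j r(1)] by auto
    qed (use sj wj in auto)
  qed
  show "wished ?t \<longrightarrow> max_views (st (Suc m) j) i \<ge> 1 \<or> timely (Suc m) i j (WISH 1)"
  proof
    assume w: "wished ?t"
    show "max_views (st (Suc m) j) i \<ge> 1 \<or> timely (Suc m) i j (WISH 1)"
    proof (cases "wished (st m i)")
      case True
      then consider "max_views (st m j) i \<ge> 1" | "timely m i j (WISH 1)" using sj by blast
      then show ?thesis
      proof cases
        case 1
        then show ?thesis using max_views_Suc[OF j, of m i] by simp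
      next
        case 2
        show ?thesis
        proof (cases "act E m = Handle j (On i (WISH 1))")
          case True
          then obtain r where "move m j r" using step[of m] by (auto intro: local_move.intros)
          moreover from this have "max_views r i \<ge> 1"
            using True by (cases rule: local_move_cases) auto
          ultimately show ?thesis using move_now(2)[OF j] by auto
        qed (use timely_step[OF j 2] in auto)
      qed
    next
      \<comment> \<open>At the very step at which \<open>i\<close> begins to wish it sends
        \<open>WISH 1\<close> to all, and this is no earlier than GST, so the message is
        timely.\<close>
      case False
      from i obtain r where r: "move m i r" "?t = r\<lparr>inbox := inbox r + own i r\<rparr>"
        using w False by (cases rule: state_cases[where m = m]) auto
      then show ?thesis using timely_new[OF i r(1)] em[OF r(1)] w False C_procs[OF j] by auto
    qed
  qed
qed

lemma early_0: "early 0"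
  using exec
  by (simp add: early_def wished_def execution_def init_pstate_def)

lemma no_timeout_early: "no_timeout m \<Longrightarrow> early m"
proof (induction m)
  case (Suc m)
  then show ?case using no_timeout_le[of "Suc m" m] by (intro early_Suc) (auto simp: no_timeout_def)
qed (rule early_0)


lemma early_curr_view:
  assumes "no_timeout m" "i \<in> C"
  shows "curr_view (st m i) = sync_view (st m i)" "curr_view (st m i) \<le> 1"
  using no_timeout_early[OF assms(1)] early_view_plus(2)[of m i] assms(2)
  by (auto simp: early_def)

lemma wished_mono:
  assumes "no_timeout m'" "i \<in> C" "m \<le> m'" "wished (st m i)"
  shows "wished (st m' i)"
  using assms(3,1,4)
proof (induction m' rule: dec_induct)
  case (step l)
  then show ?case
    using early_wished_Suc[of l i] no_timeout_early[of l] no_timeout_le[of "Suc l" l]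
      no_timeout_act[of "Suc l" l i] assms(2) by simp
qed

lemma curr_view_mono:
  assumes "no_timeout m'" "i \<in> C" "m \<le> m'" "curr_view (st m i) = 1"
  shows "curr_view (st m' i) = 1"
  using early_curr_view[OF assms(1,2)] early_curr_view[OF no_timeout_le[OF assms(1,3)] assms(2)]
    sync_view_mono[OF assms(2,3)] assms(4) by simp

lemma enters_curr_view:
  assumes "i \<in> C" "occurs E m i (Enters 1)" "no_timeout m'" "m < m'"
  shows "curr_view (st m' i) = 1"
proof (rule curr_view_mono[OF assms(3,1)])
  show "curr_view (st (Suc m) i) = 1"
    using enters_sync_view(2)[OF assms(1,2)] early_curr_view(1)[of "Suc m" i] assms
      no_timeout_le[of m' "Suc m"] by simp
qed (use assms in simp)

lemma view_1_wished:
  assumes "i \<in> C" "sync_view (st m i) > 0"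
  shows "wished (st m i)"
  using sync_view_le_view_plus[OF assms(1), of m] assms(2) by (simp add: wished_def)

lemma wished_gst: "no_timeout m \<Longrightarrow> i \<in> C \<Longrightarrow> wished (st m i) \<Longrightarrow> gst E \<le> now E m"
  using no_timeout_early by (auto simp: early_def)

lemma move_exists: "i \<in> C \<Longrightarrow> act E m = Handle i H \<Longrightarrow> \<exists>r. move m i r"
  using step[of m] by (auto intro: local_move.intros)

lemma quiescentD: "at_end T m \<Longrightarrow> i \<in> C \<Longrightarrow> \<not> ready P i (st m i) H"
  using at_end_quiescent by (auto simp: quiescent_def)

lemma wish_arrives:
  assumes "i \<in> C" "j \<in> C" "wished (st m i)" "now E m + d \<le> T" "at_end T m'" "no_timeout m'"
  shows "max_views (st m' j) i \<ge> 1"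
proof -
  have "m \<le> m'" using at_end_after[OF assms(5), of m] assms(4) d_pos by simp
  then have "early m" using assms(6) no_timeout_early no_timeout_le by blast
  then have "timely m i j (WISH 1) \<or> max_views (st m j) i \<ge> 1"
    using assms(1-3) by (auto simp: early_def)
  then have "(i, WISH 1) \<in># inbox (st m' j) \<or> max_views (st m' j) i \<ge> 1"
  proof (rule arrives[OF assms(1,2) _ assms(4,5)])
    fix l assume "act E l = Handle j (On i (WISH 1))"
    moreover from this obtain r where r: "move l j r" using move_exists[OF assms(2)] by blast
    ultimately have "max_views r i \<ge> 1"
      by (cases rule: local_move_cases[OF r]) auto
    then show "max_views (st (Suc l) j) i \<ge> 1" using move_now(2)[OF assms(2) r] by simp
  next
    show "max_views (st (Suc l) j) i \<ge> 1" if "max_views (st l j) i \<ge> 1" for l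
      using max_views_Suc[OF assms(2), of l i] that by simp
  qed
  \<comment> \<open>A \<open>WISH\<close> is ready in every state, so none remains in the inbox of a
    quiescent process.\<close>
  then show ?thesis using quiescentD[OF assms(5,2), of "On i (WISH 1)"] by auto
qed

lemma all_wished_enter:
  assumes "\<And>i. i \<in> C \<Longrightarrow> wished (st m i)" "now E m + d \<le> T" "at_end T m'" "no_timeout m'"
    and "j \<in> C"
  shows "curr_view (st m' j) = 1"
proof -
  have "C \<subseteq> {i \<in> procs P. 1 \<le> max_views (st m' j) i}"
    using wish_arrives[OF _ assms(5) assms(1-4)] C_procs by auto
  then have "card C \<le> card {i \<in> procs P. 1 \<le> max_views (st m' j) i}"
    by (intro card_mono) auto
  then have "2 * max_faulty P + 1 \<le> card {i \<in> procs P. 1 \<le> max_views (st m' j) i}"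
    using correct_majority by linarith
  then have "1 \<le> sync_view (st m' j)"
    unfolding supported_views[OF assms(5), of m', THEN conjunct1]
    by (intro supported_view_greatest) auto
  then show ?thesis using early_curr_view[OF assms(4,5)] by simp
qed

lemma view_1_spreads:
  assumes "i \<in> C" "curr_view (st m i) = 1" "now E m + 2 * d \<le> T" "at_end T m'" "no_timeout m'"
    and "j \<in> C"
  shows "curr_view (st m' j) = 1"
proof -
  have mm': "m \<le> m'" using at_end_after[OF assms(4), of m] assms(3) d_pos by simp
  have e: "early m" using no_timeout_early no_timeout_le[OF assms(5) mm'] by blast
  let ?A = "{k \<in> procs P. 1 \<le> max_views (st m i) k}"
  let ?K = "{k \<in> C. 1 \<le> max_views (st m i) k}"
  have "sync_view (st m i) = 1" using e assms(1,2) by (simp add: early_def)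
  then have "2 * max_faulty P + 1 \<le> card ?A"
    using supported_view_support[of "2 * max_faulty P + 1" P "max_views (st m i)"]
    by (simp add: supported_views[OF assms(1)])
  also have "card ?A \<le> card (?K \<union> (procs P - C))" using finite_C by (intro card_mono) auto
  also have "\<dots> \<le> card ?K + card (procs P - C)" by (rule card_Un_le)
  finally have K: "max_faulty P + 1 \<le> card ?K" using card_faulty by simp
  obtain m1 where m1: "at_end (now E m + d) m1" "m \<le> m1"
    using at_end_exists[of m "now E m + d"] d_pos by auto
  have m1m': "m1 \<le> m'"
    using m1(1) assms(3) d_pos at_end_after[OF assms(4), of m1] by (auto simp: at_end_def)
  have nt1: "no_timeout m1" using no_timeout_le[OF assms(5) m1m'] .
  have "wished (st m1 k)" if k: "k \<in> C" for k
  proof -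
    have "?K \<subseteq> {k' \<in> procs P. 1 \<le> max_views (st m1 k) k'}"
    proof clarify
      fix k' assume k': "k' \<in> C" "1 \<le> max_views (st m i) k'"
      \<comment> \<open>An entry recorded for a correct process proves that it wished, and it sends
        its wish to everyone, not only to \<open>i\<close>.\<close>
      then have "wished (st m k')" using e assms(1) by (force simp: early_def)
      then show "k' \<in> procs P \<and> 1 \<le> max_views (st m1 k) k'"
        using wish_arrives[OF k'(1) k _ _ m1(1) nt1] C_procs[OF k'(1)] by simp
    qed
    then have "card ?K \<le> card {k' \<in> procs P. 1 \<le> max_views (st m1 k) k'}"
      by (intro card_mono) auto
    then have "1 \<le> view_plus (st m1 k)" unfolding supported_views[OF k, of m1, THEN conjunct2]
      using K by (intro supported_view_greatest) auto
    then show ?thesis by (simp add: wished_def)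
  qed
  moreover have "now E m1 + d \<le> T" using m1(1) assms(3) by (simp add: at_end_def)
  ultimately show ?thesis using all_wished_enter[OF _ _ assms(4-6)] by blast
qed

subsection \<open>Timers\<close>

text \<open>The only two occasions on which a timer starts are the entry into a view and the
  handling of a BROADCAST; every other move keeps a timer or stops it.\<close>

lemma timers_after_move:
  assumes "move m i r" "act E m \<noteq> Input i Timeout"
  shows "(Enters (sync_view r) \<in> set (events r) \<and>
      timer_recovery r = Some (clk m i + dur_recovery (st m i)) \<and> timer_delivery r = (\<lambda>_. None)) \<or>
    (curr_view r = curr_view (st m i) \<and>
      (timer_recovery r = None \<or> timer_recovery r = timer_recovery (st m i)) \<and>
      (\<forall>x. timer_delivery r x = None \<or> timer_delivery r x = timer_delivery (st m i) x \<or>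
        (\<exists>j' j. act E m = Handle i (On j' (Signed j (BROADCAST x))) \<and>
          timer_delivery r x = Some (clk m i + dur_delivery (st m i)))))"
  using assms
  by (cases rule: local_move_cases) (auto simp: move_simps simp del: upt_Suc)

text \<open>The history of a process in view 1: its entry and, for each running timer, the step that
  started it. The durations are still the initial ones, since only timeouts raise them, and entering
  stopped all older delivery timers, whence \<open>m0 < m1\<close>.\<close>

lemma entered:
  assumes "no_timeout m" "i \<in> C" "curr_view (st m i) > 0"
  obtains m0 where "m0 < m" "occurs E m0 i (Enters 1)" "gst E \<le> now E m0"
    "\<And>\<delta>. timer_recovery (st m i) = Some \<delta> \<Longrightarrow> \<delta> = clk m0 i + dur_recovery (st 0 i)"
    "\<And>x \<delta>. timer_delivery (st m i) x = Some \<delta> \<Longrightarrow>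
       \<exists>m1 j' j. m0 < m1 \<and> m1 < m \<and> act E m1 = Handle i (On j' (Signed j (BROADCAST x))) \<and>
         \<delta> = clk m1 i + dur_delivery (st 0 i)"
proof -
  let ?Q = "\<lambda>m m0. m0 < m \<and> occurs E m0 i (Enters 1) \<and>
    (\<forall>\<delta>. timer_recovery (st m i) = Some \<delta> \<longrightarrow> \<delta> = clk m0 i + dur_recovery (st 0 i)) \<and>
    (\<forall>x \<delta>. timer_delivery (st m i) x = Some \<delta> \<longrightarrow>
       (\<exists>m1 j' j. m0 < m1 \<and> m1 < m \<and> act E m1 = Handle i (On j' (Signed j (BROADCAST x))) \<and>
         \<delta> = clk m1 i + dur_delivery (st 0 i)))"
  have "\<exists>m0. ?Q m m0"
    using assms(1,3)
  proof (induction m)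
    case 0
    then show ?case using exec assms(2) by (simp add: execution_def init_pstate_def)
  next
    case (Suc m)
    have ntm: "no_timeout m" using Suc.prems no_timeout_le by simp
    have e: "early m" by (rule no_timeout_early[OF ntm])
    show ?case
      using assms(2)
    proof (cases rule: state_cases[where m = m])
      case idle
      then obtain m0 where "?Q m m0" using Suc ntm by auto
      then have "?Q (Suc m) m0" unfolding idle by (meson less_SucI)
      then show ?thesis by blast
    next
      case (receive q)
      then obtain m0 where "?Q m m0" using Suc ntm by auto
      then have "?Q (Suc m) m0" unfolding receive(4) by (simp, meson less_SucI)
      then show ?thesis by blast
    next
      case (move r)
      have act: "act E m \<noteq> Input i Timeout"
        using no_timeout_act[OF Suc.prems(1)] assms(2) by simp
      have s: "dur_recovery (st m i) = dur_recovery (st 0 i)"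
        "dur_delivery (st m i) = dur_delivery (st 0 i)"
        using e assms(2) by (auto simp: early_def)
      have cv: "curr_view (st (Suc m) i) = 1" "curr_view r = sync_view r"
        using Suc.prems early_curr_view[OF Suc.prems(1) assms(2)] move(3) by auto
      from timers_after_move[OF move(1) act] show ?thesis
      proof
        assume a: "Enters (sync_view r) \<in> set (events r) \<and>
          timer_recovery r = Some (clk m i + dur_recovery (st m i)) \<and>
          timer_delivery r = (\<lambda>_. None)"
        then have "occurs E m i (Enters 1)"
          using move cv occurs_iff[OF assms(2)] by auto
        then have "?Q (Suc m) m" using a s move(3) by auto
        then show ?thesis by blast
      next
        assume a: "curr_view r = curr_view (st m i) \<and>
          (timer_recovery r = None \<or> timer_recovery r = timer_recovery (st m i)) \<and>
          (\<forall>x. timer_delivery r x = None \<or> timer_delivery r x = timer_delivery (st m i) x \<or>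
            (\<exists>j' j. act E m = Handle i (On j' (Signed j (BROADCAST x))) \<and>
              timer_delivery r x = Some (clk m i + dur_delivery (st m i))))"
        then obtain m0 where m0: "?Q m m0" using Suc ntm cv move(3) by auto
        have "?Q (Suc m) m0"
        proof (intro conjI allI impI)
          show "m0 < Suc m" "occurs E m0 i (Enters 1)" using m0 by auto
          show "\<delta> = clk m0 i + dur_recovery (st 0 i)"
            if "timer_recovery (st (Suc m) i) = Some \<delta>" for \<delta>
            using that a m0 move(3) by auto
          fix x \<delta> assume x: "timer_delivery (st (Suc m) i) x = Some \<delta>"
          then have "timer_delivery (st m i) x = Some \<delta> \<or>
            (\<exists>j' j. act E m = Handle i (On j' (Signed j (BROADCAST x))) \<and>
              \<delta> = clk m i + dur_delivery (st 0 i))"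
            using a move(3) s by (auto dest!: spec[of _ x])
          then show "\<exists>m1 j' j. m0 < m1 \<and> m1 < Suc m \<and>
            act E m1 = Handle i (On j' (Signed j (BROADCAST x))) \<and>
            \<delta> = clk m1 i + dur_delivery (st 0 i)"
          proof
            assume "timer_delivery (st m i) x = Some \<delta>"
            then show ?thesis using m0 by (meson less_SucI)
          next
            assume "\<exists>j' j. act E m = Handle i (On j' (Signed j (BROADCAST x))) \<and>
              \<delta> = clk m i + dur_delivery (st 0 i)"
            then show ?thesis using m0 by blast
          qed
        qed
        then show ?thesis by blast
      qed
    qed
  qed
  then obtain m0 where m0: "?Q m m0" by blast
  \<comment> \<open>After the entry the process wishes, which the invariant allows only from GST
    on.\<close>
  have "no_timeout (Suc m0)" using no_timeout_le[OF assms(1)] m0 by simp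
  moreover have "wished (st (Suc m0) i)"
    using m0 enters_sync_view(2)[OF assms(2), of m0 1] by (intro view_1_wished assms(2)) simp
  ultimately have "gst E \<le> now E (Suc m0)" using wished_gst assms(2) by blast
  moreover have "now E (Suc m0) = now E m0"
    using m0 occurs_iff[OF assms(2)] move_now(1)[OF assms(2)] by blast
  ultimately show thesis using that[of m0] m0 by auto
qed

lemma clock_diff:
  "i \<in> C \<Longrightarrow> gst E \<le> now E m \<Longrightarrow> m \<le> m' \<Longrightarrow> clk m' i - clk m i = now E m' - now E m"
  using exec now_mono by (auto simp: execution_def)

text \<open>A timer that fires was started in view 1, hence after GST, where local clocks advance
  with real time. The assumptions on the initial durations thus turn into strict gaps in real
  time.\<close>

lemma first_timeout:
  assumes "no_timeout m" "i \<in> C" "act E m = Input i Timeout"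
  obtains (rec) m0 where "m0 < m" "occurs E m0 i (Enters 1)" "gst E \<le> now E m0"
      "timer_recovery (st m i) \<noteq> None" "now E m0 + 5 * d < now E m"
  | (del) m0 m1 j' j x where "m0 < m1" "m1 < m" "occurs E m0 i (Enters 1)"
      "gst E \<le> now E m0" "timer_delivery (st m i) x \<noteq> None" "now E m1 + 4 * d < now E m"
      "act E m1 = Handle i (On j' (Signed j (BROADCAST x)))"
proof -
  obtain \<delta> where \<delta>: "\<delta> \<le> clk m i"
    "timer_recovery (st m i) = Some \<delta> \<or> (\<exists>x. timer_delivery (st m i) x = Some \<delta>)"
    using step[of m] assms(3) by auto
  have "curr_view (st m i) > 0"
    using \<delta>(2) view_zero_idle(1,2)[OF assms(2), of m] by (cases "curr_view (st m i)") auto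
  from entered[OF assms(1,2) this] obtain m0 where m0: "m0 < m" "occurs E m0 i (Enters 1)"
    "gst E \<le> now E m0"
    "\<And>\<delta>. timer_recovery (st m i) = Some \<delta> \<Longrightarrow> \<delta> = clk m0 i + dur_recovery (st 0 i)"
    "\<And>x \<delta>. timer_delivery (st m i) x = Some \<delta> \<Longrightarrow>
       \<exists>m1 j' j. m0 < m1 \<and> m1 < m \<and> act E m1 = Handle i (On j' (Signed j (BROADCAST x))) \<and>
         \<delta> = clk m1 i + dur_delivery (st 0 i)" by blast
  show thesis
    using \<delta>(2)
  proof
    assume t: "timer_recovery (st m i) = Some \<delta>"
    have "now E m0 + 5 * d < now E m"
      using m0(4)[OF t] \<delta>(1) clock_diff[OF assms(2) m0(3), of m] m0(1) recovery assms(2) by force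
    then show thesis using rec[of m0] m0 t by simp
  next
    assume "\<exists>x. timer_delivery (st m i) x = Some \<delta>"
    then obtain x where t: "timer_delivery (st m i) x = Some \<delta>" by blast
    obtain m1 j' j where m1: "m0 < m1" "m1 < m"
      "act E m1 = Handle i (On j' (Signed j (BROADCAST x)))"
      "\<delta> = clk m1 i + dur_delivery (st 0 i)" using m0(5)[OF t] by blast
    have "gst E \<le> now E m1" using m0(3) now_mono[of m0 m1] m1(1) by simp
    then have "now E m1 + 4 * d < now E m"
      using m1 \<delta>(1) clock_diff[OF assms(2), of m1 m] delivery assms(2) by force
    then show thesis using del[of m0 m1 x j' j] m0 m1 t by simp
  qed
qed

lemma enters_now: "i \<in> C \<Longrightarrow> occurs E m i e \<Longrightarrow> now E (Suc m) = now E m"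
  using occurs_iff move_now(1) by blast

lemma all_entered_before_timeout:
  assumes "no_timeout m" "i \<in> C" "act E m = Input i Timeout" "j \<in> C"
  shows "curr_view (st m j) = 1"
proof -
  obtain m0 where m0: "m0 < m" "occurs E m0 i (Enters 1)" "now E m0 + 2 * d < now E m"
  proof (rule first_timeout[OF assms(1-3)])
    fix m0 assume "m0 < m" "occurs E m0 i (Enters 1)" "now E m0 + 5 * d < now E m"
    then show thesis using that[of m0] d_pos by simp
  next
    fix m0 m1 assume "m0 < m1" "m1 < m" "occurs E m0 i (Enters 1)" "now E m1 + 4 * d < now E m"
    then show thesis using that[of m0] d_pos now_mono[of m0 m1] by simp
  qed
  obtain m2 where m2: "at_end (now E m0 + 2 * d) m2" "m0 \<le> m2"
    using at_end_exists[of m0 "now E m0 + 2 * d"] d_pos by auto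
  \<comment> \<open>Here the strictness of the gap matters: even the last configuration at
    \<open>now E m0 + 2 * d\<close> precedes the timeout.\<close>
  have "m2 < m" using at_end_before[OF m2(1) m0(3)] .
  then have nt2: "no_timeout m2" using no_timeout_le[OF assms(1)] by simp
  have "no_timeout (Suc m0)" using no_timeout_le[OF assms(1)] m0 by simp
  then have "curr_view (st (Suc m0) i) = 1" using enters_curr_view[OF assms(2) m0(2)] by simp
  then have "curr_view (st m2 j) = 1"
    using view_1_spreads[OF assms(2) _ _ m2(1) nt2 assms(4)] enters_now[OF assms(2) m0(2)] by simp
  then show ?thesis using curr_view_mono[OF assms(1,4), of m2] \<open>m2 < m\<close> by simp
qed

subsection \<open>Entering view 1\<close>

text \<open>The infimum \<open>T_zero\<close> is attained: the step indices are well-ordered, and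
  time is monotone in them.\<close>

lemma leave_zero_by_T_last_zero:
  assumes "leave_zero_times E i \<noteq> {}" "i \<in> C"
  obtains m where "now E m \<le> T_last_zero E"
    "occurs E m i (Advances 0) \<or> (\<exists>v > 0. occurs E m i (Enters v))"
proof -
  let ?R = "\<lambda>m. occurs E m i (Advances 0) \<or> (\<exists>v > 0. occurs E m i (Enters v))"
  define l where "l = (LEAST m. ?R m)"
  have "\<exists>m. ?R m" using assms(1) by (auto simp: leave_zero_times_def)
  then have l: "?R l" unfolding l_def by (rule LeastI_ex)
  have "now E l \<le> now E m" if "?R m" for m
    using that unfolding l_def by (intro now_mono Least_le)
  then have "T_zero E i = now E l"
    unfolding T_zero_def using l by (intro cInf_eq_minimum) (auto simp: leave_zero_times_def)
  moreover have "T_zero E i \<le> T_last_zero E"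
    unfolding T_last_zero_def using finite_C assms(2) by (intro Max_ge) auto
  ultimately show thesis using that l by simp
qed

context
  assumes T_defined: "\<forall>i \<in> C. leave_zero_times E i \<noteq> {}"
begin

text \<open>Both ways of leaving view 0 make a process wish: the call sets \<open>advanced\<close>,
  and an entry leaves \<open>view_plus\<close> at least as large as the positive
  \<open>sync_view\<close>.\<close>

lemma wished_by_T_last_zero:
  assumes "at_end (T_last_zero E) m" "no_timeout m" "i \<in> C"
  shows "wished (st m i)"
proof -
  obtain l where l: "now E l \<le> T_last_zero E"
    "occurs E l i (Advances 0) \<or> (\<exists>v > 0. occurs E l i (Enters v))"
    using leave_zero_by_T_last_zero T_defined assms(3) by blast
  have "now E (Suc l) = now E l" using l(2) enters_now[OF assms(3)] by blast
  then have "Suc l \<le> m" using at_end_after[OF assms(1)] l(1) by simp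
  moreover have "wished (st (Suc l) i)"
    using l(2) advances_zero(2)[OF assms(3)] enters_sync_view(2)[OF assms(3)]
      view_1_wished[OF assms(3), of "Suc l"] by (auto simp: wished_def)
  ultimately show ?thesis using wished_mono[OF assms(2,3)] by blast
qed

lemma T_last_zero_ge: "now E 0 \<le> T_last_zero E"
proof -
  obtain i where "i \<in> C" using correct_majority by fastforce
  then obtain m where "now E m \<le> T_last_zero E"
    using leave_zero_by_T_last_zero T_defined by blast
  then show ?thesis using now_mono[of 0 m] by simp
qed

lemma view_1_by_T_last_zero:
  assumes "at_end T m'" "T_last_zero E + d \<le> T" "no_timeout m'" "j \<in> C"
  shows "curr_view (st m' j) = 1"
proof -
  obtain m where m: "at_end (T_last_zero E) m" using at_end_exists[OF T_last_zero_ge] by blast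
  then have "now E m + d \<le> T" using assms(2) by (simp add: at_end_def)
  moreover from this have "m \<le> m'" using at_end_after[OF assms(1)] d_pos by simp
  then have "\<And>i. i \<in> C \<Longrightarrow> wished (st m i)"
    using wished_by_T_last_zero[OF m] no_timeout_le[OF assms(3)] by blast
  ultimately show ?thesis using all_wished_enter assms by blast
qed

text \<open>Under a Byzantine leader the invariant may be broken before
  \<open>T_last_zero E + d\<close>. Then a first timeout lies before that moment, and at the first
  timeout everyone is in view 1 already.\<close>

lemma enters_view_1:
  assumes "i \<in> C"
  obtains m where "occurs E m i (Enters 1)" "now E m \<le> T_last_zero E + d"
proof -
  obtain m' where m': "at_end (T_last_zero E + d) m'"
    using at_end_exists[of 0 "T_last_zero E + d"] T_last_zero_ge d_pos by force
  obtain m where m: "m \<le> m'" "no_timeout m" "curr_view (st m i) = 1"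
  proof (cases "no_timeout m'")
    case True
    then show ?thesis using that[of m'] view_1_by_T_last_zero[OF m' _ _ assms] by simp
  next
    case False
    define l where "l = (LEAST l. l < m' \<and> (\<exists>k \<in> C. act E l = Input k Timeout))"
    have "\<exists>l. l < m' \<and> (\<exists>k \<in> C. act E l = Input k Timeout)"
      using False by (auto simp: no_timeout_def)
    then have l: "l < m' \<and> (\<exists>k \<in> C. act E l = Input k Timeout)"
      unfolding l_def by (rule LeastI_ex)
    have "no_timeout l"
      unfolding no_timeout_def l_def
      using not_less_Least[of _ "\<lambda>l. l < m' \<and> (\<exists>k \<in> C. act E l = Input k Timeout)"] l
      by (metis l_def less_trans)
    then show ?thesis using that[of l] l all_entered_before_timeout assms by force
  qed
  from entered[OF m(2) assms] m(3) obtain m0 where "m0 < m" "occurs E m0 i (Enters 1)" by force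
  moreover from this have "now E m0 \<le> T_last_zero E + d"
    using m(1) m' now_mono[of m0 m'] by (simp add: at_end_def)
  ultimately show thesis using that by blast
qed

text \<open>The supremum ranges over all entries into view 1; as a process enters it only once, each
  of them is the entry already bounded.\<close>

lemma E_last_le: "E_last E 1 \<le> T_last_zero E + d"
  unfolding E_last_def
proof (rule cSup_least)
  obtain i where "i \<in> C" using correct_majority by fastforce
  then show "enter_times E 1 \<noteq> {}"
    using enters_view_1 by (force simp: enter_times_def)
  fix t assume "t \<in> enter_times E 1"
  then obtain m i where m: "t = now E m" "i \<in> C" "occurs E m i (Enters 1)"
    by (auto simp: enter_times_def)
  obtain m' where "occurs E m' i (Enters 1)" "now E m' \<le> T_last_zero E + d"
    using enters_view_1[OF m(2)] by blast
  then show "t \<le> T_last_zero E + d" using enters_unique[OF m(2,3)] m(1) by auto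
qed

end

end

subsection \<open>The proposals of a correct leader\<close>

text \<open>The local half of agreement, where \<open>R k x\<close> stands for "\<open>x\<close> is
  proposed at position \<open>k\<close>". The last two clauses are particular to view 1: the log is
  empty until NEW_STATE arrives, and since its log is empty too, accepting it stops the recovery
  timer at once. The clause on \<open>has_delivered\<close> shows that a timely delivery prevents
  the expiry of a delivery timer.\<close>

definition sound :: "(pos \<Rightarrow> 'x \<Rightarrow> bool) \<Rightarrow> ('x, 'h) pstate \<Rightarrow> bool" where
  "sound R s \<longleftrightarrow>
     (\<forall>k x. cur_log s k = Some x \<longrightarrow> R k x \<and> k \<ge> 1) \<and>
     (\<forall>k. phase s k = Start_Phase \<longleftrightarrow> cur_log s k = None) \<and>
     (\<forall>k. phase s k = Prepared \<or> phase s k = Committed \<longrightarrow> prep_log s k = cur_log s k) \<and>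
     (\<forall>k. phase s k = Committed \<longrightarrow> commit_log s k \<noteq> None) \<and>
     (\<forall>k x. commit_log s k = Some x \<longrightarrow> R k x) \<and>
     (\<forall>k. 1 \<le> k \<and> k \<le> last_delivered s \<longrightarrow> commit_log s k \<noteq> None) \<and>
     (\<forall>x. has_delivered s x \<longrightarrow> timer_delivery s x = None) \<and>
     (status s \<noteq> Normal \<longrightarrow> (\<forall>k. cur_log s k = None)) \<and>
     (status s = Normal \<longrightarrow> timer_recovery s = None)"

lemma soundD:
  assumes "sound R s"
  shows "\<forall>k x. cur_log s k = Some x \<longrightarrow> R k x \<and> k \<ge> 1"
    and "\<forall>k. phase s k = Start_Phase \<longleftrightarrow> cur_log s k = None"
    and "\<forall>k. phase s k = Prepared \<or> phase s k = Committed \<longrightarrow> prep_log s k = cur_log s k"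
    and "\<forall>k. phase s k = Committed \<longrightarrow> commit_log s k \<noteq> None"
    and "\<forall>k x. commit_log s k = Some x \<longrightarrow> R k x"
    and "\<forall>k. 1 \<le> k \<and> k \<le> last_delivered s \<longrightarrow> commit_log s k \<noteq> None"
    and "\<forall>x. has_delivered s x \<longrightarrow> timer_delivery s x = None"
    and "status s \<noteq> Normal \<longrightarrow> (\<forall>k. cur_log s k = None)"
    and "status s = Normal \<longrightarrow> timer_recovery s = None"
  using assms unfolding sound_def by - (elim conjE, assumption)+

lemma sound_mono:
  assumes "sound R s" and R: "\<And>k x. R k x \<Longrightarrow> R' k x"
  shows "sound R' s"
  unfolding sound_def
  by (intro conjI soundD(2-4,6-9)[OF assms(1)])
    (use R soundD(1,5)[OF assms(1)] in blast)+

lemma sound_inbox [simp]: "sound R (s\<lparr>inbox := B\<rparr>) = sound R s"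
  by (simp add: sound_def has_delivered_def)

lemma top_pos_None [simp]: "top_pos (\<lambda>_. None) = 0"
  by (simp add: top_pos_def)

lemma sound_cong:
  assumes "sound R s" "cur_log r = cur_log s" "phase r = phase s" "prep_log r = prep_log s"
    "commit_log r = commit_log s" "last_delivered r = last_delivered s"
    "timer_delivery r = timer_delivery s" "status r = status s"
    "timer_recovery r = timer_recovery s"
  shows "sound R r"
  using assms unfolding sound_def has_delivered_def by simp

text \<open>Covers both sources of a committed value: a DECISION keeps the phases, a quorum of
  COMMIT votes moves one from \<open>Prepared\<close> to \<open>Committed\<close>. The latter may
  overwrite a value learnt from a DECISION; since \<open>R\<close> is functional it is the same
  value, so the set of delivered values is unchanged.\<close>

lemma sound_commit:
  assumes "sound R s" and fn: "\<And>k x y. R k x \<Longrightarrow> R k y \<Longrightarrow> x = y"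
    and "R k x" and "\<And>k'. (ph k' = phase s k') \<or> (k' = k \<and> phase s k = Prepared \<and> ph k' = Committed)"
    and r: "cur_log r = cur_log s" "phase r = ph" "prep_log r = prep_log s"
    "commit_log r = (commit_log s)(k := Some x)" "last_delivered r = last_delivered s"
    "timer_delivery r = timer_delivery s" "status r = status s"
    "timer_recovery r = timer_recovery s"
  shows "sound R r"
proof -
  have ph: "ph k' = Start_Phase \<longleftrightarrow> phase s k' = Start_Phase"
    "ph k' = Prepared \<or> ph k' = Committed \<longleftrightarrow> phase s k' = Prepared \<or> phase s k' = Committed"
    "ph k' = Committed \<Longrightarrow> k' \<noteq> k \<Longrightarrow> phase s k' = Committed" for k'
    using assms(4)[of k'] by auto
  have "commit_log s k' = Some y"
    if k': "1 \<le> k'" "k' \<le> last_delivered s" "((commit_log s)(k := Some x)) k' = Some y" for k' y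
  proof (cases "k' = k")
    case True
    then have "commit_log s k \<noteq> None" "x = y" using soundD(6)[OF assms(1)] k' by auto
    then show ?thesis using soundD(5)[OF assms(1)] fn assms(3) True by (metis option.exhaust)
  next
    case False
    then show ?thesis using k' by simp
  qed
  then have "has_delivered r y \<Longrightarrow> has_delivered s y" for y
    unfolding has_delivered_def r by (meson atLeastAtMost_iff)
  note hd = this
  note sp = soundD[OF assms(1)]
  show ?thesis
    unfolding sound_def r
  proof (intro conjI)
    show "\<forall>k. ph k = Start_Phase \<longleftrightarrow> cur_log s k = None" using sp(2) ph(1) by blast
    show "\<forall>k. ph k = Prepared \<or> ph k = Committed \<longrightarrow> prep_log s k = cur_log s k"
      using sp(3) ph(2) by blast
    show "\<forall>k'. ph k' = Committed \<longrightarrow> ((commit_log s)(k := Some x)) k' \<noteq> None"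
      using sp(4) ph(3) by (metis fun_upd_apply option.discI)
    show "\<forall>k' y. ((commit_log s)(k := Some x)) k' = Some y \<longrightarrow> R k' y"
      using sp(5) assms(3) by simp
    show "\<forall>k'. 1 \<le> k' \<and> k' \<le> last_delivered s \<longrightarrow> ((commit_log s)(k := Some x)) k' \<noteq> None"
      using sp(6) by simp
    show "\<forall>x. has_delivered r x \<longrightarrow> timer_delivery s x = None" using sp(7) hd by blast
  qed (use sp(1,8,9) in blast)+
qed

text \<open>What soundness needs from the rest of the run is isolated in the assumptions: received
  proposals and decisions satisfy \<open>R\<close>, initialization concerns no view above 1, and no
  new view interrupts normal operation.\<close>

lemma sound_move:
  assumes mv: "local_move P i c s a r" and s: "sound R s"
    and fn: "\<And>k x y. R k x \<Longrightarrow> R k y \<Longrightarrow> x = y"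
    and nt: "a \<noteq> Input i Timeout"
    and pp: "\<And>src v k x. (src, Signed (leader P v) (PREPREPARE v k x)) \<in># inbox s \<Longrightarrow>
      curr_view s = v \<Longrightarrow> status s = Normal \<Longrightarrow> R k x"
    and dec: "\<And>src k x D. (src, DECISION x k D) \<in># inbox s \<Longrightarrow> valid_decision P x k D \<Longrightarrow> R k x"
    and ns: "status s = Initializing \<Longrightarrow> curr_view s \<le> 1"
    and ent: "sync_view r \<noteq> sync_view s \<Longrightarrow> status s \<noteq> Normal"
  shows "sound R r"
    and "status s = Normal \<Longrightarrow> status r = Normal"
    and "cur_log s k = Some x \<Longrightarrow> cur_log r k = Some x"
    and "has_delivered s y \<Longrightarrow> has_delivered r y"
    and "has_delivered r y \<Longrightarrow> has_delivered s y \<or> y = nop P \<or> Delivers y \<in> set (events r)"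
proof -
  have sp: "\<And>k. phase s k = Start_Phase \<Longrightarrow> cur_log s k = None"
    "\<And>k. status s \<noteq> Normal \<Longrightarrow> cur_log s k = None" 
    "\<And>k x. cur_log s k = Some x \<Longrightarrow> R k x"
    "\<And>k x. commit_log s k = Some x \<Longrightarrow> R k x"
    "\<And>k. phase s k = Prepared \<Longrightarrow> prep_log s k = cur_log s k"
    "\<And>k. 1 \<le> k \<Longrightarrow> k \<le> last_delivered s \<Longrightarrow> commit_log s k \<noteq> None"
    using soundD[OF s] by simp_all
  have "sound R r \<and> (status s = Normal \<longrightarrow> status r = Normal) \<and>
    (\<forall>k x. cur_log s k = Some x \<longrightarrow> cur_log r k = Some x) \<and>
    (\<forall>k x. commit_log s k = Some x \<longrightarrow> commit_log r k = Some x) \<and>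
    last_delivered s \<le> last_delivered r \<and>
    (\<forall>y. has_delivered r y \<longrightarrow> has_delivered s y \<or> y = nop P \<or> Delivers y \<in> set (events r))"
    using mv
  proof (cases rule: local_move_cases)
    case (wish j v)
    show ?thesis
    proof (cases "sync_view r = sync_view s")
      case True
      then have "sound R r" unfolding wish by (intro sound_cong[OF s]) (auto simp: on_wish_fields2)
      then show ?thesis using True unfolding wish has_delivered_def by (auto simp: on_wish_fields2)
    next
      case False
      \<comment> \<open>\<open>do_new_view\<close> keeps the log, so the clause about an empty log
        outside normal status survives only because the process was not in normal status
        before.\<close>
      then have n: "status s \<noteq> Normal" using ent by blast
      then have sr: "status r \<noteq> Normal" unfolding wish by (simp add: on_wish_fields2)
      then have "sound R r" using s n unfolding sound_def wish has_delivered_def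
        by (auto simp: on_wish_fields2)
      then show ?thesis using n unfolding wish has_delivered_def by auto
    qed
  next
    case (bcast j' j x)
    then show ?thesis using s unfolding sound_def has_delivered_def by auto
  next
    case (forward j' j x)
    then have "sound R r" by (intro sound_cong[OF s]) auto
    then show ?thesis using forward by (auto simp: has_delivered_def)
  next
    case (preprepare j' j v k x)
    then have "R k x" "cur_log s k = None" using pp sp(1) by auto
    then show ?thesis using preprepare s unfolding sound_def has_delivered_def by auto
  next
    case (new_state j' j v l M)
    \<comment> \<open>Replacing the log loses nothing: the old log and the one from NEW_STATE are
      both empty.\<close>
    then have l: "l = (\<lambda>_. None)" "\<And>k. cur_log s k = None" using ns sp(2) by auto
    then show ?thesis using new_state s unfolding sound_def has_delivered_def by auto
  next
    case (decision j' x k D)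
    have Rk: "R k x" using dec decision by blast
    have "sound R r"
    proof (cases "commit_log s k = None")
      case True
      show ?thesis using decision True
        by (intro sound_commit[OF s fn Rk, where ph = "phase s"]) auto
    next
      case False
      then show ?thesis using decision by (intro sound_cong[OF s]) auto
    qed
    moreover have "has_delivered r y \<Longrightarrow> has_delivered s y" for y
      using decision sp(6)[of k] unfolding has_delivered_def
      by (auto split: if_splits simp del: upt_Suc)
    ultimately show ?thesis using decision by (simp del: upt_Suc)
  next
    case (prepares Q v k h x)
    then have "cur_log s k = Some x" by simp
    then show ?thesis using prepares s unfolding sound_def has_delivered_def by auto
  next
    case (commits Q v k h x)
    then have c: "cur_log s k = Some x" using sp(5) by simp
    then have Rk: "R k x" using sp(3) by blast
    have f: "cur_log r = cur_log s" "phase r = (phase s)(k := Committed)" "prep_log r = prep_log s"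
      "commit_log r = (commit_log s)(k := Some x)" "last_delivered r = last_delivered s"
      "timer_delivery r = timer_delivery s" "status r = status s"
      "timer_recovery r = timer_recovery s"
      using commits c by (auto simp: rb_decision_def send_all_def)
    have "sound R r"
      by (rule sound_commit[OF s fn Rk _ f]) (use commits in auto)
    moreover have "commit_log s k = Some y \<Longrightarrow> y = x" for y
      using sp(4) fn Rk by blast
    moreover from this have "has_delivered r y \<Longrightarrow> has_delivered s y" for y
      using sp(6)[of k] unfolding has_delivered_def f by (force split: if_splits)
    ultimately show ?thesis using f by auto
  next
    case (new_leaders v M l)
    then have "sound R r" by (intro sound_cong[OF s]) auto
    then show ?thesis using new_leaders by (auto simp: has_delivered_def)
  next
    case (deliver x)
    have h: "has_delivered r y \<Longrightarrow> has_delivered s y \<or> y = x" for y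
      using deliver unfolding has_delivered_def by (force simp: le_Suc_eq)
    have f: "cur_log r = cur_log s" "phase r = phase s" "prep_log r = prep_log s"
      "commit_log r = commit_log s" "last_delivered r = last_delivered s + 1"
      "timer_delivery r = (timer_delivery s)(x := None)" "status r = status s"
      "timer_recovery r = None \<or> timer_recovery r = timer_recovery s"
      using deliver by auto
    have "sound R r"
      unfolding sound_def f(1-7)
    proof (intro conjI soundD(1-5,8)[OF s])
      show "\<forall>y. has_delivered r y \<longrightarrow> ((timer_delivery s)(x := None)) y = None"
        using h soundD(7)[OF s] by auto
      show "\<forall>k. 1 \<le> k \<and> k \<le> last_delivered s + 1 \<longrightarrow> commit_log s k \<noteq> None"
        using sp(6) deliver(2) by (auto simp: le_Suc_eq)
      show "status s = Normal \<longrightarrow> timer_recovery r = None"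
        using f(8) soundD(9)[OF s] by auto
    qed
    moreover have "x \<noteq> nop P \<longrightarrow> Delivers x \<in> set (events r)" using deliver by simp
    ultimately show ?thesis using h f(1,4,5,7) by (metis le_add1)
  next
    case start
    then have "sound R r" by (intro sound_cong[OF s]) (auto simp: move_simps)
    then show ?thesis using start by (auto simp: has_delivered_def move_simps)
  next
    case (broadcast x)
    then have "sound R r" by (intro sound_cong[OF s]) auto
    then show ?thesis using broadcast by (auto simp: has_delivered_def)
  next
    case timeout
    then show ?thesis using nt by simp
  next
    case tick
    then have "sound R r" by (intro sound_cong[OF s]) (auto simp: move_simps)
    then show ?thesis using tick by (auto simp: has_delivered_def move_simps)
  next
    case (rebroadcast x)
    then have "sound R r" by (intro sound_cong[OF s]) auto
    then show ?thesis using rebroadcast by (auto simp: has_delivered_def)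
  next
    case (redecide x k D)
    then have "sound R r" by (intro sound_cong[OF s]) auto
    then show ?thesis using redecide by (auto simp: has_delivered_def)
  qed
  then show "sound R r" "status s = Normal \<Longrightarrow> status r = Normal"
    "cur_log s k = Some x \<Longrightarrow> cur_log r k = Some x"
    "has_delivered s y \<Longrightarrow> has_delivered r y"
    "has_delivered r y \<Longrightarrow> has_delivered s y \<or> y = nop P \<or> Delivers y \<in> set (events r)"
    by (simp, simp, simp, unfold has_delivered_def, fastforce, blast)
qed

section \<open>The global invariant: authentic messages and the log of the leader\<close>

context pbft_run
begin

abbreviation "L \<equiv> leader P 1"

lemma quorum_correct: 
  assumes "quorum P Q"
  obtains j where "j \<in> Q" "j \<in> C"
proof -
  have "Q = {j \<in> procs P. j \<in> Q}" using assms by (auto simp: quorum_def)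
  then have "max_faulty P + 1 \<le> card {j \<in> procs P. j \<in> Q}" using assms by (simp add: quorum_def)
  then show thesis using that by (rule correct_supporter)
qed

text \<open>Signatures of correct processes are never erased from \<open>signed_by\<close>, so for a
  correct leader it doubles as the history of proposals.\<close>

abbreviation proposed :: "nat \<Rightarrow> pos \<Rightarrow> 'x \<Rightarrow> bool" where
  "proposed m k x \<equiv> (L, PREPREPARE 1 k x) \<in> signed_by (conf E m)"

text \<open>The guard of \<open>Inject\<close>, imposed as an invariant on every message, including
  those that correct processes relay.\<close>

definition unforged :: "nat \<Rightarrow> ('x, 'h) msg \<Rightarrow> bool" where
  "unforged m c \<longleftrightarrow> (\<forall>(j, b) \<in> signed_parts c. j \<in> C \<longrightarrow> (j, b) \<in> signed_by (conf E m))"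

text \<open>Certificates of decisions outlive their packets as keys of \<open>redecide_time\<close>,
  from which they are sent again; hence the last clause.\<close>

definition authentic :: "nat \<Rightarrow> bool" where
  "authentic m \<longleftrightarrow>
     (\<forall>q \<in># net (conf E m). unforged m (payload q)) \<and>
     (\<forall>i \<in> C. (\<forall>y \<in># inbox (st m i). unforged m (snd y)) \<and>
        (\<forall>x k D. redecide_time (st m i) (x, k, D) \<noteq> None \<longrightarrow> unforged m (DECISION x k D)))"

text \<open>What may be inferred from a signature of a correct process while nobody has timed out.
  NEW_LEADER messages do not exist, since view 1 does without them; NEW_STATE dates the entry of its
  sender; a COMMIT vote vouches for a proposal with its hash.\<close>

fun reveals :: "nat \<Rightarrow> proc \<Rightarrow> ('x, 'h) content \<Rightarrow> bool" where
  "reveals m i (NEW_LEADER b) \<longleftrightarrow> False"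
| "reveals m i (NEW_STATE v l M) \<longleftrightarrow> v = 1 \<and> l = (\<lambda>_. None) \<and> M = {} \<and> curr_view (st m i) = 1"
| "reveals m i (PREPREPARE v k x) \<longleftrightarrow> i = L \<and> v = 1"
| "reveals m i (COMMIT (Vote v k h)) \<longleftrightarrow> (\<exists>x. proposed m k x \<and> h = hash P x)"
| "reveals m i _ \<longleftrightarrow> True"

text \<open>Between sending a proposal and handling its own copy of it, the leader has a proposal that
  is not yet in its log. The urgency of self-addressed messages makes handling it its next move.\<close>

definition settled :: "nat \<Rightarrow> bool" where
  "settled m \<longleftrightarrow>
     (\<forall>k x. proposed m k x \<longleftrightarrow> cur_log (st m L) k = Some x) \<and>
     (\<forall>k. cur_log (st m L) k \<noteq> None \<longleftrightarrow> 1 \<le> k \<and> k < next_pos (st m L)) \<and>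
     inj_on (cur_log (st m L)) (dom (cur_log (st m L))) \<and> 1 \<le> next_pos (st m L)"

text \<open>The exact \<open>outbox\<close> is part of the definition because \<open>urgent\<close>
  consults it: as it holds only copies of the proposal, nothing else can take precedence.\<close>

definition pending :: "nat \<Rightarrow> pos \<Rightarrow> 'x \<Rightarrow> bool" where
  "pending m p y \<longleftrightarrow>
     (\<forall>k x. proposed m k x \<longleftrightarrow> cur_log (st m L) k = Some x \<or> k = p \<and> x = y) \<and>
     (\<forall>k. cur_log (st m L) k \<noteq> None \<longleftrightarrow> 1 \<le> k \<and> k < p) \<and>
     inj_on (cur_log (st m L)) (dom (cur_log (st m L))) \<and>
     next_pos (st m L) = p + 1 \<and> 1 \<le> p \<and> status (st m L) = Normal \<and> valid P y \<and>
     (\<forall>k. cur_log (st m L) k \<noteq> Some y) \<and>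
     outbox (st m L) = map (\<lambda>j. (j, Signed L (PREPREPARE 1 p y))) [1..<num_procs P + 1] \<and>
     (L, Signed L (PREPREPARE 1 p y)) \<in># inbox (st m L)"

text \<open>The initial value of \<open>next_pos\<close> is open, so \<open>settled\<close> cannot
  be claimed before the leader enters view 1 and sets it to 1.\<close>

definition leading :: "nat \<Rightarrow> bool" where
  "leading m \<longleftrightarrow> curr_view (st m L) = 0 \<and> (\<forall>k x. \<not> proposed m k x) \<or> settled m \<or>
     (\<exists>p y. pending m p y)"

definition agreeing :: "nat \<Rightarrow> bool" where
  "agreeing m \<longleftrightarrow> authentic m \<and> (\<forall>i \<in> C. \<forall>c. (i, c) \<in> signed_by (conf E m) \<longrightarrow> reveals m i c) \<and>
     (\<forall>i \<in> C. sound (proposed m) (st m i)) \<and> leading m"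

text \<open>Once the outstanding proposal is added, the log of a pending leader has the properties
  that \<open>settled\<close> demands of a log.\<close>

lemma pending_log:
  fixes p :: pos and y :: 'x
  assumes "pending m p y"
  defines "l \<equiv> (cur_log (st m L))(p := Some y)"
  shows "proposed m k x \<longleftrightarrow> l k = Some x"
    and "l k \<noteq> None \<longleftrightarrow> 1 \<le> k \<and> k < p + 1"
    and "inj_on l (dom l)"
proof -
  let ?l = "cur_log (st m L)"
  have l: "\<And>k. ?l k \<noteq> None \<longleftrightarrow> 1 \<le> k \<and> k < p" "1 \<le> p" "inj_on ?l (dom ?l)"
    "\<And>k. ?l k \<noteq> Some y" "\<And>k x. proposed m k x \<longleftrightarrow> ?l k = Some x \<or> k = p \<and> x = y"
    using assms(1) unfolding pending_def by blast+
  have lp: "?l p = None" using l(1)[of p] by auto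
  show "proposed m k x \<longleftrightarrow> l k = Some x"
    unfolding l_def using l(5)[of k x] lp by auto
  show "l k \<noteq> None \<longleftrightarrow> 1 \<le> k \<and> k < p + 1"
    unfolding l_def using l(1)[of k] l(2) by auto
  show "inj_on l (dom l)"
    unfolding l_def
  proof (rule inj_onI)
    fix a b
    assume "a \<in> dom (?l(p := Some y))" "b \<in> dom (?l(p := Some y))"
      "(?l(p := Some y)) a = (?l(p := Some y)) b"
    then show "a = b"
      using l(4)[of a] l(4)[of b] inj_onD[OF l(3), of a b] by (auto split: if_splits)
  qed
qed

lemma leading_log:
  assumes "leading m"
  obtains l N where "\<And>k x. proposed m k x \<longleftrightarrow> l k = Some x"
    "\<And>k. l k \<noteq> None \<longleftrightarrow> 1 \<le> k \<and> k < N" "inj_on l (dom l)"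
  using assms unfolding leading_def
proof (elim disjE exE)
  assume "curr_view (st m L) = 0 \<and> (\<forall>k x. \<not> proposed m k x)"
  then show thesis using that[of "\<lambda>_. None" 0] by simp
next
  assume "settled m"
  then show thesis using that[of "cur_log (st m L)" "next_pos (st m L)"]
    unfolding settled_def by blast
next
  fix p y assume "pending m p y"
  then show thesis
    using that[of "(cur_log (st m L))(p := Some y)" "p + 1"] pending_log[of m p y] by blast
qed

text \<open>The proposals form the graph of an injective log on an initial segment of positions.
  Absence of gaps is what will let delivery in order reach a given position.\<close>

lemma proposed_facts:
  assumes "leading m" "proposed m k x"
  shows "proposed m k y \<Longrightarrow> x = y"
    and "proposed m k' x \<Longrightarrow> k = k'"
    and "1 \<le> k' \<Longrightarrow> k' \<le> k \<Longrightarrow> \<exists>y. proposed m k' y"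
    and "1 \<le> k"
proof -
  obtain l N where l: "\<And>k x. proposed m k x \<longleftrightarrow> l k = Some x"
    "\<And>k. l k \<noteq> None \<longleftrightarrow> 1 \<le> k \<and> k < N" "inj_on l (dom l)"
    using leading_log[OF assms(1)] by blast
  have k: "l k = Some x" using l(1) assms(2) by blast
  show "proposed m k y \<Longrightarrow> x = y" using k l(1)[of k y] by simp
  show "proposed m k' x \<Longrightarrow> k = k'"
    using k l(1)[of k' x] l(3) unfolding inj_on_def by (metis domI)
  show "1 \<le> k" using k l(2)[of k] by simp
  show "\<exists>y. proposed m k' y" if "1 \<le> k'" "k' \<le> k"
  proof -
    have "l k' \<noteq> None" using that k l(2)[of k] l(2)[of k'] by simp
    then show ?thesis using l(1) by blast
  qed
qed

end

lemma set_to_all: "set (map (\<lambda>j. (j, c)) [1..<num_procs P + 1]) = (\<lambda>j. (j, c)) ` procs P"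
  by (simp only: set_map set_upt set_upt_procs)

context pbft_run
begin

section \<open>Preservation of the global invariant\<close>

context
  assumes LC: "L \<in> C"
begin

lemma unforged_mono: "unforged m c \<Longrightarrow> m \<le> m' \<Longrightarrow> unforged m' c"
  using signed_by_mono[of m m'] by (fastforce simp: unforged_def)

lemma inbox_unforged: "agreeing m \<Longrightarrow> i \<in> C \<Longrightarrow> (j', c) \<in># inbox (st m i) \<Longrightarrow> unforged m c"
  by (fastforce simp: agreeing_def authentic_def)

lemma received_signed:
  assumes "agreeing m" "i \<in> C" "received (st m i) j c" "j \<in> C"
  shows "(j, c) \<in> signed_by (conf E m)"
  using assms inbox_unforged[OF assms(1,2), of _ "Signed j c"]
  by (auto simp: received_def unforged_def)

lemma signed_reveals: "agreeing m \<Longrightarrow> i \<in> C \<Longrightarrow> (i, c) \<in> signed_by (conf E m) \<Longrightarrow> reveals m i c"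
  by (simp add: agreeing_def)

text \<open>A quorum of reports would include one signed by a correct process, and
  \<open>reveals\<close> excludes such signatures.\<close>

lemma no_new_leaders:
  assumes "agreeing m" "i \<in> C" "valid_reports P v M"
    and "\<forall>(j, b) \<in> M. received (st m i) j (NEW_LEADER b)"
  shows False
proof -
  have "quorum P (fst ` M)" using assms(3) by (simp add: valid_reports_def)
  then obtain j where j: "j \<in> fst ` M" "j \<in> C" by (rule quorum_correct)
  then obtain b where "(j, b) \<in> M" by auto
  then have "(j, NEW_LEADER b) \<in> signed_by (conf E m)"
    using received_signed[OF assms(1,2)] assms(4) j(2) by blast
  then show False using signed_reveals[OF assms(1) j(2)] by fastforce
qed

text \<open>A single correct voter in the certificate suffices: it vouches for a proposal with this
  hash, and the hash is injective.\<close>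

lemma decision_proposed:
  assumes "agreeing m" "i \<in> C" "(j', DECISION x k D) \<in># inbox (st m i)"
    "valid_decision P x k D"
  shows "proposed m k x"
proof -
  obtain v Q where Q: "quorum P Q" "D = votes Q v k (hash P x)"
    using assms(4) by (auto simp: valid_decision_def quorum_votes_def)
  obtain j where j: "j \<in> Q" "j \<in> C" using Q(1) by (rule quorum_correct)
  have "(j, COMMIT (Vote v k (hash P x))) \<in> signed_by (conf E m)"
    using inbox_unforged[OF assms(1-3)] j Q(2) by (auto simp: unforged_def votes_def)
  then obtain y where "proposed m k y" "hash P x = hash P y"
    using signed_reveals[OF assms(1) j(2)] by fastforce
  then show ?thesis using params by (auto simp: protocol_params_def inj_def)
qed

lemma normal_view_1:
  assumes "no_timeout m" "i \<in> C" "status (st m i) = Normal"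
  shows "curr_view (st m i) = 1"
  using early_curr_view(2)[OF assms(1,2)] view_zero_idle(3)[OF assms(2), of m] assms(3)
  by linarith

lemma preprepare_proposed:
  assumes "no_timeout m" "agreeing m" "i \<in> C"
    and "(j', Signed (leader P v) (PREPREPARE v k x)) \<in># inbox (st m i)"
    and "curr_view (st m i) = v" "status (st m i) = Normal"
  shows "proposed m k x"
proof -
  have "v = 1" using normal_view_1[OF assms(1,3,6)] assms(5) by simp
  then show ?thesis using inbox_unforged[OF assms(2-4)] LC by (simp add: unforged_def)
qed

lemma agreeing_sound: "agreeing m \<Longrightarrow> i \<in> C \<Longrightarrow> sound (proposed m) (st m i)"
  by (simp add: agreeing_def)

context
  fixes m i r
  assumes nt: "no_timeout (Suc m)" and ag: "agreeing m" and iC: "i \<in> C" and mv: "move m i r"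
begin

lemma ntm: "no_timeout m"
  using no_timeout_le[OF nt] by simp

lemma views_at_move:
  "curr_view (st m i) = sync_view (st m i)" "curr_view (st m i) \<le> 1"
  "curr_view r = sync_view r" "curr_view r \<le> 1"
  using early_curr_view[OF ntm iC] early_curr_view[OF nt iC] move_now(2)[OF iC mv] by auto

lemma outbox_reveals:
  assumes "(t, Signed j c) \<in> set (outbox r)"
  shows "j = i \<and> reveals (Suc m) i c"
proof -
  let ?s = "st m i"
  have n1: "status ?s = Normal \<Longrightarrow> curr_view ?s = 1" using normal_view_1[OF ntm iC] .
  have cv: "curr_view (st (Suc m) i) = curr_view r" using move_now(2)[OF iC mv] by simp
  have pm: "proposed m k x \<Longrightarrow> proposed (Suc m) k x" for k x
    using signed_by_mono[of m "Suc m"] by auto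
  note sd = soundD[OF agreeing_sound[OF ag iC]]
  show ?thesis
    using mv
  proof (cases rule: local_move_cases)
    case (wish j' v)
    \<comment> \<open>Entering a view above 1 would send a NEW_LEADER message; entering view 1 sends
      at most the empty NEW_STATE.\<close>
    have "sync_view r \<le> 1" using views_at_move by simp
    then show ?thesis using assms wish(3) cv
      by (auto simp: on_wish_fields2 simp del: upt_Suc split: if_splits)
  next
    case (bcast j' j'' x) then show ?thesis using assms by auto
  next
    case (forward j' j'' x) then show ?thesis using assms n1 by auto
  next
    case (preprepare j' j'' v k x) then show ?thesis using assms by auto
  next
    case (new_state j' j'' v l M)
    then have "v = 1" using views_at_move by simp
    then show ?thesis using assms new_state by auto
  next
    case (decision j' x k D) then show ?thesis using assms by (auto split: if_splits)
  next
    case (prepares Q v k h x)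
    then have "proposed (Suc m) k x" using sd(1) pm by blast
    then show ?thesis using assms prepares by auto
  next
    case (commits Q v k h x)
    then show ?thesis using assms
      by (auto simp: rb_decision_def send_all_def simp del: upt_Suc split: if_splits)
  next
    case (new_leaders v M l) then show ?thesis using no_new_leaders[OF ag iC] by blast
  next
    case (deliver x) then show ?thesis using assms by auto
  next
    case start then show ?thesis using assms by (auto simp: move_simps split: if_splits)
  next
    case (broadcast x) then show ?thesis using assms by auto
  next
    case (timeout d) then show ?thesis using no_timeout_act[OF nt _ iC] by simp
  next
    case tick then show ?thesis using assms by (auto simp: move_simps split: if_splits)
  next
    case (rebroadcast x) then show ?thesis using assms by auto
  next
    case (redecide x k D) then show ?thesis using assms by auto
  qed
qed

lemma commits_unforged:
  assumes "\<forall>j \<in> Q. received (st m i) j (COMMIT (Vote v k h))"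
  shows "unforged m (DECISION x k (votes Q v k h))"
  using assms received_signed[OF ag iC] by (auto simp: unforged_def votes_def)

lemma redecide_after_move:
  assumes "redecide_time r (x, k, D) \<noteq> None"
  shows "unforged m (DECISION x k D)"
proof -
  have o: "redecide_time (st m i) (x, k, D) \<noteq> None \<Longrightarrow> unforged m (DECISION x k D)"
    using ag iC by (auto simp: agreeing_def authentic_def)
  show ?thesis
    using mv
  proof (cases rule: local_move_cases)
    case (decision j' x' k' D')
    then show ?thesis using assms o inbox_unforged[OF ag iC decision(2)] by (auto split: if_splits)
  next
    case (commits Q v k' h x')
    then show ?thesis using assms o commits_unforged[OF commits(3)]
      by (auto simp: rb_decision_def send_all_def split: if_splits)
  qed (use assms o in \<open>auto simp: move_simps simp del: upt_Suc split: if_splits\<close>)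
qed

lemma outbox_unforged:
  assumes "(t, c) \<in> set (outbox r)"
  shows "unforged (Suc m) c"
proof (cases c)
  case (Signed j b)
  have b: "j = i" "reveals (Suc m) i b" using outbox_reveals assms Signed by auto
  have "(i, b) \<in> signed_by (conf E (Suc m))"
    using move_now(4)[OF iC mv] assms Signed b(1) by auto
  \<comment> \<open>The only contents with nested signatures are NEW_LEADER, which
    \<open>reveals\<close> excludes, and NEW_STATE, whose set of reports it forces to be
    empty.\<close>
  then show ?thesis using b Signed by (cases b) (auto simp: unforged_def)
next
  case (DECISION x k D)
  have o: "redecide_time (st m i) (x, k, D) \<noteq> None \<Longrightarrow> unforged m (DECISION x k D)" for x k D
    using ag iC by (auto simp: agreeing_def authentic_def)
  have "unforged m c"
    using mv
  proof (cases rule: local_move_cases)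
    case (decision j' x' k' D')
    then show ?thesis using assms DECISION inbox_unforged[OF ag iC decision(2)]
      by (auto split: if_splits)
  next
    case (commits Q v k' h x')
    then show ?thesis using assms DECISION commits_unforged[OF commits(3)]
      by (auto simp: rb_decision_def send_all_def simp del: upt_Suc split: if_splits)
  qed (use assms o DECISION in
    \<open>auto simp: move_simps simp del: upt_Suc split: if_splits\<close>)
  then show ?thesis by (rule unforged_mono) simp
qed (simp add: unforged_def)

lemma sound_after_move:
  shows "sound (proposed m) r"
    and "status (st m i) = Normal \<Longrightarrow> status r = Normal"
    and "cur_log (st m i) k = Some x \<Longrightarrow> cur_log r k = Some x"
    and "has_delivered (st m i) y \<Longrightarrow> has_delivered r y"
    and "has_delivered r y \<Longrightarrow> has_delivered (st m i) y \<or> y = nop P \<or> Delivers y \<in> set (events r)"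
proof -
  have ld: "leading m" using ag by (simp add: agreeing_def)
  \<comment> \<open>A process in normal operation is in view 1, the highest view reachable before a
    timeout, so it cannot enter another.\<close>
  have ent: "status (st m i) \<noteq> Normal" if "sync_view r \<noteq> sync_view (st m i)"
  proof
    assume "status (st m i) = Normal"
    then have "sync_view (st m i) = 1" using normal_view_1[OF ntm iC] views_at_move by simp
    moreover have "sync_view (st m i) \<le> sync_view r"
      using sync_view_mono[OF iC, of m "Suc m"] move_now(2)[OF iC mv] by simp
    ultimately show False using views_at_move that by simp
  qed
  note * = sound_move[OF mv agreeing_sound[OF ag iC] proposed_facts(1)[OF ld]
      no_timeout_act[OF nt _ iC, of m] preprepare_proposed[OF ntm ag iC]
      decision_proposed[OF ag iC]  _ ent]
  show "sound (proposed m) r"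
    by (rule *(1)) (use views_at_move in auto)
  show "status (st m i) = Normal \<Longrightarrow> status r = Normal"
    by (rule *(2)) (use views_at_move in auto)
  show "cur_log (st m i) k = Some x \<Longrightarrow> cur_log r k = Some x"
    by (rule *(3)) (use views_at_move in auto)
  show "has_delivered (st m i) y \<Longrightarrow> has_delivered r y"
    by (rule *(4)) (use views_at_move in auto)
  show "has_delivered r y \<Longrightarrow> has_delivered (st m i) y \<or> y = nop P \<or> Delivers y \<in> set (events r)"
    by (rule *(5)) (use views_at_move in auto)
qed

end

lemma authentic_Suc:
  assumes nt: "no_timeout (Suc m)" and ag: "agreeing m"
  shows "authentic (Suc m)"
proof -
  have um: "unforged m c \<Longrightarrow> unforged (Suc m) c" for c
    by (simp add: unforged_mono[of m c "Suc m"])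
  have net: "q \<in># net (conf E m) \<Longrightarrow> unforged (Suc m) (payload q)" for q
    using ag um by (auto simp: agreeing_def authentic_def)
  have inb: "i \<in> C \<Longrightarrow> y \<in># inbox (st m i) \<Longrightarrow> unforged (Suc m) (snd y)" for i y
    using inbox_unforged[OF ag, of i "fst y" "snd y"] um by simp
  have rd: "i \<in> C \<Longrightarrow> redecide_time (st m i) (x, k, D) \<noteq> None \<Longrightarrow>
    unforged (Suc m) (DECISION x k D)" for i x k D
    using ag um by (auto simp: agreeing_def authentic_def)
  show ?thesis
  proof (cases m rule: step_cases)
    case pass
    then show ?thesis using net inb rd unfolding authentic_def by simp
  next
    case (local i r)
    note ou = outbox_unforged[OF nt ag local(1,3)]
    have "unforged (Suc m) (payload q)" if "q \<in># net (conf E (Suc m))" for q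
      using that net ou in_emit[of q m i r] unfolding local(5) by auto
    moreover have "unforged (Suc m) (snd y)" if "j \<in> C" "y \<in># inbox (st (Suc m) j)" for j y
      using that inb[OF that(1)] inb[OF local(1)] mset_subset_eqD[OF inbox_after_move(1)[OF local(3)]]
        ou[of "fst y" "snd y"] unfolding local(4)
      by (cases y; auto split: if_splits; blast)
    moreover have "unforged (Suc m) (DECISION x k D)"
      if "j \<in> C" "redecide_time (st (Suc m) j) (x, k, D) \<noteq> None" for j x k D
      using that rd[OF that(1)] um[OF redecide_after_move[OF nt ag local(1,3)]]
      unfolding local(4) by (auto split: if_splits)
    ultimately show ?thesis unfolding authentic_def by blast
  next
    case (receive q)
    have "unforged (Suc m) (snd y)" if "j \<in> C" "y \<in># inbox (st (Suc m) j)" for j y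
      using that inb[OF that(1)] net[OF receive(3)] unfolding receive(6)
      by (cases y; auto split: if_splits; blast)
    moreover have "unforged (Suc m) (DECISION x k D)"
      if "j \<in> C" "redecide_time (st (Suc m) j) (x, k, D) \<noteq> None" for j x k D
      using that rd[OF that(1)] unfolding receive(6) by (auto split: if_splits)
    moreover have "unforged (Suc m) (payload q')" if "q' \<in># net (conf E (Suc m))" for q'
      using that net unfolding receive(7) by (auto dest: in_diffD)
    ultimately show ?thesis unfolding authentic_def by blast
  next
    case (inject q)
    have "unforged (Suc m) (payload q)" using inject(6,9) by (simp add: unforged_def)
    then have "unforged (Suc m) (payload q')" if "q' \<in># net (conf E (Suc m))" for q'
      using that net unfolding inject(8) by auto
    then show ?thesis using inb rd unfolding authentic_def inject(7) by blast
  qed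
qed


lemma reveals_Suc:
  assumes nt: "no_timeout (Suc m)" and ag: "agreeing m" and "i \<in> C"
    and "(i, c) \<in> signed_by (conf E (Suc m))"
  shows "reveals (Suc m) i c"
proof (cases "(i, c) \<in> signed_by (conf E m)")
  case True
  then have "reveals m i c" using signed_reveals[OF ag assms(3)] by blast
  moreover have "signed_by (conf E m) \<subseteq> signed_by (conf E (Suc m))"
    by (rule signed_by_mono) simp
  moreover have "curr_view (st m i) = 1 \<Longrightarrow> curr_view (st (Suc m) i) = 1"
    using curr_view_mono[OF nt assms(3), of m] by simp
  ultimately show ?thesis by (cases "(m, i, c)" rule: reveals.cases) auto
next
  case False
  have "\<exists>r t. move m i r \<and> (t, Signed i c) \<in> set (outbox r)"
    using assms(4) False by (cases m rule: step_cases) auto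
  then show ?thesis using outbox_reveals[OF nt ag assms(3)] by blast
qed

lemma sound_Suc:
  assumes nt: "no_timeout (Suc m)" and ag: "agreeing m" and "i \<in> C"
  shows "sound (proposed (Suc m)) (st (Suc m) i)"
proof -
  have "sound (proposed m) (st (Suc m) i)"
    using assms(3)
  proof (cases rule: state_cases[where m = m])
    case (move r)
    then show ?thesis using sound_after_move(1)[OF assms move(1)] by simp
  qed (use agreeing_sound[OF ag assms(3)] in simp_all)
  then show ?thesis
    by (rule sound_mono) (use signed_by_mono[of m "Suc m"] in auto)
qed

lemma proposed_Suc:
  "proposed (Suc m) k x \<longleftrightarrow> proposed m k x \<or>
    (\<exists>r j. move m L r \<and> (j, Signed L (PREPREPARE 1 k x)) \<in> set (outbox r))"
proof -
  have "proposed m k x \<or>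
    (\<exists>r j. move m L r \<and> (j, Signed L (PREPREPARE 1 k x)) \<in> set (outbox r))"
    if "proposed (Suc m) k x"
    using that by (cases m rule: step_cases) auto
  moreover have "proposed (Suc m) k x" if "move m L r"
    "(j, Signed L (PREPREPARE 1 k x)) \<in> set (outbox r)" for r j
    unfolding move_now(4)[OF LC that(1)] using that(2) by blast
  moreover have "proposed m k x \<Longrightarrow> proposed (Suc m) k x"
    using signed_by_mono[of m "Suc m"] by auto
  ultimately show ?thesis by blast
qed

lemma proposed_move:
  assumes "move m L r"
  shows "proposed (Suc m) k x \<longleftrightarrow> proposed m k x \<or>
    (\<exists>j. (j, Signed L (PREPREPARE 1 k x)) \<in> set (outbox r))"
proof -
  have "move m L r' \<Longrightarrow> r' = r" for r'
    using assms by (auto elim!: local_move.cases)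
  then show ?thesis unfolding proposed_Suc using assms by blast
qed

lemma pending_ready:
  assumes "no_timeout m" "agreeing m" "pending m p y"
  shows "ready P L (st m L) (On L (Signed L (PREPREPARE 1 p y)))"
proof -
  have p: "1 \<le> p" "status (st m L) = Normal" "valid P y" "\<And>k. cur_log (st m L) k \<noteq> Some y"
    "(L, Signed L (PREPREPARE 1 p y)) \<in># inbox (st m L)" "cur_log (st m L) p = None"
    using assms(3) unfolding pending_def by (blast, blast, blast, blast, blast, force)
  have "phase (st m L) p = Start_Phase"
    using soundD(2)[OF agreeing_sound[OF assms(2) LC]] p(6) by blast
  then show ?thesis using p normal_view_1[OF assms(1) LC p(2)] by simp
qed

text \<open>The leader's copy of its proposal is ready, so \<open>urgent\<close> is nonempty and
  \<open>may_run\<close> admits only its members, of which there is just this one. Inputs are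
  blocked because the leader is not quiescent.\<close>

lemma pending_act:
  assumes "no_timeout m" "agreeing m" "pending m p y" "move m L r"
  shows "act E m = Handle L (On L (Signed L (PREPREPARE 1 p y)))"
  using assms(4)
proof cases
  case (handle H)
  let ?b = "Signed L (PREPREPARE 1 p y)"
  have o: "set (outbox (st m L)) = (\<lambda>j. (j, ?b)) ` procs P"
    using assms(3) set_to_all unfolding pending_def by metis
  have "On L ?b \<in> urgent P L (st m L)"
    using pending_ready[OF assms(1-3)] o unfolding urgent_def by auto
  then have "H \<in> urgent P L (st m L)" using handle(3) unfolding may_run_def by blast
  then have "H = On L ?b" using o unfolding urgent_def by auto
  then show ?thesis using handle by simp
next
  case (input u)
  then show ?thesis using pending_ready[OF assms(1-3)] unfolding quiescent_def by blast
qed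

lemma settled_cong:
  assumes "settled m" "cur_log (st (Suc m) L) = cur_log (st m L)"
    "next_pos (st (Suc m) L) = next_pos (st m L)"
    "\<And>k x. proposed (Suc m) k x \<longleftrightarrow> proposed m k x"
  shows "settled (Suc m)"
  using assms(1) unfolding settled_def assms(2-4) .

lemma leading_cases:
  assumes "agreeing m"
  obtains (pending) p y where "pending m p y"
    | (zero) "curr_view (st m L) = 0" "\<And>k x. \<not> proposed m k x" | (settled) "settled m"
proof -
  have "leading m" using assms by (simp add: agreeing_def)
  then show thesis unfolding leading_def using that by (elim disjE exE conjE) (blast, blast, blast)
qed

lemma leading_Suc:
  assumes nt: "no_timeout (Suc m)" and ag: "agreeing m"
  shows "leading (Suc m)"
  using LC
proof (cases rule: state_cases[where m = m])
  case idle
  have "proposed (Suc m) k x \<longleftrightarrow> proposed m k x" for k x unfolding proposed_Suc using idle by blast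
  then show ?thesis using ag unfolding agreeing_def leading_def settled_def pending_def idle by simp
next
  case (receive q)
  have pr: "proposed (Suc m) k x \<longleftrightarrow> proposed m k x" for k x
    unfolding proposed_Suc using receive by blast
  have "no_timeout m" using no_timeout_le[OF nt] by simp
  \<comment> \<open>Reception requires quiescence, whereas a pending leader still has a handler
    ready.\<close>
  then have "\<not> pending m p y" for p y
    using pending_ready[OF _ ag] receive(6) unfolding quiescent_def by blast
  from ag show ?thesis
  proof (cases rule: leading_cases)
    case (pending p y)
    then show ?thesis using \<open>\<And>p y. \<not> pending m p y\<close> by blast
  next
    case zero
    then show ?thesis unfolding leading_def pr receive(4) by simp
  next
    case settled
    then have "settled (Suc m)" by (rule settled_cong) (use pr receive(4) in simp_all)
    then show ?thesis by (simp add: leading_def)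
  qed
next
  case (move r)
  have ntm: "no_timeout m" using no_timeout_le[OF nt] by simp
  note pr = proposed_move[OF move(1)]
  note sd = soundD[OF agreeing_sound[OF ag LC]]
  note views = views_at_move[OF nt ag LC move(1)]
  let ?s = "st m L"
  from ag show ?thesis
  proof (cases rule: leading_cases)
    case (pending p y)
    note py = this
    note a = pending_act[OF ntm ag py move(1)]
    from move(1) a have r: "cur_log r = (cur_log ?s)(p := Some y) \<and> next_pos r = next_pos ?s \<and>
      (\<forall>j k x. (j, Signed L (PREPREPARE 1 k x)) \<notin> set (outbox r))"
      by (cases rule: local_move_cases) auto
    have "next_pos ?s = p + 1" using py by (simp add: pending_def)
    then have "settled (Suc m)"
      using pending_log[OF py] r pr move(3) unfolding settled_def by simp
    then show ?thesis by (simp add: leading_def)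
  next
    case zero
    note 2 = this
    have s: "status ?s \<noteq> Normal" using view_zero_idle(3)[OF LC 2(1)] .
    then have l: "cur_log ?s = (\<lambda>_. None)" using sd(8) by auto
    \<comment> \<open>Entering view 1 sets \<open>next_pos\<close> to 1, which together with the
      empty log makes the leader settled.\<close>
    have "cur_log r = cur_log ?s \<and> (curr_view r \<noteq> 0 \<longrightarrow> next_pos r = 1) \<and>
      (\<forall>j k x. (j, Signed L (PREPREPARE 1 k x)) \<notin> set (outbox r))"
      using move(1)
    proof (cases rule: local_move_cases)
      case (wish j v)
      then show ?thesis using views 2(1)
        by (auto simp: on_wish_fields2 simp del: upt_Suc split: if_splits)
    next
      case (commits Q v k h x)
      then show ?thesis using s by simp
    qed (use s 2(1) in \<open>auto simp: move_simps simp del: upt_Suc split: if_splits\<close>)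
    then have "curr_view r = 0 \<and> (\<forall>k x. \<not> proposed (Suc m) k x) \<or> settled (Suc m)"
      unfolding settled_def pr using 2(2) l move(3) by auto
    then show ?thesis using move(3) by (auto simp: leading_def)
  next
    case settled
    note set = settled[unfolded settled_def]
    consider (propose) j' j x where "act E m = Handle L (On j' (Signed j (FORWARD x)))"
      | (other) "cur_log r = cur_log ?s"
        "next_pos r = next_pos ?s \<or> cur_log ?s = (\<lambda>_. None) \<and> next_pos r = 1"
        "\<And>j k x. (j, Signed L (PREPREPARE 1 k x)) \<notin> set (outbox r)"
    proof -
      assume p: "\<And>j' j x. act E m = Handle L (On j' (Signed j (FORWARD x))) \<Longrightarrow> thesis"
        and o: "cur_log r = cur_log ?s \<Longrightarrow>
          next_pos r = next_pos ?s \<or> cur_log ?s = (\<lambda>_. None) \<and> next_pos r = 1 \<Longrightarrow>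
          (\<And>j k x. (j, Signed L (PREPREPARE 1 k x)) \<notin> set (outbox r)) \<Longrightarrow> thesis"
      show thesis
        using move(1)
      proof (cases rule: local_move_cases)
        case (wish j v)
        show thesis
        proof (rule o)
          show "next_pos r = next_pos ?s \<or> cur_log ?s = (\<lambda>_. None) \<and> next_pos r = 1"
          proof (cases "sync_view ?s < sync_view r")
            \<comment> \<open>\<open>next_pos\<close> is reset only by an entry into view 1, that is
              from view 0, where the log is still empty.\<close>
            case True
            then have "curr_view ?s = 0" using views by simp
            then have "cur_log ?s = (\<lambda>_. None)" using view_zero_idle(3)[OF LC] sd(8) by auto
            then show ?thesis unfolding wish by (simp add: on_wish_fields2)
          next
            case False
            then show ?thesis unfolding wish by (simp add: on_wish_fields2)
          qed
        qed (auto simp: wish on_wish_fields2 simp del: upt_Suc split: if_splits)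
      next
        case (forward j' j x) then show thesis using p by blast
      next
        case (preprepare j' j v k x)
        \<comment> \<open>For a settled leader a PREPREPARE of its own can only be a repetition: the
          value is in its log already, which contradicts the guard.\<close>
        then have "proposed m k x" using preprepare_proposed[OF ntm ag LC, of j' v k x] by simp
        then show thesis using set preprepare by blast
      next
        case (new_state j' j v l M)
        then have "cur_log ?s = (\<lambda>_. None)" "l = (\<lambda>_. None)" using sd(8) views by auto
        then show thesis using o new_state by auto
      next
        case (commits Q v k h x)
        then show thesis using o
          by (auto simp: rb_decision_def send_all_def simp del: upt_Suc split: if_splits)
      next
        case (new_leaders v M l) then show thesis using no_new_leaders[OF ag LC] by blast
      next
        case timeout then show thesis using no_timeout_act[OF nt _ LC] by simp
      qed (use o in \<open>auto simp: move_simps simp del: upt_Suc split: if_splits\<close>)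
    qed
    then show ?thesis
    proof cases
      case propose
      from move(1) propose have r: "valid P x" "status ?s = Normal" "\<forall>k. cur_log ?s k \<noteq> Some x"
        "r = (clear ?s)\<lparr>inbox := inbox ?s - {#(j', Signed j (FORWARD x))#},
          next_pos := next_pos ?s + 1,
          outbox := map (\<lambda>j. (j, Signed L (PREPREPARE (curr_view ?s) (next_pos ?s) x)))
            [1..<num_procs P + 1]\<rparr>"
        by (cases rule: local_move_cases; simp)+
      have cv: "curr_view ?s = 1" using normal_view_1[OF ntm LC r(2)] .
      have pr': "proposed (Suc m) k z \<longleftrightarrow> cur_log ?s k = Some z \<or> k = next_pos ?s \<and> z = x" for k z
        unfolding pr using set r(4) cv leader_in_procs[of P 1] by (auto simp: procs_def)
      have "pending (Suc m) (next_pos ?s) x"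
        unfolding pending_def pr' move(3) using set r cv C_procs[OF LC]
        by (auto simp: procs_def simp del: upt_Suc)
      then show ?thesis by (auto simp: leading_def)
    next
      case other
      have "settled (Suc m)"
        unfolding settled_def pr using set other move(3) by auto
      then show ?thesis by (simp add: leading_def)
    qed
  qed
qed

lemma agreeing_0: "agreeing 0"
proof -
  have *: "i \<in> C \<Longrightarrow> init_pstate P (clk 0 i) (st 0 i)" "net (conf E 0) = {#}"
    "signed_by (conf E 0) = {}" for i
    using exec by (auto simp: execution_def)
  have "sound R (st 0 i)" if "i \<in> C" for i R
    using *(1)[OF that] by (simp add: sound_def init_pstate_def has_delivered_def)
  moreover have "authentic 0" using * by (simp add: authentic_def init_pstate_def)
  moreover have "leading 0" using * *(1)[OF LC] by (simp add: leading_def init_pstate_def)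
  ultimately show ?thesis using * by (simp add: agreeing_def)
qed

lemma no_timeout_agreeing: "no_timeout m \<Longrightarrow> agreeing m"
proof (induction m)
  case (Suc m)
  then have "agreeing m" using no_timeout_le[of "Suc m" m] by simp
  then show ?case
    using authentic_Suc reveals_Suc sound_Suc leading_Suc Suc.prems by (simp add: agreeing_def)
qed (rule agreeing_0)

end


lemma handle_moves:
  assumes "act E m = Handle i H" "i \<in> C"
  obtains r where "move m i r" "st (Suc m) i = r\<lparr>inbox := inbox r + own i r\<rparr>"
  using move_exists[OF assms(2,1)] move_now(2)[OF assms(2)] that by blast

text \<open>The variant of \<open>arrives\<close> for a message already received: no delay and no
  condition on the final time.\<close>

lemma inbox_until:
  assumes "j \<in> C" "(i, c) \<in># inbox (st m j) \<or> R m" "m \<le> m'"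
    and stable: "\<And>l. m \<le> l \<Longrightarrow> l < m' \<Longrightarrow> R l \<Longrightarrow> R (Suc l)"
    and handled: "\<And>l. m \<le> l \<Longrightarrow> l < m' \<Longrightarrow> act E l = Handle j (On i c) \<Longrightarrow> R (Suc l)"
  shows "(i, c) \<in># inbox (st m' j) \<or> R m'"
  using assms(3)
proof (induction m' rule: dec_induct)
  case base
  then show ?case using assms(2) by simp
next
  case (step l)
  then show ?case using stable handled inbox_step[OF assms(1), of i c l] by blast
qed

lemma view_1_gst:
  assumes "no_timeout m" "i \<in> C" "curr_view (st m i) = 1"
  shows "gst E \<le> now E m"
  using wished_gst[OF assms(1,2)] view_1_wished[OF assms(2), of m]
    early_curr_view[OF assms(1,2)] assms(3) by simp

section \<open>Persistence of local progress under a correct leader\<close>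

context
  assumes LC: "L \<in> C"
begin

lemmas agreeing_at = no_timeout_agreeing[OF LC]
lemmas sound_at = agreeing_sound[OF LC agreeing_at]

lemma leading_at: "no_timeout m \<Longrightarrow> leading m"
  using agreeing_at by (simp add: agreeing_def)

lemma normal_at: "no_timeout m \<Longrightarrow> i \<in> C \<Longrightarrow> status (st m i) = Normal \<Longrightarrow> curr_view (st m i) = 1"
  by (rule normal_view_1[OF LC])

lemma state_Suc:
  assumes nt: "no_timeout (Suc m)" and "i \<in> C"
  shows "status (st m i) = Normal \<Longrightarrow> status (st (Suc m) i) = Normal"
    and "cur_log (st m i) k = Some x \<Longrightarrow> cur_log (st (Suc m) i) k = Some x"
    and "has_delivered (st m i) y \<Longrightarrow> has_delivered (st (Suc m) i) y"
    and "has_delivered (st (Suc m) i) y \<Longrightarrow>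
      has_delivered (st m i) y \<or> y = nop P \<or> occurs E m i (Delivers y)"
proof -
  have ag: "agreeing m" using agreeing_at no_timeout_le[OF nt] by simp
  have *: "(status (st m i) = Normal \<longrightarrow> status (st (Suc m) i) = Normal) \<and>
    (cur_log (st m i) k = Some x \<longrightarrow> cur_log (st (Suc m) i) k = Some x) \<and>
    (has_delivered (st m i) y \<longrightarrow> has_delivered (st (Suc m) i) y) \<and>
    (has_delivered (st (Suc m) i) y \<longrightarrow>
      has_delivered (st m i) y \<or> y = nop P \<or> occurs E m i (Delivers y))"
    using assms(2)
  proof (cases rule: state_cases[where m = m])
    case (move r)
    have hd: "has_delivered (st (Suc m) i) y = has_delivered r y"
      unfolding move(3) by (simp add: has_delivered_def)
    note sm = sound_after_move[OF LC nt ag assms(2) move(1)]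
    have "occurs E m i (Delivers y)" if "Delivers y \<in> set (events r)"
      using occurs_iff[OF assms(2)] move(1) that by blast
    then show ?thesis
      unfolding hd using sm(2,4) sm(3)[of k x] sm(5)[of y] move(3) by auto
  qed (auto simp: has_delivered_def)
  then show "status (st m i) = Normal \<Longrightarrow> status (st (Suc m) i) = Normal"
    "cur_log (st m i) k = Some x \<Longrightarrow> cur_log (st (Suc m) i) k = Some x"
    "has_delivered (st m i) y \<Longrightarrow> has_delivered (st (Suc m) i) y"
    "has_delivered (st (Suc m) i) y \<Longrightarrow>
      has_delivered (st m i) y \<or> y = nop P \<or> occurs E m i (Delivers y)" by auto
qed

lemma state_mono:
  assumes nt: "no_timeout m'" and "i \<in> C" "m \<le> m'"
  shows "status (st m i) = Normal \<Longrightarrow> status (st m' i) = Normal"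
    and "cur_log (st m i) k = Some x \<Longrightarrow> cur_log (st m' i) k = Some x"
    and "has_delivered (st m i) y \<Longrightarrow> has_delivered (st m' i) y"
proof -
  have *: "(status (st m i) = Normal \<longrightarrow> status (st m' i) = Normal) \<and>
    (cur_log (st m i) k = Some x \<longrightarrow> cur_log (st m' i) k = Some x) \<and>
    (has_delivered (st m i) y \<longrightarrow> has_delivered (st m' i) y)"
    using assms(3,1)
  proof (induction m' rule: dec_induct)
    case (step l)
    then show ?case
      using state_Suc(1-3)[OF step.prems assms(2)] no_timeout_le[OF step.prems, of l] by auto
  qed simp
  then show "status (st m i) = Normal \<Longrightarrow> status (st m' i) = Normal"
    "cur_log (st m i) k = Some x \<Longrightarrow> cur_log (st m' i) k = Some x"
    "has_delivered (st m i) y \<Longrightarrow> has_delivered (st m' i) y" by auto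
qed

lemma delivered_before:
  "no_timeout m \<Longrightarrow> i \<in> C \<Longrightarrow> has_delivered (st m i) y \<Longrightarrow> y \<noteq> nop P \<Longrightarrow>
    \<exists>l<m. occurs E l i (Delivers y)"
proof (induction m)
  case 0
  then show ?case using exec by (auto simp: execution_def init_pstate_def has_delivered_def)
next
  case (Suc m)
  then show ?case using state_Suc(4)[OF Suc.prems(1,2,3)] no_timeout_le[OF Suc.prems(1), of m]
    by (metis Suc.IH le_SucI lessI less_SucI order_refl)
qed

lemma proposed_mono: "proposed m k x \<Longrightarrow> m \<le> m' \<Longrightarrow> proposed m' k x"
  using signed_by_mono by blast

lemma proposal_sent:
  assumes "no_timeout (Suc m)" "move m L r" "(t, Signed L (PREPREPARE v k x)) \<in> set (outbox r)"
  shows "j \<in> procs P \<Longrightarrow> (j, Signed L (PREPREPARE v k x)) \<in> set (outbox r)"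
    and "status (st m L) = Normal" and "valid P x"
proof -
  have "(\<forall>j \<in> procs P. (j, Signed L (PREPREPARE v k x)) \<in> set (outbox r)) \<and>
    status (st m L) = Normal \<and> valid P x"
    using assms(2)
  proof (cases rule: local_move_cases)
    case (forward j' j y)
    then show ?thesis using assms(3) by (auto simp: procs_def simp del: upt_Suc)
  next
    case (wish j v)
    then show ?thesis using assms(3)
      by (auto simp: on_wish_fields2 simp del: upt_Suc split: if_splits)
  next
    case (commits Q v k h x)
    then show ?thesis using assms(3)
      by (auto simp: rb_decision_def send_all_def simp del: upt_Suc split: if_splits)
  next
    case (new_state j' j v l M)
    then show ?thesis using assms(3) by auto
  qed (use assms(3) in \<open>auto simp: move_simps simp del: upt_Suc split: if_splits\<close>)
  then show "j \<in> procs P \<Longrightarrow> (j, Signed L (PREPREPARE v k x)) \<in> set (outbox r)"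
    "status (st m L) = Normal" "valid P x" by auto
qed

lemma proposed_valid: "no_timeout m \<Longrightarrow> proposed m k x \<Longrightarrow> valid P x"
proof (induction m)
  case 0
  then show ?case using exec by (simp add: execution_def)
next
  case (Suc m)
  then show ?case using proposal_sent(3)[OF Suc.prems(1)] no_timeout_le[OF Suc.prems(1), of m]
    proposed_Suc[OF LC, of k x m] by auto
qed

subsection \<open>Messages in transit in view 1\<close>

text \<open>The leader sends NEW_STATE on entering, after GST. A copy leaves the inbox of
  \<open>j\<close> only by being accepted, because a message whose guard fails is kept.\<close>

lemma new_state_sent:
  assumes "no_timeout m" "curr_view (st m L) = 1" "j \<in> C"
  shows "timely m L j (Signed L (NEW_STATE 1 (\<lambda>_. None) {})) \<or> status (st m j) = Normal"
  using assms(1,2)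
proof (induction m)
  case 0
  then show ?case using exec LC by (auto simp: execution_def init_pstate_def)
next
  case (Suc m)
  have ntm: "no_timeout m" using no_timeout_le[OF Suc.prems(1)] by simp
  show ?case
  proof (cases "curr_view (st m L) = 1")
    case True
    then consider "status (st m j) = Normal"
      | "timely m L j (Signed L (NEW_STATE 1 (\<lambda>_. None) {}))" using Suc ntm by blast
    then show ?thesis
    proof cases
      case 1
      then show ?thesis using state_Suc(1)[OF Suc.prems(1) assms(3)] by blast
    next
      case 2
      have "status (st (Suc m) j) = Normal"
        if a: "act E m = Handle j (On L (Signed L (NEW_STATE 1 (\<lambda>_. None) {})))"
      proof -
        obtain r where r: "move m j r" "st (Suc m) j = r\<lparr>inbox := inbox r + own j r\<rparr>"
          using handle_moves[OF a assms(3)] by blast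
        have "status r = Normal" using r(1) a by (cases rule: local_move_cases) auto
        then show ?thesis using r(2) by simp
      qed
      then show ?thesis using timely_step[OF assms(3) 2] by blast
    qed
  next
    case False
    then have z: "curr_view (st m L) = 0" using early_curr_view(2)[OF ntm LC] by simp
    from LC obtain r where r: "move m L r" "curr_view r = 1" "now E (Suc m) = now E m"
      using Suc.prems(2) z by (cases rule: state_cases[where m = m]) auto
    from r(1) have "(j, Signed L (NEW_STATE 1 (\<lambda>_. None) {})) \<in> set (outbox r)"
    proof (cases rule: local_move_cases)
      case (wish j' v)
      then show ?thesis using r(2) z C_procs[OF assms(3)]
        by (auto simp: on_wish_fields2 procs_def simp del: upt_Suc split: if_splits)
    next
      case (commits Q v k h x)
      then show ?thesis using r(2) z by (simp add: rb_decision_def send_all_def split: if_splits)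
    next
      case (forward j' j'' x)
      have "curr_view r = curr_view (st m L)" unfolding forward(7) by simp
      then show ?thesis using r(2) z by simp
    next
      case (new_leaders v M l)
      have "curr_view r = curr_view (st m L)" unfolding new_leaders(8) by simp
      then show ?thesis using r(2) z by simp
    qed (use r(2) z in \<open>auto simp: move_simps simp del: upt_Suc split: if_splits\<close>)
    moreover have "gst E \<le> now E m" using view_1_gst[OF Suc.prems(1) LC Suc.prems(2)] r(3) by simp
    ultimately show ?thesis using timely_new[OF LC r(1)] by blast
  qed
qed

text \<open>NEW_STATE may arrive before \<open>j\<close> enters view 1 and then waits; hence the
  separate assumption that \<open>j\<close> is in view 1 at the end.\<close>

lemma normal_arrives:
  assumes "curr_view (st m L) = 1" "now E m + d \<le> T" "at_end T m'" "no_timeout m'"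
    and "j \<in> C" "curr_view (st m' j) = 1"
  shows "status (st m' j) = Normal"
proof -
  let ?c = "Signed L (NEW_STATE 1 (\<lambda>_. None) {})"
  have mm': "m \<le> m'" using at_end_after[OF assms(3), of m] assms(2) d_pos by simp
  have "timely m L j ?c \<or> status (st m j) = Normal"
    using new_state_sent[OF no_timeout_le[OF assms(4) mm'] assms(1,5)] .
  then have "(L, ?c) \<in># inbox (st m' j) \<or> status (st m' j) = Normal"
  proof (rule arrives[OF LC assms(5) _ assms(2,3)])
    fix l assume l: "l < m'"
    then have nt: "no_timeout (Suc l)" using no_timeout_le[OF assms(4)] by simp
    show "status (st (Suc l) j) = Normal" if "status (st l j) = Normal"
      using state_Suc(1)[OF nt assms(5) that] .
    assume a: "act E l = Handle j (On L ?c)"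
    obtain r where r: "move l j r" "st (Suc l) j = r\<lparr>inbox := inbox r + own j r\<rparr>"
      using handle_moves[OF a assms(5)] by blast
    have "status r = Normal" using r(1) a by (cases rule: local_move_cases) auto
    then show "status (st (Suc l) j) = Normal" using r(2) by simp
  qed
  moreover have "status (st m' j) \<noteq> Advanced"
    using no_timeout_early[OF assms(4)] assms(5,6) by (auto simp: early_def)
  moreover have "status (st m' j) = Initializing \<Longrightarrow> (L, ?c) \<notin># inbox (st m' j)"
    using quiescentD[OF assms(3,5), of "On L ?c"] assms(6) by auto
  ultimately show ?thesis by (cases "status (st m' j)") auto
qed

text \<open>A process becomes normal only through a NEW_STATE signed by the leader, and that
  signature reveals that the leader is in view 1. This dates the entry of the leader when a delivery
  timer starts elsewhere.\<close>

lemma normal_leader: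
  "no_timeout m \<Longrightarrow> i \<in> C \<Longrightarrow> status (st m i) = Normal \<Longrightarrow> curr_view (st m L) = 1"
proof (induction m)
  case 0
  then show ?case using exec by (auto simp: execution_def init_pstate_def)
next
  case (Suc m)
  have ntm: "no_timeout m" using no_timeout_le[OF Suc.prems(1)] by simp
  have "curr_view (st m L) = 1"
  proof (cases "status (st m i) = Normal")
    case True
    then show ?thesis using Suc ntm by blast
  next
    case False
    from Suc.prems(2) obtain r where r: "move m i r" "status r = Normal"
      using Suc.prems(3) False by (cases rule: state_cases[where m = m]) auto
    have "\<exists>j' v l M. v = curr_view (st m i) \<and> v \<ge> 1 \<and>
      (j', Signed (leader P v) (NEW_STATE v l M)) \<in># inbox (st m i)"
      using r(1)
    proof (cases rule: local_move_cases)
      case (wish j v)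
      then show ?thesis using r(2) False
        by (auto simp: on_wish_fields2 split: if_splits)
    next
      case (commits Q v k h x)
      then show ?thesis using False by simp
    next
      case timeout
      then show ?thesis using no_timeout_act[OF Suc.prems(1) _ Suc.prems(2)] by simp
    qed (use r(2) False in \<open>auto simp: move_simps split: if_splits\<close>)
    then obtain j' v l M where v: "v = curr_view (st m i)" "v \<ge> 1"
      "(j', Signed (leader P v) (NEW_STATE v l M)) \<in># inbox (st m i)" by blast
    have "v = 1" using v early_curr_view(2)[OF ntm Suc.prems(2)] by simp
    then have "(L, NEW_STATE v l M) \<in> signed_by (conf E m)"
      using inbox_unforged[OF LC agreeing_at[OF ntm] Suc.prems(2) v(3)] LC
      by (auto simp: unforged_def)
    then show ?thesis using signed_reveals[OF LC agreeing_at[OF ntm] LC] by fastforce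
  qed
  then show ?case using curr_view_mono[OF Suc.prems(1) LC, of m] by simp
qed

lemma proposal_in_transit:
  assumes "no_timeout m" "proposed m k x" "j \<in> C"
  shows "timely m L j (Signed L (PREPREPARE 1 k x)) \<or> cur_log (st m j) k = Some x"
  using assms(1,2)
proof (induction m)
  case 0
  then show ?case using exec by (simp add: execution_def)
next
  case (Suc m)
  have ntm: "no_timeout m" using no_timeout_le[OF Suc.prems(1)] by simp
  show ?case
  proof (cases "proposed m k x")
    case True
    then consider "cur_log (st m j) k = Some x"
      | "timely m L j (Signed L (PREPREPARE 1 k x))" using Suc ntm by blast
    then show ?thesis
    proof cases
      case 1
      then show ?thesis using state_Suc(2)[OF Suc.prems(1) assms(3)] by blast
    next
      case 2
      have "cur_log (st (Suc m) j) k = Some x"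
        if a: "act E m = Handle j (On L (Signed L (PREPREPARE 1 k x)))"
      proof -
        obtain r where r: "move m j r" "st (Suc m) j = r\<lparr>inbox := inbox r + own j r\<rparr>"
          using handle_moves[OF a assms(3)] by blast
        have "cur_log r k = Some x" using r(1) a by (cases rule: local_move_cases) auto
        then show ?thesis using r(2) by simp
      qed
      then show ?thesis using timely_step[OF assms(3) 2] by blast
    qed
  next
    case False
    then obtain r t where r: "move m L r" "(t, Signed L (PREPREPARE 1 k x)) \<in> set (outbox r)"
      using Suc.prems(2) proposed_Suc[OF LC, of k x m] by blast
    note s = proposal_sent[OF Suc.prems(1) r]
    have "gst E \<le> now E m" using view_1_gst[OF ntm LC normal_at[OF ntm LC s(2)]] .
    then show ?thesis using timely_new[OF LC r(1) s(1)] C_procs[OF assms(3)] by blast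
  qed
qed

text \<open>\<open>msg_ready\<close> is false for votes, so no step removes them from an
  inbox.\<close>

lemma vote_stays:
  assumes "j \<in> C"
  shows "timely m i j (Signed i (PREPARE v)) \<Longrightarrow> timely (Suc m) i j (Signed i (PREPARE v))"
    and "timely m i j (Signed i (COMMIT v)) \<Longrightarrow> timely (Suc m) i j (Signed i (COMMIT v))"
proof -
  have no: "act E m \<noteq> Handle j (On i (Signed i c))" if "\<not> msg_ready P j (st m j) (Signed i c)" for c
    using step[of m] that by (auto simp: may_run_def)
  show "timely m i j (Signed i (PREPARE v)) \<Longrightarrow> timely (Suc m) i j (Signed i (PREPARE v))"
    "timely m i j (Signed i (COMMIT v)) \<Longrightarrow> timely (Suc m) i j (Signed i (COMMIT v))"
    using timely_step[OF assms(1), of m i] no[of "PREPARE v"] no[of "COMMIT v"] by auto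
qed

text \<open>In view 1 an entry gets into the log only by a PREPREPARE, since NEW_STATE brings an
  empty log, and the same step sends the vote to all.\<close>

lemma prepare_in_transit:
  assumes "no_timeout m" "i \<in> C" "cur_log (st m i) k = Some x" "j \<in> C"
  shows "timely m i j (Signed i (PREPARE (Vote 1 k (hash P x))))"
  using assms(1,3)
proof (induction m)
  case 0
  then show ?case using exec assms(2) by (auto simp: execution_def init_pstate_def)
next
  case (Suc m)
  have ntm: "no_timeout m" using no_timeout_le[OF Suc.prems(1)] by simp
  show ?case
  proof (cases "cur_log (st m i) k = Some x")
    case True
    then have "timely m i j (Signed i (PREPARE (Vote 1 k (hash P x))))" using Suc ntm by blast
    then show ?thesis using vote_stays(1)[OF assms(4)] by blast
  next
    case False
    from assms(2) obtain r where r: "move m i r" "cur_log r k = Some x"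
      using Suc.prems(2) False by (cases rule: state_cases[where m = m]) auto
    note views = early_curr_view(2)[OF ntm assms(2)]
    from r(1) have "status (st m i) = Normal \<and>
      (j, Signed i (PREPARE (Vote 1 k (hash P x)))) \<in> set (outbox r)"
    proof (cases rule: local_move_cases)
      case (preprepare j' j'' v k' x')
      then have "v = 1" using normal_at[OF ntm assms(2)] by simp
      moreover have "k' = k \<and> x' = x" using preprepare r(2) False by (auto split: if_splits)
      ultimately show ?thesis using preprepare C_procs[OF assms(4)]
        by (auto simp: procs_def simp del: upt_Suc)
    next
      case (new_state j' j v l M)
      then have "l = (\<lambda>_. None)" using views by simp
      then show ?thesis using new_state r(2) by simp
    next
      case (commits Q v k h x)
      then show ?thesis using r(2) False by (auto simp: rb_decision_def send_all_def split: if_splits)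
    next
      case (wish j v)
      then show ?thesis using r(2) False by simp
    qed (use r(2) False in \<open>auto simp: move_simps simp del: upt_Suc split: if_splits\<close>)
    then show ?thesis using timely_new[OF assms(2) r(1)]
        view_1_gst[OF ntm assms(2) normal_at[OF ntm assms(2)]] by blast
  qed
qed

lemma commit_in_transit:
  assumes "no_timeout m" "i \<in> C" "phase (st m i) k = Prepared \<or> phase (st m i) k = Committed"
    and "cur_log (st m i) k = Some x" "j \<in> C"
  shows "timely m i j (Signed i (COMMIT (Vote 1 k (hash P x))))"
  using assms(1,3,4)
proof (induction m)
  case 0
  then show ?case using exec assms(2) by (auto simp: execution_def init_pstate_def)
next
  case (Suc m)
  have ntm: "no_timeout m" using no_timeout_le[OF Suc.prems(1)] by simp
  show ?case
  proof (cases "phase (st m i) k = Prepared \<or> phase (st m i) k = Committed")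
    case True
    then have "phase (st m i) k \<noteq> Start_Phase" by auto
    then obtain y where "cur_log (st m i) k = Some y"
      using soundD(2)[OF sound_at[OF ntm assms(2)]] by blast
    moreover from this have "y = x"
      using state_Suc(2)[OF Suc.prems(1) assms(2)] Suc.prems(3) by fastforce
    ultimately have "timely m i j (Signed i (COMMIT (Vote 1 k (hash P x))))"
      using Suc.IH ntm True by blast
    then show ?thesis using vote_stays(2)[OF assms(5)] by blast
  next
    case False
    from assms(2) obtain r where r: "move m i r" "cur_log r k = Some x"
        "phase r k = Prepared \<or> phase r k = Committed"
      using Suc.prems False by (cases rule: state_cases[where m = m]) auto
    from r(1) have "status (st m i) = Normal \<and>
      (j, Signed i (COMMIT (Vote 1 k (hash P x)))) \<in> set (outbox r)"
    proof (cases rule: local_move_cases)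
      case (prepares Q v k' h x')
      then have "v = 1" using normal_at[OF ntm assms(2)] by simp
      moreover have "k' = k \<and> x' = x" using prepares r(2,3) False by (auto split: if_splits)
      ultimately show ?thesis using prepares C_procs[OF assms(5)]
        by (auto simp: procs_def simp del: upt_Suc)
    next
      case (commits Q v k' h x')
      then show ?thesis using r(3) False
        by (auto simp: rb_decision_def send_all_def split: if_splits)
    next
      case (wish j v)
      then show ?thesis using r(3) False by simp
    qed (use r(3) False in \<open>auto simp: move_simps simp del: upt_Suc split: if_splits\<close>)
    then show ?thesis using timely_new[OF assms(2) r(1)]
        view_1_gst[OF ntm assms(2) normal_at[OF ntm assms(2)]] by blast
  qed
qed

end


subsection \<open>Delivery in view 1\<close>

context
  assumes LC: "L \<in> C"
begin

lemmas sound_now = sound_at[OF LC]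
lemmas proposed_unique = proposed_facts[OF leading_at[OF LC]]

lemma proposal_logged:
  assumes "proposed m k x" "now E m + d \<le> T" "at_end T m'" "no_timeout m'"
    and "j \<in> C" "status (st m' j) = Normal"
  shows "cur_log (st m' j) k = Some x"
proof -
  let ?c = "Signed L (PREPREPARE 1 k x)"
  have mm': "m \<le> m'" using at_end_after[OF assms(3), of m] assms(2) d_pos by simp
  note nt = no_timeout_le[OF assms(4)]
  have "timely m L j ?c \<or> cur_log (st m j) k = Some x"
    using proposal_in_transit[OF LC nt[OF mm'] assms(1,5)] .
  then have "(L, ?c) \<in># inbox (st m' j) \<or> cur_log (st m' j) k = Some x"
  proof (rule arrives[OF LC assms(5) _ assms(2,3)])
    fix l assume l: "l < m'"
    show "cur_log (st (Suc l) j) k = Some x" if "cur_log (st l j) k = Some x"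
      using state_Suc(2)[OF LC nt assms(5) that, of] l by simp
    assume a: "act E l = Handle j (On L ?c)"
    obtain r where r: "move l j r" "st (Suc l) j = r\<lparr>inbox := inbox r + own j r\<rparr>"
      using handle_moves[OF a assms(5)] by blast
    have "cur_log r k = Some x" using r(1) a by (cases rule: local_move_cases) auto
    then show "cur_log (st (Suc l) j) k = Some x" using r(2) by simp
  qed
  then show ?thesis
  proof
    assume i: "(L, ?c) \<in># inbox (st m' j)"
    have pr: "proposed m' k x" using proposed_mono[OF LC assms(1) mm'] .
    note sd = soundD[OF sound_now[OF assms(4,5)]]
    have "\<not> ready P j (st m' j) (On L ?c)" using quiescentD[OF assms(3,5)] .
    moreover have "1 \<le> k" using proposed_unique(4)[OF assms(4) pr] .
    moreover have "valid P x" using proposed_valid[OF LC assms(4) pr] .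
    moreover have "curr_view (st m' j) = 1" using normal_at[OF LC assms(4-6)] .
    \<comment> \<open>An unhandled proposal can be blocked only because its position or its value is
      taken. Uniqueness of proposals in both directions shows that it was then logged from another
      copy.\<close>
    ultimately have "phase (st m' j) k \<noteq> Start_Phase \<or> (\<exists>k'. cur_log (st m' j) k' = Some x)"
      using i assms(6) by auto
    then show ?thesis
    proof
      assume "phase (st m' j) k \<noteq> Start_Phase"
      then obtain y where y: "cur_log (st m' j) k = Some y" using sd(2) by blast
      then have "proposed m' k y" using sd(1) by blast
      then show ?thesis using y proposed_unique(1)[OF assms(4) pr] by blast
    next
      assume "\<exists>k'. cur_log (st m' j) k' = Some x"
      then obtain k' where k': "cur_log (st m' j) k' = Some x" by blast
      then have "proposed m' k' x" using sd(1) by blast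
      then show ?thesis using k' proposed_unique(2)[OF assms(4) pr] by blast
    qed
  qed
qed

lemma correct_quorum:
  obtains Q where "quorum P Q" "Q \<subseteq> C"
proof -
  obtain Q where Q: "Q \<subseteq> C" "card Q = 2 * max_faulty P + 1"
    using obtain_subset_with_card_n[OF correct_majority] by blast
  then have "quorum P Q" using C_procs by (auto simp: quorum_def)
  then show thesis using that Q by blast
qed

text \<open>With the votes of a correct quorum in the inbox, phase \<open>Preprepared\<close> would
  leave \<open>On_Prepares\<close> ready, contrary to quiescence. The later phases remain possible
  because a process may run ahead.\<close>

lemma all_prepare:
  assumes log: "\<And>j. j \<in> C \<Longrightarrow> cur_log (st m j) k = Some x"
    and normal: "\<And>j. j \<in> C \<Longrightarrow> status (st m j) = Normal"
    and T: "now E m + d \<le> T" "at_end T m'" "no_timeout m'" and j: "j \<in> C"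
  shows "phase (st m' j) k = Prepared \<or> phase (st m' j) k = Committed"
proof -
  let ?v = "Vote 1 k (hash P x)"
  have mm': "m \<le> m'" using at_end_after[OF T(2), of m] T(1) d_pos by simp
  note ntm = no_timeout_le[OF T(3) mm']
  have arr: "(i, Signed i (PREPARE ?v)) \<in># inbox (st m' j)" if i: "i \<in> C" for i
  proof -
    have "timely m i j (Signed i (PREPARE ?v)) \<or> False"
      using prepare_in_transit[OF LC ntm i log[OF i] j] by simp
    then have "(i, Signed i (PREPARE ?v)) \<in># inbox (st m' j) \<or> False"
    proof (rule arrives[OF i j _ T(1,2)])
      fix l assume "act E l = Handle j (On i (Signed i (PREPARE ?v)))"
      then show False using step[of l] by (auto simp: may_run_def)
    qed simp
    then show ?thesis by simp
  qed
  obtain Q where Q: "quorum P Q" "Q \<subseteq> C" by (rule correct_quorum)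
  have s: "cur_log (st m' j) k = Some x" "status (st m' j) = Normal"
    using state_mono[OF LC T(3) j mm'] log[OF j] normal[OF j] by auto
  have "\<not> ready P j (st m' j) (On_Prepares Q 1 k (hash P x))" using quiescentD[OF T(2) j] .
  moreover have "\<forall>i \<in> Q. received (st m' j) i (PREPARE ?v)"
    using arr Q(2) unfolding received_def by blast
  ultimately have "phase (st m' j) k \<noteq> Preprepared"
    using s Q(1) normal_at[OF LC T(3) j s(2)] by auto
  moreover have "phase (st m' j) k \<noteq> Start_Phase"
    using soundD(2)[OF sound_now[OF T(3) j]] s(1) by simp
  ultimately show ?thesis by (cases "phase (st m' j) k") auto
qed

lemma all_commit:
  assumes log: "\<And>j. j \<in> C \<Longrightarrow> cur_log (st m j) k = Some x"
    and normal: "\<And>j. j \<in> C \<Longrightarrow> status (st m j) = Normal"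
    and T: "now E m + 2 * d \<le> T" "at_end T m'" "no_timeout m'" and j: "j \<in> C"
  shows "commit_log (st m' j) k \<noteq> None"
proof -
  let ?v = "Vote 1 k (hash P x)"
  obtain m1 where m1: "at_end (now E m + d) m1" "m \<le> m1"
    using at_end_exists[of m "now E m + d"] d_pos by auto
  have now1: "now E m1 + d \<le> T" using m1(1) T(1) by (simp add: at_end_def)
  have m1m': "m1 \<le> m'" using at_end_after[OF T(2), of m1] now1 d_pos by simp
  note nt1 = no_timeout_le[OF T(3) m1m']
  have log1: "cur_log (st m1 i) k = Some x" if "i \<in> C" for i
    using state_mono(2)[OF LC nt1 that m1(2)] log[OF that] by blast
  have arr: "(i, Signed i (COMMIT ?v)) \<in># inbox (st m' j)" if i: "i \<in> C" for i
  proof -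
    have "phase (st m1 i) k = Prepared \<or> phase (st m1 i) k = Committed"
      using all_prepare[OF log normal _ m1(1) nt1 i] by simp
    then have "timely m1 i j (Signed i (COMMIT ?v)) \<or> False"
      using commit_in_transit[OF LC nt1 i _ log1[OF i] j] by blast
    then have "(i, Signed i (COMMIT ?v)) \<in># inbox (st m' j) \<or> False"
    proof (rule arrives[OF i j _ now1 T(2)])
      fix l assume "act E l = Handle j (On i (Signed i (COMMIT ?v)))"
      then show False using step[of l] by (auto simp: may_run_def)
    qed simp
    then show ?thesis by simp
  qed
  obtain Q where Q: "quorum P Q" "Q \<subseteq> C" by (rule correct_quorum)
  have mm': "m \<le> m'" using m1(2) m1m' by simp
  have s: "cur_log (st m' j) k = Some x" "status (st m' j) = Normal"
    using state_mono[OF LC T(3) j mm'] log[OF j] normal[OF j] by auto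
  note sd = soundD[OF sound_now[OF T(3) j]]
  have ph: "phase (st m' j) k = Prepared \<or> phase (st m' j) k = Committed"
    using all_prepare[OF log normal _ T(2,3) j] T(1) d_pos by simp
  have "\<not> ready P j (st m' j) (On_Commits Q 1 k (hash P x))" using quiescentD[OF T(2) j] .
  moreover have "\<forall>i \<in> Q. received (st m' j) i (COMMIT ?v)"
    using arr Q(2) unfolding received_def by blast
  moreover have "prep_log (st m' j) k = Some x" using sd(3) ph s(1) by metis
  ultimately have "phase (st m' j) k \<noteq> Prepared"
    using s Q(1) normal_at[OF LC T(3) j s(2)] by auto
  then show ?thesis using ph sd(4) by blast
qed

text \<open>Delivery is in order, so every earlier position must be committed as well. These
  positions were proposed no later than \<open>k\<close>, so the bound for \<open>k\<close> serves
  them too. \<open>T2\<close> is a time at whose end everyone is normal and has logged them.\<close>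

lemma proposal_delivered:
  assumes pr: "proposed m k x" and T2: "now E m + d \<le> T2" "at_end T2 m2"
    and normal: "\<And>j. j \<in> C \<Longrightarrow> status (st m2 j) = Normal"
    and T: "T2 + 2 * d \<le> T" "at_end T m'" "no_timeout m'" and j: "j \<in> C"
  shows "has_delivered (st m' j) x"
proof -
  have now2: "now E m2 + 2 * d \<le> T" using T2(2) T(1) by (simp add: at_end_def)
  have m2m': "m2 \<le> m'" using at_end_after[OF T(2), of m2] now2 d_pos by simp
  have mm2: "m \<le> m2" using at_end_after[OF T2(2), of m] T2(1) d_pos by simp
  note nt2 = no_timeout_le[OF T(3) m2m']
  note ntm = no_timeout_le[OF nt2 mm2]
  note sd = soundD[OF sound_now[OF T(3) j]]
  have cm: "commit_log (st m' j) k' \<noteq> None" if k': "1 \<le> k'" "k' \<le> k" for k'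
  proof -
    obtain y where "proposed m k' y" using proposed_unique(3)[OF ntm pr k'] by blast
    then have "cur_log (st m2 i) k' = Some y" if "i \<in> C" for i
      using proposal_logged[OF _ T2 nt2 that normal[OF that]] by blast
    then show ?thesis using all_commit[OF _ normal now2 T(2,3) j] by blast
  qed
  have k1: "1 \<le> k" using proposed_unique(4)[OF ntm pr] .
  have "k \<le> last_delivered (st m' j)"
  proof (rule ccontr)
    assume "\<not> k \<le> last_delivered (st m' j)"
    then have "commit_log (st m' j) (last_delivered (st m' j) + 1) \<noteq> None"
      by (intro cm) simp_all
    then show False using quiescentD[OF T(2) j, of Deliver] by simp
  qed
  moreover obtain z where z: "commit_log (st m' j) k = Some z" using cm[of k] k1 by auto
  moreover have "z = x"
  proof -
    have "proposed m' k z" using z sd(5) by blast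
    moreover have "proposed m' k x" using proposed_mono[OF LC pr] mm2 m2m' by simp
    ultimately show ?thesis using proposed_unique(1)[OF T(3)] by blast
  qed
  ultimately show ?thesis using k1 unfolding has_delivered_def by auto
qed

lemma forward_handled:
  assumes "act E l = Handle L (On i (Signed i (FORWARD x)))" "no_timeout (Suc l)"
  shows "\<exists>k. proposed (Suc l) k x"
proof -
  obtain r where r: "move l L r" using handle_moves[OF assms(1) LC] by blast
  from r assms(1) have "status (st l L) = Normal \<and> outbox r =
    map (\<lambda>j. (j, Signed L (PREPREPARE (curr_view (st l L)) (next_pos (st l L)) x)))
      [1..<num_procs P + 1]"
    by (cases rule: local_move_cases) (simp_all del: upt_Suc)
  moreover from this have "curr_view (st l L) = 1"
    using normal_at[OF LC _ LC] no_timeout_le[OF assms(2)] by simp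
  ultimately have "(L, Signed L (PREPREPARE 1 (next_pos (st l L)) x)) \<in> set (outbox r)"
    using leader_in_procs[of P 1] by (auto simp: procs_def simp del: upt_Suc)
  then show ?thesis using proposed_move[OF LC r] by blast
qed

text \<open>A FORWARD left over in a quiescent normal leader is blocked only because the value is in
  its log, and whatever is logged was proposed.\<close>

lemma forward_proposed:
  assumes "(i, Signed i (FORWARD x)) \<in># inbox (st m L) \<or> (\<exists>k. proposed m k x)"
    and "at_end T m" "no_timeout m" "status (st m L) = Normal" "valid P x"
  shows "\<exists>k. proposed m k x"
proof (cases "\<exists>k. cur_log (st m L) k = Some x")
  case True
  then show ?thesis using soundD(1)[OF sound_now[OF assms(3) LC]] by blast
next
  case False
  have "curr_view (st m L) = 1" using normal_at[OF LC assms(3) LC assms(4)] .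
  then have "(i, Signed i (FORWARD x)) \<notin># inbox (st m L)"
    using quiescentD[OF assms(2) LC, of "On i (Signed i (FORWARD x))"] False assms(4,5) by auto
  then show ?thesis using assms(1) by blast
qed

lemma broadcast_handled:
  assumes "act E m = Handle i (On j' (Signed j (BROADCAST x)))" "i \<in> C" "no_timeout (Suc m)"
  shows "timely (Suc m) i L (Signed i (FORWARD x))" and "status (st m i) = Normal" and "valid P x"
    and "i = L \<Longrightarrow> (L, Signed L (FORWARD x)) \<in># inbox (st (Suc m) L)"
    and "now E (Suc m) = now E m"
proof -
  obtain r where r: "move m i r" "st (Suc m) i = r\<lparr>inbox := inbox r + own i r\<rparr>"
    using handle_moves[OF assms(1,2)] by blast
  from r(1) assms(1) have o: "valid P x \<and> status (st m i) = Normal \<and>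
    outbox r = [(leader P (curr_view (st m i)), Signed i (FORWARD x))]"
    by (cases rule: local_move_cases) (simp_all del: upt_Suc)
  note ntm = no_timeout_le[OF assms(3), of m]
  have cv: "curr_view (st m i) = 1" using normal_at[OF LC ntm assms(2)] o by simp
  have "gst E \<le> now E m" using view_1_gst[OF ntm assms(2) cv] by simp
  then show "timely (Suc m) i L (Signed i (FORWARD x))"
    using timely_new[OF assms(2) r(1)] o cv by simp
  show "status (st m i) = Normal" "valid P x" using o by auto
  show "now E (Suc m) = now E m" using move_now(1)[OF assms(2) r(1)] .
  show "(L, Signed L (FORWARD x)) \<in># inbox (st (Suc m) L)" if "i = L"
    using r(2) o cv that by simp
qed

text \<open>Closes the circle: the facts that hold below \<open>m\<close> show that the timer which
  would fire at step \<open>m\<close> has been stopped by then.\<close>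

lemma no_timeout_ever: "no_timeout m"
proof (induction m)
  case 0
  show ?case by (simp add: no_timeout_def)
next
  case (Suc m)
  have "act E m \<noteq> Input i Timeout" if i: "i \<in> C" for i
  proof
    assume a: "act E m = Input i Timeout"
    from Suc i a show False
    proof (cases rule: first_timeout)
      case (rec m0)
      have ntm0: "no_timeout (Suc m0)" using no_timeout_le[OF Suc] rec(1) by simp
      have now0: "now E (Suc m0) = now E m0" using enters_now[OF i rec(2)] .
      have cv0: "curr_view (st (Suc m0) i) = 1" using enters_curr_view[OF i rec(2) ntm0] by simp
      \<comment> \<open>Within \<open>2 * d\<close> of one entry everyone, in particular the leader,
        is in view 1, and NEW_STATE takes one more \<open>d\<close>. In normal status the recovery
        timer is off.\<close>
      obtain m2 where m2: "at_end (now E m0 + 2 * d) m2" "m0 \<le> m2"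
        using at_end_exists[of m0 "now E m0 + 2 * d"] d_pos by auto
      obtain m3 where m3: "at_end (now E m0 + 3 * d) m3" "m0 \<le> m3"
        using at_end_exists[of m0 "now E m0 + 3 * d"] d_pos by auto
      have m2m: "m2 < m" using at_end_before[OF m2(1), of m] rec(5) d_pos by simp
      have m3m: "m3 < m" using at_end_before[OF m3(1), of m] rec(5) d_pos by simp
      note nt2 = no_timeout_le[OF Suc less_imp_le[OF m2m]]
      note nt3 = no_timeout_le[OF Suc less_imp_le[OF m3m]]
      have cv2: "curr_view (st m2 k) = 1" if "k \<in> C" for k
        using view_1_spreads[OF i cv0 _ m2(1) nt2 that] now0 by simp
      have m23: "m2 \<le> m3"
        using at_end_after[OF m3(1), of m2] m2(1) d_pos by (simp add: at_end_def)
      have "curr_view (st m3 i) = 1" using curr_view_mono[OF nt3 i m23 cv2[OF i]] .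
      then have "status (st m3 i) = Normal"
        using normal_arrives[OF LC cv2[OF LC] _ m3(1) nt3 i] m2(1) by (simp add: at_end_def)
      then have "status (st m i) = Normal" using state_mono(1)[OF LC Suc i less_imp_le[OF m3m]] by simp
      then show False using soundD(9)[OF sound_now[OF Suc i]] rec(4) by simp
    next
      case (del m0 m1 j' j x)
      have m1m: "Suc m1 \<le> m" using del(2) by simp
      note nt1 = no_timeout_le[OF Suc m1m]
      note b = broadcast_handled[OF del(7) i nt1]
      have ntm1: "no_timeout m1" using no_timeout_le[OF nt1] by simp
      \<comment> \<open>Process \<open>i\<close> is already normal when it starts the timer, so the
        leader has entered by then. Everyone else follows within \<open>2 * d\<close>, just when the
        proposal is due.\<close>
      have cvL: "curr_view (st m1 L) = 1" using normal_leader[OF LC ntm1 i b(2)] .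
      obtain n1 where n1: "at_end (now E m1 + d) n1" "m1 \<le> n1"
        using at_end_exists[of m1 "now E m1 + d"] d_pos by auto
      obtain n2 where n2: "at_end (now E m1 + 2 * d) n2" "m1 \<le> n2"
        using at_end_exists[of m1 "now E m1 + 2 * d"] d_pos by auto
      obtain n4 where n4: "at_end (now E m1 + 4 * d) n4" "m1 \<le> n4"
        using at_end_exists[of m1 "now E m1 + 4 * d"] d_pos by auto
      have n1m: "n1 < m" using at_end_before[OF n1(1), of m] del(6) d_pos by simp
      have n2m: "n2 < m" using at_end_before[OF n2(1), of m] del(6) d_pos by simp
      have n4m: "n4 < m" using at_end_before[OF n4(1), of m] del(6) d_pos by simp
      note ntn1 = no_timeout_le[OF Suc less_imp_le[OF n1m]]
      note ntn2 = no_timeout_le[OF Suc less_imp_le[OF n2m]]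
      note ntn4 = no_timeout_le[OF Suc less_imp_le[OF n4m]]
      have normL: "status (st n1 L) = Normal"
        using normal_arrives[OF LC cvL _ n1(1) ntn1 LC] curr_view_mono[OF ntn1 LC n1(2) cvL] by simp
      have "curr_view (st n2 k) = 1" if "k \<in> C" for k
        using view_1_spreads[OF LC cvL _ n2(1) ntn2 that] by simp
      then have norm: "status (st n2 k) = Normal" if "k \<in> C" for k
        using normal_arrives[OF LC cvL _ n2(1) ntn2 that] that d_pos by simp
      have "timely (Suc m1) i L (Signed i (FORWARD x)) \<or> (\<exists>k. proposed (Suc m1) k x)"
        using b(1) by blast
      then have "(i, Signed i (FORWARD x)) \<in># inbox (st n1 L) \<or> (\<exists>k. proposed n1 k x)"
      proof (rule arrives[OF i LC _ _ n1(1)])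
        show "now E (Suc m1) + d \<le> now E m1 + d" using b(5) by simp
        fix l assume l: "l < n1"
        show "\<exists>k. proposed (Suc l) k x" if "\<exists>k. proposed l k x"
          using that proposed_mono[OF LC, of _ _ l "Suc l"] by auto
        show "\<exists>k. proposed (Suc l) k x" if "act E l = Handle L (On i (Signed i (FORWARD x)))"
          using forward_handled[OF that no_timeout_le[OF ntn1]] l by simp
      qed
      then obtain k where k: "proposed n1 k x"
        using forward_proposed[OF _ n1(1) ntn1 normL b(3)] by blast
      have "now E n1 + d \<le> now E m1 + 2 * d" using n1(1) by (simp add: at_end_def)
      then have "has_delivered (st n4 i) x"
        using proposal_delivered[OF k _ n2(1) norm _ n4(1) ntn4 i] by simp
      then have "has_delivered (st m i) x" using state_mono(3)[OF LC Suc i less_imp_le[OF n4m]] by simp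
      then show False using soundD(7)[OF sound_now[OF Suc i]] del(5) by simp
    qed
  qed
  then show ?case using Suc unfolding no_timeout_def by (metis less_Suc_eq)
qed

text \<open>Besides the delivery of \<open>x\<close>, only entering a view or a timeout stops this
  timer, and neither can happen any more.\<close>

lemma timer_stays:
  assumes "timer_delivery (st m L) x \<noteq> None \<or> has_delivered (st m L) x"
  shows "timer_delivery (st (Suc m) L) x \<noteq> None \<or> has_delivered (st (Suc m) L) x"
proof (cases "has_delivered (st m L) x")
  case True
  then show ?thesis using state_Suc(3)[OF LC no_timeout_ever LC] by blast
next
  case False
  then have t: "timer_delivery (st m L) x \<noteq> None" using assms by blast
  then have "curr_view (st m L) \<noteq> 0" using view_zero_idle(2)[OF LC, of m x] by metis
  then have sv: "sync_view (st m L) = 1"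
    using early_curr_view[OF no_timeout_ever LC, of m] by simp
  show ?thesis
    using LC
  proof (cases rule: state_cases[where m = m])
    case (move r)
    have sv': "sync_view r \<le> 1"
      using early_curr_view[OF no_timeout_ever LC, of "Suc m"] move(3) by simp
    have "timer_delivery r x \<noteq> None \<or> has_delivered r x"
      using move(1)
    proof (cases rule: local_move_cases)
      case (wish j v)
      then show ?thesis using t sv sv' by (auto simp: on_wish_fields2)
    next
      case (forward j' j y)
      have "timer_delivery r x = timer_delivery (st m L) x" unfolding forward(7) by simp
      then show ?thesis using t by simp
    next
      case (new_leaders v M l)
      have "timer_delivery r x = timer_delivery (st m L) x" unfolding new_leaders(8) by simp
      then show ?thesis using t by simp
    next
      case timeout
      then show ?thesis using no_timeout_act[OF no_timeout_ever _ LC, of m "Suc m"] by simp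
    next
      case (deliver y)
      then show ?thesis using t by (auto simp: has_delivered_def)
    qed (use t in \<open>auto simp: move_simps simp del: upt_Suc split: if_splits\<close>)
    then show ?thesis unfolding move(3) by (simp add: has_delivered_def)
  qed (use t in auto)
qed

lemma broadcast_delivered:
  assumes T_defined: "\<forall>i \<in> C. leave_zero_times E i \<noteq> {}"
    and a: "act E m = Input i (Broadcast x)" and i: "i \<in> C" and g: "gst E \<le> now E m" and j: "j \<in> C"
  shows "delivers_by E j x (max (now E m) (T_last_zero E + d) + 4 * d)"
proof -
  define T where "T = max (now E m) (T_last_zero E + d)"
  have mT: "now E m \<le> T" "T_last_zero E + d \<le> T" by (auto simp: T_def)
  note nt = no_timeout_ever
  obtain r where r: "move m i r"
    using step[of m] unfolding a step.simps by (blast intro: local_move.input)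
  have v: "valid P x" "x \<noteq> nop P" "\<And>k. k \<in> procs P \<Longrightarrow> (k, Signed i (BROADCAST x)) \<in> set (outbox r)"
    using r a by (cases rule: local_move_cases; auto simp: procs_def simp del: upt_Suc)+
  have sent: "timely (Suc m) i L (Signed i (BROADCAST x))"
    using timely_new[OF i r v(3)] g C_procs[OF LC] by blast
  have now: "now E (Suc m) = now E m" using move_now(1)[OF i r] .
  obtain n0 where n0: "at_end T n0" using at_end_exists[OF mT(1)] by blast
  have ge: "now E n0 \<le> T + c * d" if "0 \<le> c" for c
    using n0 that d_pos by (simp add: at_end_def add_increasing2)
  obtain n1 where n1: "at_end (T + d) n1" "n0 \<le> n1"
    using at_end_exists[OF ge[of 1, simplified]] by blast
  obtain n2 where n2: "at_end (T + 2 * d) n2" "n0 \<le> n2"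
    using at_end_exists[OF ge[of 2, simplified]] by blast
  obtain n4 where n4: "at_end (T + 4 * d) n4" "n0 \<le> n4"
    using at_end_exists[OF ge[of 4, simplified]] by blast
  have cv0: "curr_view (st n0 k) = 1" if "k \<in> C" for k
    using view_1_by_T_last_zero[OF T_defined n0 mT(2) nt that] .
  have now0: "now E n0 \<le> T" using n0 by (simp add: at_end_def)
  \<comment> \<open>The NEW_STATE and the BROADCAST travel during the same delay, so reaching normal
    status costs no extra time.\<close>
  have norm1: "status (st n1 k) = Normal" if "k \<in> C" for k
    using normal_arrives[OF LC cv0[OF LC] _ n1(1) nt that]
      curr_view_mono[OF nt that n1(2) cv0[OF that]] now0 by simp
  have norm2: "status (st n2 k) = Normal" if "k \<in> C" for k
    using normal_arrives[OF LC cv0[OF LC] _ n2(1) nt that]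
      curr_view_mono[OF nt that n2(2) cv0[OF that]] now0 d_pos by simp
  \<comment> \<open>The leader may have handled this copy or an earlier one from another sender.
    Either way a running timer or a delivery remains as a trace.\<close>
  let ?R = "\<lambda>l. timer_delivery (st l L) x \<noteq> None \<or> has_delivered (st l L) x"
  have "timely (Suc m) i L (Signed i (BROADCAST x)) \<or> ?R (Suc m)" using sent by blast
  then have "(i, Signed i (BROADCAST x)) \<in># inbox (st n1 L) \<or> ?R n1"
  proof (rule arrives[OF i LC _ _ n1(1)])
    show "now E (Suc m) + d \<le> T + d" using now mT by simp
    show "?R (Suc l)" if "?R l" for l using timer_stays[OF that] .
    fix l assume b: "act E l = Handle L (On i (Signed i (BROADCAST x)))"
    obtain r' where r': "move l L r'" "st (Suc l) L = r'\<lparr>inbox := inbox r' + own L r'\<rparr>"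
      using handle_moves[OF b LC] by blast
    have "timer_delivery r' x \<noteq> None" using r'(1) b by (cases rule: local_move_cases) auto
    then show "?R (Suc l)" using r'(2) by simp
  qed
  then have "?R n1"
    using quiescentD[OF n1(1) LC, of "On i (Signed i (BROADCAST x))"] v(1) norm1[OF LC] by auto
  then have "\<exists>k. proposed n1 k x"
  proof
    assume t: "timer_delivery (st n1 L) x \<noteq> None"
    then obtain \<delta> where \<delta>: "timer_delivery (st n1 L) x = Some \<delta>" by blast
    have "curr_view (st n1 L) > 0" using normal_at[OF LC nt LC norm1[OF LC]] by simp
    \<comment> \<open>The timer leads back to the step that started it, at which the leader also
      forwarded \<open>x\<close> to itself.\<close>
    from entered[OF nt LC this] \<delta> obtain m1 j' j where m1: "m1 < n1"
      "act E m1 = Handle L (On j' (Signed j (BROADCAST x)))" by metis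
    have "(L, Signed L (FORWARD x)) \<in># inbox (st (Suc m1) L) \<or> (\<exists>k. proposed (Suc m1) k x)"
      using broadcast_handled(4)[OF m1(2) LC nt] by blast
    then have "(L, Signed L (FORWARD x)) \<in># inbox (st n1 L) \<or> (\<exists>k. proposed n1 k x)"
    proof (rule inbox_until[OF LC])
      show "Suc m1 \<le> n1" using m1(1) by simp
      show "\<exists>k. proposed (Suc l) k x" if "\<exists>k. proposed l k x" for l
        using that proposed_mono[OF LC, of _ _ l "Suc l"] by auto
      show "\<exists>k. proposed (Suc l) k x" if "act E l = Handle L (On L (Signed L (FORWARD x)))" for l
        using forward_handled[OF that nt] .
    qed
    then show ?thesis using forward_proposed[OF _ n1(1) nt norm1[OF LC] v(1)] by blast
  next
    assume "has_delivered (st n1 L) x"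
    then show ?thesis using soundD(5)[OF sound_now[OF nt LC]] unfolding has_delivered_def by blast
  qed
  then obtain k where k: "proposed n1 k x" by blast
  have "now E n1 + d \<le> T + 2 * d" using n1(1) by (simp add: at_end_def)
  then have "has_delivered (st n4 j) x"
    using proposal_delivered[OF k _ n2(1) norm2 _ n4(1) nt j] by simp
  then obtain l where "l < n4" "occurs E l j (Delivers x)"
    using delivered_before[OF LC nt j _ v(2)] by blast
  moreover from this have "now E l \<le> T + 4 * d"
    using n4(1) now_mono[of l n4] by (simp add: at_end_def)
  ultimately show ?thesis unfolding delivers_by_def T_def by blast
qed

end

end

text \<open>That each correct process enters view 1 is a conjunct of its own, because
  \<open>E_last\<close> is a supremum over the entries that do occur and would not bound a missing
  one.\<close>

theorem theorem9:
  fixes P :: "('x, 'h) protocol" and E :: "('x, 'h) run"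
  assumes params: "protocol_params P"
    and exec: "execution P E"
    and T_defined: "\<forall>i \<in> correct E. leave_zero_times E i \<noteq> {}"
    and starts: "\<forall>i \<in> correct E. starts_after_gst E i"
    and recovery: "\<forall>i \<in> correct E. dur_recovery (local_state (conf E 0) i) > 5 * delta E"
    and delivery: "\<forall>i \<in> correct E. dur_delivery (local_state (conf E 0) i) > 4 * delta E"
  shows "stable_view P E = 1 \<and>
    (\<forall>i \<in> correct E. \<exists>m. occurs E m i (Enters 1)) \<and>
    E_last E 1 \<le> T_last_zero E + delta E \<and>
    (\<forall>m i x. act E m = Input i (Broadcast x) \<and> i \<in> correct E \<and> gst E \<le> now E m \<and>
       leader P 1 \<in> correct E \<longrightarrow>
       (\<forall>j \<in> correct E.
          delivers_by E j x (max (now E m) (T_last_zero E + delta E) + 4 * delta E)))"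
proof -
  interpret pbft_run P E
    using params exec starts recovery delivery by unfold_locales
  show ?thesis
  proof (intro conjI allI impI ballI)
    show "stable_view P E = 1" by (rule stable_view_eq_1)
    show "\<exists>m. occurs E m i (Enters 1)" if "i \<in> correct E" for i
      using enters_view_1[OF T_defined that] by metis
    show "E_last E 1 \<le> T_last_zero E + delta E" by (rule E_last_le[OF T_defined])
    show "delivers_by E j x (max (now E m) (T_last_zero E + delta E) + 4 * delta E)"
      if "act E m = Input i (Broadcast x) \<and> i \<in> correct E \<and> gst E \<le> now E m \<and>
        leader P 1 \<in> correct E" "j \<in> correct E" for m i x j
      using broadcast_delivered[OF _ T_defined] that by metis
  qed
qed

end
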